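(* Let $\mu_1,\mu_2$ be two distinct complex numbers and $n_1,n_2$ two positive integers such that $n_1+n_2=n$. Let $\{E^i_j\}_{i,j=1}^n$ be the set of generators of the algebra $\mathcal{U}(gl(n,\mathbb{C}))[t]$ subject to the relations $$E^i_jE^m_n-E^m_nE^i_j=t\,(\delta^m_jE^i_n-\delta^i_nE^m_j)$$ (here $i,j,m,n$ denote running indices). The quotient of $\mathcal{U}(gl(n,\mathbb{C}))[t]$ with respect to the ideal generated by the relations $$(E-\mu_1)(E-\mu_2)=0,\qquad \mathrm{Tr}(E)=n_1\mu_1+n_2\mu_2+t\,n_1n_2$$ is the quantization of the Kirillov–Kostant–Souriau bracket on the symmetric orbit $O_{[n_1,n_2;\mu_1,\mu_2]}$. It is equivariant with respect to the adjoint action of $\mathcal{U}(gl(n,\mathbb{C}))$.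
   Context: $\mathcal{U}(gl(n,\mathbb{C}))[t]$ denotes the associative algebra over $\mathbb{C}[t]$ generated by the $E^i_j$ with the commutation relations in the claim. $E=\sum_{i,j}E^i_je^j_i$ is the matrix of generators, where $e^i_j$ are the matrix units with $e^i_je^l_k=\delta^l_je^i_k$; thus the coefficient of $e^j_m$ in $E^2$ is $\sum_iE^i_jE^m_i$ (in this order), and the matrix equation means that all $n^2$ entries vanish. $\mathrm{Tr}(E)=\sum_iE^i_i$. $O_{[n_1,n_2;\mu_1,\mu_2]}\subset\mathrm{End}(\mathbb{C}^n)$ is the $GL(n,\mathbb{C})$-conjugation orbit of the diagonal matrix with eigenvalues $\mu_1,\mu_2$ of multiplicities $n_1,n_2$. Identify $\mathrm{End}(\mathbb{C}^n)$ with $gl(n,\mathbb{C})^*$ by the trace pairing, so that $E^i_j$ corresponds to the linear function $A\mapsto\mathrm{Tr}(e^i_jA)$. The Poisson–Lie bracket on $gl(n,\mathbb{C})^*$ is $\{X,Y\}=[X,Y]$ for linear functions $X,Y\in gl(n,\mathbb{C})$; its restriction to the orbit is the Kirillov–Kostant–Souriau bracket. A quantization of this bracket is a flat deformation of the polynomial function algebra on the orbit with (formal) deformation parameter $t$, equal to the function algebra at $t=0$ and such that $\frac1t(ab-ba)\bmod t$ is the bracket. Equivariance: it is a $\mathcal{U}(gl(n,\mathbb{C}))$-module algebra for the action induced by the adjoint action. *)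

theory Defs
  imports
    "HOL-Analysis.Analysis"
    "HOL-Algebra.QuotRing"
    "HOL-Computational_Algebra.Polynomial"
    "HOL-Library.Poly_Mapping"
begin

text \<open>
  The free algebra over a commutative ring \<open>'r\<close> on generators \<open>'x\<close> is the monoid algebra
  \<open>'x list \<Rightarrow>\<^sub>0 'r\<close> of the free monoid of words; the convolution product of
  \<^theory>\<open>HOL-Library.Poly_Mapping\<close> expects the monoid operation in additive notation.
\<close>

instantiation list :: (type) monoid_add
begin
definition zero_list_def: "0 = []"
definition plus_list_def: "xs + ys = xs @ ys"
instance by standard (simp_all add: zero_list_def plus_list_def)
end

definition free_algebra :: "('x list \<Rightarrow>\<^sub>0 'r::comm_ring_1) ring"
  where "free_algebra = \<lparr>carrier = UNIV, mult = (*), one = 1, zero = 0, add = (+)\<rparr>"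

lemma ring_free_algebra: "ring (free_algebra :: ('x list \<Rightarrow>\<^sub>0 'r::comm_ring_1) ring)"
proof -
  have "\<exists>y. x + y = 0" for x :: "'x list \<Rightarrow>\<^sub>0 'r"
    using add.right_inverse by blast
  moreover have "\<exists>y. y + x = 0 \<and> x + y = 0" for x :: "'x list \<Rightarrow>\<^sub>0 'r"
    by (rule exI[of _ "- x"]) simp
  ultimately show ?thesis
    unfolding free_algebra_def
    by unfold_locales (auto simp: algebra_simps Units_def)
qed

definition const :: "'r \<Rightarrow> ('x list \<Rightarrow>\<^sub>0 'r::comm_ring_1)"
  where "const c = Poly_Mapping.single [] c"

definition monomial :: "'x list \<Rightarrow> ('x list \<Rightarrow>\<^sub>0 'r::comm_ring_1)"
  where "monomial w = Poly_Mapping.single w 1"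


section \<open>The algebras \<open>U(gl(n))[t]\<close> and \<open>U(gl(n))\<close>\<close>

text \<open>\<open>gen i j\<close> is the generator with upper index \<open>i\<close> and lower index \<open>j\<close>.\<close>

definition gen :: "'n \<Rightarrow> 'n \<Rightarrow> (('n \<times> 'n) list \<Rightarrow>\<^sub>0 'r::comm_ring_1)"
  where "gen i j = monomial [(i, j)]"

definition gl_bracket :: "'n \<Rightarrow> 'n \<Rightarrow> 'n \<Rightarrow> 'n \<Rightarrow> (('n \<times> 'n) list \<Rightarrow>\<^sub>0 'r::comm_ring_1)"
  where "gl_bracket i j m k = (if m = j then gen i k else 0) - (if i = k then gen m j else 0)"

definition gl_relations :: "'r \<Rightarrow> (('n \<times> 'n) list \<Rightarrow>\<^sub>0 'r::comm_ring_1) set"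
  where "gl_relations s =
    {gen i j * gen m k - gen m k * gen i j - const s * gl_bracket i j m k | i j m k. True}"

text \<open>
  The commutators of the generators are scaled by \<open>s\<close>.  Thus \<open>env_algebra [:0, 1:]\<close>, over
  \<open>complex poly\<close>, is \<open>U(gl(n,\<complex>))[t]\<close>, and \<open>env_algebra 1\<close>, over \<open>complex\<close>, is \<open>U(gl(n,\<complex>))\<close>.
\<close>

definition env_algebra :: "'r \<Rightarrow> (('n \<times> 'n) list \<Rightarrow>\<^sub>0 'r::comm_ring_1) set ring"
  where "env_algebra s = free_algebra Quot (Idl\<^bsub>free_algebra\<^esub> (gl_relations s))"

definition env_class ::
    "'r \<Rightarrow> (('n \<times> 'n) list \<Rightarrow>\<^sub>0 'r::comm_ring_1) \<Rightarrow> (('n \<times> 'n) list \<Rightarrow>\<^sub>0 'r) set"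
  where "env_class s x = Idl\<^bsub>free_algebra\<^esub> (gl_relations s) +>\<^bsub>free_algebra\<^esub> x"

lemma ideal_gl_relations:
  "ideal (Idl\<^bsub>free_algebra\<^esub> (gl_relations s :: (('n \<times> 'n) list \<Rightarrow>\<^sub>0 'r::comm_ring_1) set)) free_algebra"
  by (rule ring.genideal_ideal[OF ring_free_algebra]) (simp add: free_algebra_def)

lemma ring_env_algebra:
  "ring (env_algebra s :: (('n \<times> 'n) list \<Rightarrow>\<^sub>0 'r::comm_ring_1) set ring)"
  unfolding env_algebra_def by (rule ideal.quotient_is_ring[OF ideal_gl_relations])

lemma env_class_ring_hom:
  "env_class s \<in> ring_hom (free_algebra :: (('n \<times> 'n) list \<Rightarrow>\<^sub>0 'r::comm_ring_1) ring) (env_algebra s)"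
  using ideal.rcos_ring_hom[OF ideal_gl_relations, of s]
  unfolding env_algebra_def env_class_def[abs_def] .


section \<open>The quotient algebra\<close>

type_synonym 'n word_poly = "('n \<times> 'n) list \<Rightarrow>\<^sub>0 complex poly"

abbreviation t_poly :: "complex poly" where "t_poly \<equiv> [:0, 1:]"

text \<open>
  Since the matrix unit \<open>e\<^sup>j\<^sub>i\<close> sits in row \<open>j\<close> and column \<open>i\<close>, so does the generator \<open>E\<^sup>i\<^sub>j\<close>
  in the matrix \<open>E\<close>.
\<close>

definition gen_matrix :: "'n word_poly ^ 'n ^ ('n::finite)"
  where "gen_matrix = (\<chi> j i. gen i j)"

definition orbit_relations :: "complex \<Rightarrow> complex \<Rightarrow> nat \<Rightarrow> nat \<Rightarrow> ('n::finite) word_poly set"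
  where "orbit_relations \<mu>1 \<mu>2 n1 n2 =
    {((gen_matrix - mat (const [:\<mu>1:])) ** (gen_matrix - mat (const [:\<mu>2:]))) $ j $ m | j m. True}
    \<union> {trace gen_matrix
        - const ([:of_nat n1 * \<mu>1 + of_nat n2 * \<mu>2:] + t_poly * of_nat (n1 * n2))}"

definition orbit_ideal :: "complex \<Rightarrow> complex \<Rightarrow> nat \<Rightarrow> nat \<Rightarrow> ('n::finite) word_poly set set"
  where "orbit_ideal \<mu>1 \<mu>2 n1 n2 =
    Idl\<^bsub>env_algebra t_poly\<^esub> (env_class t_poly ` orbit_relations \<mu>1 \<mu>2 n1 n2)"

definition quotient_algebra ::
    "complex \<Rightarrow> complex \<Rightarrow> nat \<Rightarrow> nat \<Rightarrow> ('n::finite) word_poly set set ring"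
  where "quotient_algebra \<mu>1 \<mu>2 n1 n2 = env_algebra t_poly Quot orbit_ideal \<mu>1 \<mu>2 n1 n2"

text \<open>The class in the quotient of a (noncommutative) polynomial in the generators.\<close>

definition quotient_class ::
    "complex \<Rightarrow> complex \<Rightarrow> nat \<Rightarrow> nat \<Rightarrow> ('n::finite) word_poly \<Rightarrow> 'n word_poly set set"
  where "quotient_class \<mu>1 \<mu>2 n1 n2 x =
    orbit_ideal \<mu>1 \<mu>2 n1 n2 +>\<^bsub>env_algebra t_poly\<^esub> env_class t_poly x"

definition quotient_scalar ::
    "complex \<Rightarrow> complex \<Rightarrow> nat \<Rightarrow> nat \<Rightarrow> complex poly \<Rightarrow> ('n::finite) word_poly set set"
  where "quotient_scalar \<mu>1 \<mu>2 n1 n2 p = quotient_class \<mu>1 \<mu>2 n1 n2 (const p)"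

lemma ideal_orbit_ideal:
  "ideal (orbit_ideal \<mu>1 \<mu>2 n1 n2 :: ('n::finite) word_poly set set) (env_algebra t_poly)"
  unfolding orbit_ideal_def
  by (rule ring.genideal_ideal[OF ring_env_algebra])
     (use ring_hom_closed[OF env_class_ring_hom] in \<open>auto simp: free_algebra_def\<close>)

lemma ring_quotient_algebra:
  "ring (quotient_algebra \<mu>1 \<mu>2 n1 n2 :: ('n::finite) word_poly set set ring)"
  unfolding quotient_algebra_def by (rule ideal.quotient_is_ring[OF ideal_orbit_ideal])


section \<open>The orbit, its function algebra and its Poisson bracket\<close>

text \<open>
  The index type carries no order, so the position of the eigenvalue \<open>\<mu>1\<close> on the diagonal is an
  arbitrary set \<open>S\<close> of size \<open>n1\<close>; all these diagonal matrices are conjugate to each other.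
\<close>

definition orbit :: "complex \<Rightarrow> complex \<Rightarrow> nat \<Rightarrow> nat \<Rightarrow> (complex ^ 'n ^ ('n::finite)) set"
  where "orbit \<mu>1 \<mu>2 n1 n2 =
    {g ** (\<chi> i j. if i = j then (if i \<in> S then \<mu>1 else \<mu>2) else 0) ** matrix_inv g
       | (g :: complex ^ 'n ^ 'n) S.
       invertible g \<and> card S = n1 \<and> card (- S) = n2}"

inductive_set poly_functions :: "((complex ^ 'n ^ ('n::finite)) \<Rightarrow> complex) set" where
  "(\<lambda>A. c) \<in> poly_functions"
| "(\<lambda>A. A $ i $ j) \<in> poly_functions"
| "f \<in> poly_functions \<Longrightarrow> g \<in> poly_functions \<Longrightarrow> (\<lambda>A. f A + g A) \<in> poly_functions"
| "f \<in> poly_functions \<Longrightarrow> g \<in> poly_functions \<Longrightarrow> (\<lambda>A. f A * g A) \<in> poly_functions"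

definition function_algebra ::
    "(complex ^ 'n ^ ('n::finite)) set \<Rightarrow> ((complex ^ 'n ^ 'n) \<Rightarrow> complex) ring"
  where "function_algebra X = \<lparr>carrier = (\<lambda>f. restrict f X) ` poly_functions,
    mult = (\<lambda>f g. \<lambda>A\<in>X. f A * g A), one = (\<lambda>A\<in>X. 1),
    zero = (\<lambda>A\<in>X. 0), add = (\<lambda>f g. \<lambda>A\<in>X. f A + g A)\<rparr>"

definition const_function :: "(complex ^ 'n ^ ('n::finite)) set \<Rightarrow> complex \<Rightarrow> complex ^ 'n ^ 'n \<Rightarrow> complex"
  where "const_function X c = (\<lambda>A\<in>X. c)"

definition matrix_unit :: "'n \<Rightarrow> 'n \<Rightarrow> complex ^ 'n ^ ('n::finite)"
  where "matrix_unit i j = (\<chi> r c. if r = i \<and> c = j then 1 else 0)"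

text \<open>The linear function on matrices given by an element \<open>X\<close> of \<open>gl(n)\<close> under the trace pairing.\<close>

definition trace_function :: "complex ^ 'n ^ ('n::finite) \<Rightarrow> complex ^ 'n ^ 'n \<Rightarrow> complex"
  where "trace_function X A = trace (X ** A)"

text \<open>
  The differential of \<open>f\<close> at \<open>A\<close> as an element of \<open>gl(n)\<close>: it is
  \<open>\<Sum>\<^sub>i\<^sub>,\<^sub>j (\<partial>f/\<partial>E\<^sup>i\<^sub>j)(A) e\<^sup>i\<^sub>j\<close>, where the coordinate \<open>E\<^sup>i\<^sub>j\<close> of \<open>A\<close> is \<open>Tr (e\<^sup>i\<^sub>j A)\<close>, i.e. the
  entry of \<open>A\<close> in row \<open>j\<close> and column \<open>i\<close>, whence the direction \<open>e\<^sup>j\<^sub>i\<close> of differentiation.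
\<close>

definition differential ::
    "(complex ^ 'n ^ ('n::finite) \<Rightarrow> complex) \<Rightarrow> complex ^ 'n ^ 'n \<Rightarrow> complex ^ 'n ^ 'n"
  where "differential f A =
    (\<chi> i j. deriv (\<lambda>z. f (A + (\<chi> r c. z * matrix_unit j i $ r $ c))) 0)"

text \<open>
  The Poisson-Lie bracket \<open>{f, g}(A) = \<langle>A, [df\<^sub>A, dg\<^sub>A]\<rangle>\<close>.  The lemmas \<open>lie_poisson_linear\<close>,
  \<open>lie_poisson_antisym\<close>, \<open>lie_poisson_add\<close>, \<open>lie_poisson_Leibniz\<close> and \<open>lie_poisson_const\<close> below
  characterise it as the biderivation of polynomial functions that extends the commutator of linear
  functions.
\<close>

definition lie_poisson ::
    "(complex ^ 'n ^ ('n::finite) \<Rightarrow> complex) \<Rightarrow> (complex ^ 'n ^ 'n \<Rightarrow> complex) \<Rightarrow>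
      complex ^ 'n ^ 'n \<Rightarrow> complex"
  where "lie_poisson f g A =
    trace ((differential f A ** differential g A - differential g A ** differential f A) ** A)"

text \<open>
  The Kirillov-Kostant-Souriau bracket on \<open>X\<close>, as the restriction of the Poisson-Lie bracket: the
  bracket of two restrictions is the restriction of the bracket.  (On a union of conjugation orbits
  this does not depend on the polynomial extensions.)
\<close>

definition kks_bracket ::
    "(complex ^ 'n ^ ('n::finite)) set \<Rightarrow> (complex ^ 'n ^ 'n \<Rightarrow> complex) \<Rightarrow>
      (complex ^ 'n ^ 'n \<Rightarrow> complex) \<Rightarrow> complex ^ 'n ^ 'n \<Rightarrow> complex"
  where "kks_bracket X f g =
    (THE h. \<exists>F\<in>poly_functions. \<exists>G\<in>poly_functions.
       restrict F X = f \<and> restrict G X = g \<and> h = restrict (lie_poisson F G) X)"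

lemma differential_trace_function: "differential (trace_function X) A = X"
proof -
  have lin: "trace_function X (A + (\<chi> r c. z * matrix_unit j i $ r $ c)) =
      trace_function X A + z * X $ i $ j" for z i j
  proof -
    have "(\<Sum>r\<in>UNIV. \<Sum>c\<in>UNIV. X $ r $ c * (z * (if c = j \<and> r = i then 1 else 0)))
        = (\<Sum>r\<in>UNIV. if r = i then z * X $ i $ j else 0)"
      by (intro sum.cong refl) (auto simp: if_distrib cong: if_cong)
    also have "\<dots> = z * X $ i $ j" by simp
    finally show ?thesis
      by (simp add: trace_function_def trace_def matrix_matrix_mult_def matrix_unit_def
          distrib_left sum.distrib)
  qed
  have "((\<lambda>z. trace_function X A + z * X $ i $ j) has_field_derivative X $ i $ j) (at 0)" for i j
    by (auto intro!: derivative_eq_intros)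
  then have "deriv (\<lambda>z. trace_function X (A + (\<chi> r c. z * matrix_unit j i $ r $ c))) 0 = X $ i $ j" for i j
    unfolding lin by (rule DERIV_imp_deriv)
  then show ?thesis
    by (simp add: differential_def vec_eq_iff)
qed

lemma lie_poisson_linear:
  "lie_poisson (trace_function X) (trace_function Y) = trace_function (X ** Y - Y ** X)"
  by (rule ext) (simp add: lie_poisson_def differential_trace_function trace_function_def)

lemma lie_poisson_antisym: "lie_poisson f g A = - lie_poisson g f A"
  by (simp add: lie_poisson_def trace_def matrix_matrix_mult_def sum_negf[symmetric]
      left_diff_distrib sum_subtractf)

lemma poly_functions_line_differentiable:
  assumes "f \<in> poly_functions"
  shows "(\<lambda>z. f (A + (\<chi> r c. z * B r c))) field_differentiable at 0"
  using assms
proof induction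
  case (3 f g)
  then show ?case by (intro field_differentiable_add)
next
  case (4 f g)
  then show ?case by (intro field_differentiable_mult)
next
  case (2 i j)
  have "(\<lambda>z. A $ i $ j + z * B i j) field_differentiable at 0"
    by (intro derivative_intros)
  then show ?case by simp
qed (rule field_differentiable_const)

lemma differential_add:
  assumes "f \<in> poly_functions" "g \<in> poly_functions"
  shows "differential (\<lambda>A. f A + g A) A = differential f A + differential g A"
  using deriv_add[OF assms[THEN poly_functions_line_differentiable]]
  by (simp add: differential_def vec_eq_iff)

lemma differential_mult:
  assumes "f \<in> poly_functions" "g \<in> poly_functions"
  shows "differential (\<lambda>A. f A * g A) A $ i $ j =
    f A * differential g A $ i $ j + differential f A $ i $ j * g A"
proof -
  have "A + (\<chi> r c. 0) = A" by (simp add: vec_eq_iff)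
  then show ?thesis
    using deriv_mult[OF assms[THEN poly_functions_line_differentiable],
        of A "\<lambda>r c. matrix_unit j i $ r $ c" A "\<lambda>r c. matrix_unit j i $ r $ c"]
    by (simp add: differential_def)
qed

lemma lie_poisson_add:
  assumes "f \<in> poly_functions" "g \<in> poly_functions"
  shows "lie_poisson (\<lambda>A. f A + g A) h A = lie_poisson f h A + lie_poisson g h A"
  using assms
  by (simp add: lie_poisson_def differential_add trace_def matrix_matrix_mult_def
      algebra_simps sum.distrib sum_subtractf)

lemma lie_poisson_Leibniz:
  assumes "f \<in> poly_functions" "g \<in> poly_functions"
  shows "lie_poisson (\<lambda>A. f A * g A) h A = f A * lie_poisson g h A + lie_poisson f h A * g A"
  using assms
  by (simp add: lie_poisson_def differential_mult trace_def matrix_matrix_mult_def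
      algebra_simps sum.distrib sum_subtractf sum_distrib_left sum_distrib_right)

lemma lie_poisson_const: "lie_poisson (\<lambda>A. c) h A = 0"
  by (simp add: lie_poisson_def differential_def trace_def matrix_matrix_mult_def)


section \<open>Quantization\<close>

text \<open>
  The setting: an algebra \<open>Q\<close> over \<open>\<complex>[t]\<close> whose scalars are embedded by \<open>\<iota>\<close>, and a commutative algebra
  \<open>A\<close> over \<open>\<complex>\<close> whose scalars are embedded by \<open>\<kappa>\<close>.  Elements of \<open>A[[t]]\<close> are sequences of elements
  of \<open>A\<close>.

  The map \<open>\<phi>\<close> makes \<open>A[[t]]\<close> the \<open>t\<close>-adic completion of the module \<open>Q\<close>: it is \<open>\<complex>[t]\<close>-linear and
  induces bijections \<open>Q / t\<^sup>k Q \<rightarrow> A[[t]] / t\<^sup>k A[[t]]\<close> for all \<open>k\<close> (the map is well defined by linearity,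
  and the last two conjuncts say that it is injective and surjective).
\<close>

definition is_completion_map ::
    "('q, 'x) ring_scheme \<Rightarrow> (complex poly \<Rightarrow> 'q) \<Rightarrow> ('a, 'y) ring_scheme \<Rightarrow> (complex \<Rightarrow> 'a) \<Rightarrow>
      ('q \<Rightarrow> nat \<Rightarrow> 'a) \<Rightarrow> bool"
  where "is_completion_map Q \<iota> A \<kappa> \<phi> \<longleftrightarrow>
    (\<forall>q\<in>carrier Q. \<forall>i. \<phi> q i \<in> carrier A) \<and>
    (\<forall>p\<in>carrier Q. \<forall>q\<in>carrier Q. \<forall>i. \<phi> (p \<oplus>\<^bsub>Q\<^esub> q) i = \<phi> p i \<oplus>\<^bsub>A\<^esub> \<phi> q i) \<and>
    (\<forall>c. \<forall>q\<in>carrier Q. \<forall>i. \<phi> (\<iota> [:c:] \<otimes>\<^bsub>Q\<^esub> q) i = \<kappa> c \<otimes>\<^bsub>A\<^esub> \<phi> q i) \<and>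
    (\<forall>q\<in>carrier Q. \<phi> (\<iota> t_poly \<otimes>\<^bsub>Q\<^esub> q) 0 = \<zero>\<^bsub>A\<^esub> \<and>
       (\<forall>i. \<phi> (\<iota> t_poly \<otimes>\<^bsub>Q\<^esub> q) (Suc i) = \<phi> q i)) \<and>
    (\<forall>k. \<forall>q\<in>carrier Q. (\<forall>i<k. \<phi> q i = \<zero>\<^bsub>A\<^esub>) \<longrightarrow> (\<exists>q'\<in>carrier Q. q = \<iota> (t_poly ^ k) \<otimes>\<^bsub>Q\<^esub> q')) \<and>
    (\<forall>k. \<forall>f. (\<forall>i. f i \<in> carrier A) \<longrightarrow> (\<exists>q\<in>carrier Q. \<forall>i<k. \<phi> q i = f i))"

text \<open>
  \<open>Q\<close> is a quantization of the bracket \<open>B\<close> on \<open>A\<close>, where \<open>\<sigma>\<close> is the evaluation at \<open>t = 0\<close>: \<open>\<sigma>\<close> identifies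
  \<open>Q / t Q\<close> with \<open>A\<close> as an algebra; \<open>Q\<close> is a flat deformation with formal parameter \<open>t\<close>, i.e. its
  \<open>t\<close>-adic completion is the topologically free \<open>\<complex>[[t]]\<close>-module \<open>A[[t]]\<close>, compatibly with \<open>\<sigma>\<close>; and
  \<open>(ab - ba)/t\<close> modulo \<open>t\<close> is \<open>B\<close>.  In the last clause \<open>c\<close> is unique modulo \<open>t\<close>, by flatness.
  Flatness is formal: over \<open>\<complex>[t]\<close> itself such a quotient may have torsion at nonzero values of \<open>t\<close>.
\<close>

definition is_quantization ::
    "('q, 'x) ring_scheme \<Rightarrow> (complex poly \<Rightarrow> 'q) \<Rightarrow> ('a, 'y) ring_scheme \<Rightarrow> (complex \<Rightarrow> 'a) \<Rightarrow>
      ('a \<Rightarrow> 'a \<Rightarrow> 'a) \<Rightarrow> ('q \<Rightarrow> 'a) \<Rightarrow> bool"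
  where "is_quantization Q \<iota> A \<kappa> B \<sigma> \<longleftrightarrow>
    \<sigma> \<in> ring_hom Q A \<and>
    (\<forall>p. \<sigma> (\<iota> p) = \<kappa> (coeff p 0)) \<and>
    \<sigma> ` carrier Q = carrier A \<and>
    a_kernel Q A \<sigma> = {\<iota> t_poly \<otimes>\<^bsub>Q\<^esub> q | q. q \<in> carrier Q} \<and>
    (\<exists>\<phi>. is_completion_map Q \<iota> A \<kappa> \<phi> \<and> (\<forall>q\<in>carrier Q. \<phi> q 0 = \<sigma> q)) \<and>
    (\<forall>a\<in>carrier Q. \<forall>b\<in>carrier Q. \<exists>c\<in>carrier Q.
       a \<otimes>\<^bsub>Q\<^esub> b \<ominus>\<^bsub>Q\<^esub> b \<otimes>\<^bsub>Q\<^esub> a = \<iota> t_poly \<otimes>\<^bsub>Q\<^esub> c \<and> \<sigma> c = B (\<sigma> a) (\<sigma> b))"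


section \<open>Equivariance\<close>

text \<open>
  \<open>act\<close> makes the \<open>\<complex>[t]\<close>-algebra \<open>Q\<close> a module algebra over the Hopf algebra \<open>U(gl(n,\<complex>))\<close>, acting
  \<open>\<complex>[t]\<close>-linearly: \<open>u (a b) = \<Sum> (u\<^sub>1 a) (u\<^sub>2 b)\<close> and \<open>u 1 = \<epsilon>(u) 1\<close>.  The last two clauses state this for
  monomials \<open>u = x\<^sub>1 \<dots> x\<^sub>r\<close> in the generators, which span.  As the generators are primitive, the
  coproduct of \<open>u\<close> is the sum of \<open>x\<^sub>S \<otimes> x\<^sub>S\<^sub>'\<close> over all subsets \<open>S\<close> of positions, where \<open>S'\<close> is the
  complement of \<open>S\<close> and \<open>x\<^sub>S\<close> the subword at the positions in \<open>S\<close>; the counit kills all \<open>u\<close> with \<open>r > 0\<close>.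
\<close>

definition is_module_algebra ::
    "('q, 'x) ring_scheme \<Rightarrow> (complex poly \<Rightarrow> 'q) \<Rightarrow>
      ((('n \<times> 'n) list \<Rightarrow>\<^sub>0 complex) set \<Rightarrow> 'q \<Rightarrow> 'q) \<Rightarrow> bool"
  where "is_module_algebra Q \<iota> act \<longleftrightarrow>
    (let U = env_algebra (1::complex); x = (\<lambda>w. env_class (1::complex) (monomial w)) in
      (\<forall>u\<in>carrier U. \<forall>a\<in>carrier Q. act u a \<in> carrier Q) \<and>
      (\<forall>u\<in>carrier U. \<forall>v\<in>carrier U. \<forall>a\<in>carrier Q. act (u \<oplus>\<^bsub>U\<^esub> v) a = act u a \<oplus>\<^bsub>Q\<^esub> act v a) \<and>
      (\<forall>u\<in>carrier U. \<forall>a\<in>carrier Q. \<forall>b\<in>carrier Q. act u (a \<oplus>\<^bsub>Q\<^esub> b) = act u a \<oplus>\<^bsub>Q\<^esub> act u b) \<and>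
      (\<forall>u\<in>carrier U. \<forall>v\<in>carrier U. \<forall>a\<in>carrier Q. act (u \<otimes>\<^bsub>U\<^esub> v) a = act u (act v a)) \<and>
      (\<forall>c. \<forall>a\<in>carrier Q. act (env_class 1 (const c)) a = \<iota> [:c:] \<otimes>\<^bsub>Q\<^esub> a) \<and>
      (\<forall>u\<in>carrier U. \<forall>p. \<forall>a\<in>carrier Q. act u (\<iota> p \<otimes>\<^bsub>Q\<^esub> a) = \<iota> p \<otimes>\<^bsub>Q\<^esub> act u a) \<and>
      (\<forall>w. \<forall>a\<in>carrier Q. \<forall>b\<in>carrier Q.
         act (x w) (a \<otimes>\<^bsub>Q\<^esub> b) =
           (\<Oplus>\<^bsub>Q\<^esub>S\<in>Pow {..<length w}. act (x (nths w S)) a \<otimes>\<^bsub>Q\<^esub> act (x (nths w (- S))) b)) \<and>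
      (\<forall>w. act (x w) \<one>\<^bsub>Q\<^esub> = (if w = [] then \<one>\<^bsub>Q\<^esub> else \<zero>\<^bsub>Q\<^esub>)))"

end

theory Submission
  imports Defs "HOL-Library.Function_Algebras"
begin

text \<open>
  Write \<open>a\<close> for the generic matrix and \<open>\<Delta>\<^sub>S\<close> for the diagonal matrix with entry \<open>\<mu>1\<close> on \<open>S\<close> and \<open>\<mu>2\<close> off \<open>S\<close>.
  At \<open>t = 0\<close> the relations generate the full ideal of the orbit: let \<open>g\<^sub>S\<close> take its columns in \<open>S\<close> from
  \<open>a - \<mu>2\<close> and the others from \<open>\<mu>1 - a\<close>.  Then \<open>a g\<^sub>S = g\<^sub>S \<Delta>\<^sub>S\<close> modulo the relations, the \<open>det g\<^sub>S\<close> sum up to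
  the unit \<open>(\<mu>1 - \<mu>2)\<^sup>n\<close>, and the trace relation kills \<open>(det g\<^sub>S)\<^sup>2\<close> unless \<open>S\<close> has \<open>n1\<close> elements; in that case
  a function vanishing on the orbit is killed by a power of \<open>det g\<^sub>S\<close>, by substituting \<open>g\<^sub>S\<close> into an
  identity that holds for all numerical matrices.

  Flatness comes from explicit representations.  For \<open>x\<close>, \<open>p\<close> with \<open>[x, p] = t\<close> the matrix
  \<open>\<mu>1 + (x, 1) (p, \<mu>2 - \<mu>1 - p x)\<close> in block form satisfies all relations, including the quantum
  correction \<open>t n1 n2\<close> of the trace, and so does every conjugate of it by a numerical matrix \<open>g\<close>.  The
  operators act on a module without \<open>t\<close>-torsion, and modulo \<open>t\<close> they recover the evaluation at
  \<open>g \<Delta>\<^sub>S g\<^sup>-\<^sup>1\<close>.  Hence an element annihilated by all these representations is divisible by arbitrarily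
  high powers of \<open>t\<close>, which makes the expansion in powers of \<open>t\<close> well defined.
\<close>

section \<open>Monoid algebras and two-sided ideals\<close>

text \<open>The representing matrix quantizes the factorization of the rank \<open>n2\<close> matrix
  \<open>A - \<mu>1\<close> as \<open>U V\<close> with \<open>V U = \<mu>2 - \<mu>1\<close>; the
  entries of \<open>x\<close> are coordinates on a cell of a Grassmannian and those of
  \<open>p\<close> the conjugate momenta. Since \<open>p\<close> stands to the left of
  \<open>x\<close>, the identity for \<open>V U\<close> survives quantization exactly, and so does
  the quadratic relation. The trace pays for exchanging \<open>U\<close> and \<open>V\<close>: one
  \<open>t\<close> for each of the \<open>n1 n2\<close> conjugate pairs. Conjugation by numerical
  matrices is required because each operator module sees a single point of the orbit at
  \<open>t = 0\<close>, the one at \<open>x = p = 0\<close>. The obstacle to expanding in powers of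
  \<open>t\<close> is that the structure of the quotient is known only modulo \<open>t\<close>, so
  that division by \<open>t\<close> has no evident uniqueness modulo the ideal of relations. Two
  ideals share the work: quotients by \<open>t\<close> exist modulo the ideal of relations, and they
  are unique modulo the larger common kernel of the representations. The same division shows that
  the bracket does not depend on polynomial extensions: an element vanishing on the orbit is
  \<open>t q\<close> modulo the relations, and its commutator with \<open>y\<close>, divided by
  \<open>t\<close>, is again a commutator.\<close>

lemma poly_mapping_single_induct [case_names single add]:
  assumes single: "\<And>k c. P (Poly_Mapping.single k c)"
    and add: "\<And>x y. P x \<Longrightarrow> P y \<Longrightarrow> P (x + y)"
  shows "P (x :: 'a \<Rightarrow>\<^sub>0 'b::comm_monoid_add)"
proof (induction x rule: update_induct)
  case const
  show ?case using single[of undefined 0] by simp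
next
  case (update f a b)
  have "Poly_Mapping.update a b f = f + Poly_Mapping.single a b"
    using update(1) by (intro poly_mapping_eqI) (auto simp: lookup_update lookup_add lookup_single when_def in_keys_iff)
  then show ?case using add[OF update(3) single] by metis
qed

definition monoid_algebra_eval :: "('k \<Rightarrow> 'r) \<Rightarrow> ('m \<Rightarrow> 'r) \<Rightarrow> ('m::monoid_add \<Rightarrow>\<^sub>0 'k::comm_ring_1) \<Rightarrow> 'r::ring_1"
  where "monoid_algebra_eval r \<eta> x = (\<Sum>m\<in>Poly_Mapping.keys x. r (Poly_Mapping.lookup x m) * \<eta> m)"

text \<open>Only additivity is assumed, because this locale also serves maps that are not ring
  homomorphisms: the derivations of the adjoint action and the additive lift of commutative
  polynomials to words in \<open>abel_kernel\<close>.\<close>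

locale monoid_algebra_linear =
  fixes r :: "'k::comm_ring_1 \<Rightarrow> 'r::ring_1" and \<eta> :: "'m::monoid_add \<Rightarrow> 'r"
  assumes r_add: "r (a + b) = r a + r b"
begin

abbreviation ev where "ev \<equiv> monoid_algebra_eval r \<eta>"

lemma r_zero: "r 0 = 0"
  using r_add[of 0 0] by simp

lemma ev_superset:
  assumes "finite F" "Poly_Mapping.keys x \<subseteq> F"
  shows "ev x = (\<Sum>m\<in>F. r (Poly_Mapping.lookup x m) * \<eta> m)"
  unfolding monoid_algebra_eval_def
  by (rule sum.mono_neutral_left[OF assms]) (auto simp: in_keys_iff r_zero)

lemma ev_single: "ev (Poly_Mapping.single m c) = r c * \<eta> m"
  by (subst ev_superset[of "{m}"]) auto

lemma ev_add: "ev (x + y) = ev x + ev y"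
proof -
  let ?F = "Poly_Mapping.keys x \<union> Poly_Mapping.keys y"
  have "Poly_Mapping.keys (x + y) \<subseteq> ?F" by (rule Poly_Mapping.keys_add)
  then show ?thesis
    by (simp add: ev_superset[of ?F] lookup_add r_add distrib_right sum.distrib)
qed

lemma ev_zero: "ev 0 = 0"
  by (simp add: monoid_algebra_eval_def)

lemma ev_uminus: "ev (- x) = - ev x"
  using ev_add[of x "- x"] by (simp add: ev_zero eq_neg_iff_add_eq_0 add.commute)

lemma ev_diff: "ev (x - y) = ev x - ev y"
  using ev_add[of x "- y"] by (simp add: ev_uminus)

lemma ev_sum: "ev (sum f A) = (\<Sum>a\<in>A. ev (f a))"
  by (induction A rule: infinite_finite_induct) (simp_all add: ev_zero ev_add)

end

locale monoid_algebra_hom = monoid_algebra_linear +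
  assumes r_mult: "r (a * b) = r a * r b"
    and r_one: "r 1 = 1"
    and \<eta>_zero: "\<eta> 0 = 1"
    and \<eta>_add: "\<eta> (m + m') = \<eta> m * \<eta> m'"
    and commute: "r a * \<eta> m = \<eta> m * r a"
begin

lemma ev_one: "ev 1 = 1"
  using ev_single[of 0 1] by (simp add: r_one \<eta>_zero)

lemma ev_mult: "ev (x * y) = ev x * ev y"
proof (induction x rule: poly_mapping_single_induct)
  case (single k c)
  show ?case
  proof (induction y rule: poly_mapping_single_induct)
    case (single l d)
    have "r c * r d * (\<eta> k * \<eta> l) = r c * \<eta> k * (r d * \<eta> l)"
      by (metis commute mult.assoc)
    then show ?case by (simp add: mult_single ev_single r_mult \<eta>_add)
  qed (simp add: distrib_left ev_add)
qed (simp add: distrib_right ev_add)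

lemma ev_power: "ev (x ^ k) = ev x ^ k"
  by (induction k) (simp_all add: ev_one ev_mult)

end

text \<open>Stated for type class rings, so that ordinary ring arithmetic applies to membership
  goals; \<open>ideal_free_algebra_iff\<close> links it to the ideals of the record
  \<open>free_algebra\<close>.\<close>

definition two_sided_ideal :: "'r::ring_1 set \<Rightarrow> bool"
  where "two_sided_ideal K \<longleftrightarrow> 0 \<in> K \<and> (\<forall>x\<in>K. \<forall>y\<in>K. x + y \<in> K) \<and> (\<forall>x\<in>K. \<forall>z. z * x \<in> K \<and> x * z \<in> K)"

lemma two_sided_idealI:
  assumes "0 \<in> K" "\<And>x y. x \<in> K \<Longrightarrow> y \<in> K \<Longrightarrow> x + y \<in> K"
    "\<And>x z. x \<in> K \<Longrightarrow> z * x \<in> K" "\<And>x z. x \<in> K \<Longrightarrow> x * z \<in> K"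
  shows "two_sided_ideal K"
  using assms by (auto simp: two_sided_ideal_def)

lemma
  assumes K: "two_sided_ideal K"
  shows two_sided_ideal_zero: "0 \<in> K"
    and two_sided_ideal_add: "x \<in> K \<Longrightarrow> y \<in> K \<Longrightarrow> x + y \<in> K"
    and two_sided_ideal_lmult: "x \<in> K \<Longrightarrow> z * x \<in> K"
    and two_sided_ideal_rmult: "x \<in> K \<Longrightarrow> x * z \<in> K"
  using K by (auto simp: two_sided_ideal_def)

lemma two_sided_ideal_uminus: "two_sided_ideal K \<Longrightarrow> x \<in> K \<Longrightarrow> - x \<in> K"
  using two_sided_ideal_lmult[of K x "- 1"] by simp

lemma two_sided_ideal_diff: "two_sided_ideal K \<Longrightarrow> x \<in> K \<Longrightarrow> y \<in> K \<Longrightarrow> x - y \<in> K"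
  using two_sided_ideal_add[of K x "- y"] two_sided_ideal_uminus[of K y] by simp

lemma two_sided_ideal_sum:
  "two_sided_ideal K \<Longrightarrow> (\<And>a. a \<in> A \<Longrightarrow> f a \<in> K) \<Longrightarrow> sum f A \<in> K"
  by (induction A rule: infinite_finite_induct)
    (auto simp: two_sided_ideal_zero two_sided_ideal_add)

lemma two_sided_ideal_minus_iff: "two_sided_ideal K \<Longrightarrow> x - y \<in> K \<longleftrightarrow> y - x \<in> K"
  using two_sided_ideal_uminus[of K "x - y"] two_sided_ideal_uminus[of K "y - x"] by auto

lemma two_sided_ideal_trans:
  "two_sided_ideal K \<Longrightarrow> x - y \<in> K \<Longrightarrow> y - z \<in> K \<Longrightarrow> x - z \<in> K"
  using two_sided_ideal_add[of K "x - y" "y - z"] by simp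

lemma two_sided_ideal_mult_cong:
  assumes "two_sided_ideal K" "x - x' \<in> K" "y - y' \<in> K"
  shows "x * y - x' * y' \<in> K"
proof -
  have "x * y - x' * y' = (x - x') * y + x' * (y - y')" by (simp add: algebra_simps)
  then show ?thesis
    using assms by (simp add: two_sided_ideal_add two_sided_ideal_lmult two_sided_ideal_rmult)
qed

lemma two_sided_ideal_add_cong:
  assumes "two_sided_ideal K" "x - x' \<in> K" "y - y' \<in> K"
  shows "(x + y) - (x' + y') \<in> K"
  using two_sided_ideal_add[OF assms] by (simp add: algebra_simps)

lemma const_add: "const (a + b) = const a + const b"
  by (simp add: const_def single_add)

lemma const_mult: "const (a * b) = const a * const b"
  by (simp add: const_def mult_single plus_list_def)

lemma const_zero [simp]: "const 0 = 0" by (simp add: const_def)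

lemma const_one [simp]: "const 1 = 1"
  by (simp add: const_def zero_list_def flip: single_one)

lemma const_commute: "const c * x = x * const c"
  by (induction x rule: poly_mapping_single_induct)
    (simp_all add: const_def mult_single plus_list_def mult.commute distrib_left distrib_right)

lemma const_left_commute: "x * (const c * y) = const c * (x * y)"
  by (metis const_commute mult.assoc)

lemma monomial_Nil [simp]: "monomial [] = 1"
  by (simp add: monomial_def zero_list_def flip: single_one)

lemma monomial_append: "monomial (v @ w) = monomial v * monomial w"
  by (simp add: monomial_def mult_single plus_list_def)

lemma monomial_Cons: "monomial (a # w) = gen (fst a) (snd a) * monomial w"
  using monomial_append[of "[a]" w] by (simp add: gen_def)

lemma single_eq_const_monomial: "Poly_Mapping.single w c = const c * monomial w"
  by (simp add: const_def monomial_def mult_single plus_list_def)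

lemma free_algebra_induct [case_names const gen add mult]:
  assumes "\<And>c. P (const c)" "\<And>i j. P (gen i j)"
    "\<And>x y. P x \<Longrightarrow> P y \<Longrightarrow> P (x + y)" "\<And>x y. P x \<Longrightarrow> P y \<Longrightarrow> P (x * y)"
  shows "P (x :: ('n \<times> 'n) list \<Rightarrow>\<^sub>0 'r::comm_ring_1)"
proof (induction x rule: poly_mapping_single_induct)
  case (single w c)
  have "P (monomial w)"
  proof (induction w)
    case Nil
    show ?case using assms(1)[of 1] by simp
  next
    case (Cons a w)
    then show ?case by (simp add: monomial_Cons assms)
  qed
  then show ?case by (simp add: single_eq_const_monomial assms)
qed (rule assms(3))

section \<open>Evaluation of noncommutative polynomials\<close>

definition free_eval :: "('k \<Rightarrow> 'r) \<Rightarrow> ('n \<times> 'n \<Rightarrow> 'r) \<Rightarrow> (('n \<times> 'n) list \<Rightarrow>\<^sub>0 'k::comm_ring_1) \<Rightarrow> 'r::ring_1"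
  where "free_eval r v = monoid_algebra_eval r (\<lambda>w. prod_list (map v w))"

locale free_hom =
  fixes r :: "'k::comm_ring_1 \<Rightarrow> 'r::ring_1" and v :: "'n \<times> 'n \<Rightarrow> 'r"
  assumes scalar_add: "r (a + b) = r a + r b"
    and scalar_mult: "r (a * b) = r a * r b"
    and scalar_one: "r 1 = 1"
    and scalar_commute: "r a * v p = v p * r a"
begin

lemma prod_list_commute: "r a * prod_list (map v w) = prod_list (map v w) * r a"
proof (induction w)
  case (Cons p w)
  then show ?case by simp (metis scalar_commute mult.assoc)
qed simp

sublocale monoid_algebra_hom r "\<lambda>w. prod_list (map v w)"
  rewrites "monoid_algebra_eval r (\<lambda>w. prod_list (map v w)) = free_eval r v"
  using prod_list_commute
  by unfold_locales
    (simp_all add: scalar_add scalar_mult scalar_one zero_list_def plus_list_def free_eval_def)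

lemma ev_const: "free_eval r v (const c) = r c"
  by (simp add: const_def ev_single)

lemma ev_gen: "free_eval r v (gen i j) = v (i, j)"
  by (simp add: gen_def monomial_def ev_single scalar_one)

lemma ev_monomial: "free_eval r v (monomial w) = prod_list (map v w)"
  by (simp add: monomial_def ev_single scalar_one)

end

section \<open>Commutative polynomials and determinants\<close>

type_synonym 'v comm_poly = "'v multiset \<Rightarrow>\<^sub>0 complex"

definition comm_const :: "complex \<Rightarrow> 'v comm_poly"
  where "comm_const c = Poly_Mapping.single {#} c"

definition comm_var :: "'v \<Rightarrow> 'v comm_poly"
  where "comm_var x = Poly_Mapping.single {#x#} 1"

definition comm_eval :: "(complex \<Rightarrow> 'r) \<Rightarrow> ('v \<Rightarrow> 'r) \<Rightarrow> 'v comm_poly \<Rightarrow> 'r::comm_ring_1"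
  where "comm_eval r v = monoid_algebra_eval r (\<lambda>M. prod_mset (image_mset v M))"

locale comm_hom =
  fixes r :: "complex \<Rightarrow> 'r::comm_ring_1" and v :: "'v \<Rightarrow> 'r"
  assumes scalar_add: "r (a + b) = r a + r b"
    and scalar_mult: "r (a * b) = r a * r b"
    and scalar_one: "r 1 = 1"
begin

sublocale monoid_algebra_hom r "\<lambda>M. prod_mset (image_mset v M)"
  rewrites "monoid_algebra_eval r (\<lambda>M. prod_mset (image_mset v M)) = comm_eval r v"
  by unfold_locales (simp_all add: scalar_add scalar_mult scalar_one mult.commute comm_eval_def)

lemma ev_const: "comm_eval r v (comm_const c) = r c"
  by (simp add: comm_const_def ev_single)

lemma ev_var: "comm_eval r v (comm_var x) = v x"
  by (simp add: comm_var_def ev_single scalar_one)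

lemma ev_prod: "comm_eval r v (prod f A) = (\<Prod>a\<in>A. comm_eval r v (f a))"
  by (induction A rule: infinite_finite_induct) (simp_all add: ev_one ev_mult)

lemma ev_of_nat: "comm_eval r v (of_nat k) = of_nat k"
  by (induction k) (simp_all add: ev_zero ev_one ev_add)

lemma ev_of_int: "comm_eval r v (of_int k) = of_int k"
  by (cases k) (simp_all add: ev_of_nat ev_uminus ev_one ev_diff)

lemma ev_det: "comm_eval r v (det A) = det (\<chi> i j. comm_eval r v (A $ i $ j) :: 'r ^ 'm ^ ('m::finite))"
  by (simp add: det_def ev_sum ev_mult ev_prod ev_of_int)

end

interpretation num: comm_hom "\<lambda>c. c" v for v :: "'v \<Rightarrow> complex"
  by unfold_locales simp_all

lemma comm_const_add: "comm_const (a + b) = comm_const a + comm_const b"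
  by (simp add: comm_const_def single_add)

lemma comm_const_mult: "comm_const (a * b) = comm_const a * comm_const b"
  by (simp add: comm_const_def mult_single)

lemma comm_const_one: "comm_const 1 = 1"
  by (simp add: comm_const_def flip: single_one)

lemma comm_const_zero: "comm_const 0 = 0"
  by (simp add: comm_const_def)

lemma comm_const_diff: "comm_const (a - b) = comm_const a - comm_const b"
  by (simp add: comm_const_def single_diff)

lemma comm_const_of_nat: "comm_const (of_nat k) = of_nat k"
  by (induction k) (simp_all add: comm_const_zero comm_const_add comm_const_one)

lemma comm_const_power: "comm_const (a ^ k) = comm_const a ^ k"
  by (induction k) (simp_all add: comm_const_mult comm_const_one)

interpretation sub: comm_hom comm_const v for v :: "'v \<Rightarrow> 'w comm_poly"
  by unfold_locales (simp_all add: comm_const_add comm_const_mult comm_const_one)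

lemma comm_poly_induct [case_names const var add mult]:
  assumes "\<And>c. P (comm_const c)" "\<And>x. P (comm_var x)"
    "\<And>x y. P x \<Longrightarrow> P y \<Longrightarrow> P (x + y)" "\<And>x y. P x \<Longrightarrow> P y \<Longrightarrow> P (x * y)"
  shows "P x"
proof (induction x rule: poly_mapping_single_induct)
  case (single M c)
  have "P (Poly_Mapping.single M 1)"
  proof (induction M)
    case empty
    show ?case using assms(1)[of 1] by (simp add: comm_const_def)
  next
    case (add x M)
    have "Poly_Mapping.single (add_mset x M) 1 = comm_var x * Poly_Mapping.single M 1"
      by (simp add: comm_var_def mult_single)
    then show ?case using assms(2,4) add by metis
  qed
  moreover have "Poly_Mapping.single M c = comm_const c * Poly_Mapping.single M 1"
    by (simp add: comm_const_def mult_single)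
  ultimately show ?case using assms(1,4) by metis
qed (rule assms(3))

text \<open>
  Evaluating at the powers \<open>p\<^sub>x\<^sup>k\<close> of distinct primes separates monomials: they take the
  values \<open>N\<^sup>k\<close> for pairwise distinct \<open>N\<close> by unique factorisation, and Lagrange interpolation
  then extracts each coefficient.
\<close>

lemma comm_poly_eq_zeroI:
  fixes f :: "'v::finite comm_poly"
  assumes zero: "\<And>v. comm_eval (\<lambda>c. c) v f = 0"
  shows "f = 0"
proof -
  obtain q :: "nat \<Rightarrow> nat" where q: "inj q" "range q \<subseteq> {p. prime p}"
    using infinite_countable_subset[OF primes_infinite] by blast
  obtain e :: "'v \<Rightarrow> nat" where e: "inj e"
    using finite_imp_inj_to_nat_seg[of "UNIV :: 'v set"] by auto
  define p where "p = q \<circ> e"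
  have p: "inj p" "\<And>x. prime (p x)"
    using q e by (auto simp: p_def inj_compose)
  define N where "N M = prod_mset (image_mset p M)" for M
  have "inj N"
  proof (rule injI)
    fix M M' assume "N M = N M'"
    moreover have "prime_factorization (N M) = image_mset p M" for M
      unfolding N_def using p(2) by (intro prime_factorization_prod_mset_primes) auto
    ultimately have "image_mset p M = image_mset p M'" by metis
    then show "M = M'" using multiset.inj_map[OF p(1)] by (auto dest: injD)
  qed
  let ?K = "Poly_Mapping.keys f" and ?c = "Poly_Mapping.lookup f"
  have pow: "(\<Sum>M\<in>?K. ?c M * of_nat (N M) ^ k) = 0" for k
  proof -
    have "prod_mset (image_mset (\<lambda>x. of_nat (p x) ^ k :: complex) M) = of_nat (N M) ^ k" for M
      by (induction M) (simp_all add: N_def power_mult_distrib)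
    then show ?thesis
      using zero[of "\<lambda>x. of_nat (p x) ^ k"] by (simp add: comm_eval_def monoid_algebra_eval_def)
  qed
  have poly: "(\<Sum>M\<in>?K. ?c M * poly h (of_nat (N M))) = 0" for h
  proof -
    have "(\<Sum>M\<in>?K. ?c M * poly h (of_nat (N M)))
        = (\<Sum>M\<in>?K. \<Sum>k\<le>degree h. coeff h k * (?c M * of_nat (N M) ^ k))"
      by (simp add: poly_altdef sum_distrib_left mult_ac)
    also have "\<dots> = (\<Sum>k\<le>degree h. coeff h k * (\<Sum>M\<in>?K. ?c M * of_nat (N M) ^ k))"
      by (subst sum.swap) (simp add: sum_distrib_left)
    finally show ?thesis by (simp add: pow)
  qed
  have "?c M = 0" if "M \<in> ?K" for M
  proof -
    define h :: "complex poly" where "h = (\<Prod>M'\<in>?K - {M}. [:- of_nat (N M'), 1:])"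
    have h: "poly h (of_nat (N M')) = 0" if "M' \<in> ?K - {M}" for M'
      using that by (auto simp: h_def poly_prod)
    have "(\<Sum>M'\<in>?K. ?c M' * poly h (of_nat (N M'))) = ?c M * poly h (of_nat (N M))"
      using that h by (subst sum.remove[OF _ that]) auto
    moreover have "poly h (of_nat (N M)) \<noteq> 0"
      using injD[OF \<open>inj N\<close>] by (auto simp: h_def poly_prod)
    ultimately show ?thesis using poly[of h] by simp
  qed
  then show ?thesis by (intro poly_mapping_eqI) (auto simp: in_keys_iff)
qed

section \<open>Adjugates and the determinant of a sum\<close>

definition adjugate :: "'r::comm_ring_1 ^ 'm ^ 'm \<Rightarrow> 'r ^ 'm ^ ('m::finite)"
  where "adjugate g = (\<chi> k l. det (\<chi> i. if i = l then axis k 1 else g $ i))"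

text \<open>Cofactors are full determinants with one row replaced by a unit vector, which avoids
  minors over a smaller index type. By linearity in that row, row \<open>j\<close> of
  \<open>g\<close> times column \<open>l\<close> of the adjugate is the determinant of
  \<open>g\<close> with row \<open>l\<close> overwritten by row \<open>j\<close>; for
  \<open>j \<noteq> l\<close> two rows coincide.\<close>

lemma mult_adjugate: "g ** adjugate g = mat (det g)"
proof -
  have "(\<Sum>k\<in>UNIV. g $ j $ k * det (\<chi> i. if i = l then axis k 1 else g $ i))
      = (if j = l then det g else 0)" (is "?s = _") for j l
  proof -
    have "?s = (\<Sum>k\<in>UNIV. det (\<chi> i. if i = l then g $ j $ k *s axis k 1 else g $ i))"
      by (simp add: det_row_mul)
    also have "\<dots> = det (\<chi> i. if i = l then (\<Sum>k\<in>UNIV. g $ j $ k *s axis k 1) else g $ i)"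
      by (rule det_linear_row_sum[symmetric]) simp
    also have "(\<Sum>k\<in>UNIV. g $ j $ k *s axis k 1) = g $ j"
      by (simp add: vec_eq_iff axis_def if_distrib cong: if_cong)
    also have "det (\<chi> i. if i = l then g $ j else g $ i) = (if j = l then det g else 0)"
    proof (cases "j = l")
      case True
      then have "(\<chi> i. if i = l then g $ j else g $ i) = g" by (simp add: vec_eq_iff)
      then show ?thesis using True by simp
    next
      case False
      then show ?thesis by (auto intro!: det_identical_rows[of j l] simp: row_def)
    qed
    finally show ?thesis .
  qed
  then show ?thesis
    by (auto simp: adjugate_def matrix_matrix_mult_def mat_def vec_eq_iff)
qed

text \<open>A left-hand counterpart of \<open>mult_adjugate\<close>, obtained by transposition. The
  left and the right adjugate are compared in \<open>orbit_functions_ideal\<close>, after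
  multiplication by the determinant.\<close>

lemma transpose_adjugate_mult: "transpose (adjugate (transpose g)) ** g = mat (det g)"
proof -
  have "transpose (transpose g ** adjugate (transpose g)) = transpose (mat (det g))"
    by (simp add: mult_adjugate)
  then show ?thesis by (simp add: matrix_transpose_mul transpose_mat)
qed

text \<open>Multilinearity: each product in the Leibniz formula expands over the subsets of rows on
  which the entry of \<open>A\<close> is chosen. Transposing turns rows into columns, the form in
  which the matrices \<open>g S\<close> of the orbit arise.\<close>

lemma det_add:
  fixes A B :: "'r::comm_ring_1 ^ 'm ^ ('m::finite)"
  shows "det (A + B) = (\<Sum>S\<in>UNIV. det (\<chi> i j. if j \<in> S then A $ i $ j else B $ i $ j))"
proof -
  have rows: "det (A + B) = (\<Sum>S\<in>UNIV. det (\<chi> i j. if i \<in> S then A $ i $ j else B $ i $ j))"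
    for A B :: "'r ^ 'm ^ 'm"
  proof -
    have "(\<Prod>i\<in>UNIV. A $ i $ p i + B $ i $ p i)
        = (\<Sum>S\<in>UNIV. \<Prod>i\<in>UNIV. if i \<in> S then A $ i $ p i else B $ i $ p i)" for p
    proof -
      have "(\<Prod>i\<in>UNIV. A $ i $ p i + B $ i $ p i)
          = (\<Sum>S\<in>UNIV. (\<Prod>i\<in>S. A $ i $ p i) * (\<Prod>i\<in>UNIV - S. B $ i $ p i))"
        by (simp add: prod_add)
      also have "\<dots> = (\<Sum>S\<in>UNIV. \<Prod>i\<in>UNIV. if i \<in> S then A $ i $ p i else B $ i $ p i)"
        by (intro sum.cong refl) (simp add: prod.If_cases Compl_eq_Diff_UNIV)
      finally show ?thesis .
    qed
    then show ?thesis
      by (simp add: det_def sum_distrib_left) (rule sum.swap)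
  qed
  have "det (A + B) = det (transpose A + transpose B)"
    by (subst det_transpose[symmetric]) (simp add: transpose_def vec_eq_iff plus_vec_def)
  also have "\<dots> = (\<Sum>S\<in>UNIV. det (transpose (\<chi> i j. if i \<in> S then transpose A $ i $ j else transpose B $ i $ j)))"
    by (simp add: rows)
  also have "\<dots> = (\<Sum>S\<in>UNIV. det (\<chi> i j. if j \<in> S then A $ i $ j else B $ i $ j))"
    by (intro sum.cong refl arg_cong[of _ _ det]) (simp add: transpose_def vec_eq_iff)
  finally show ?thesis .
qed

lemma det_mat: "det (mat c :: 'r::comm_ring_1 ^ 'm ^ 'm) = c ^ CARD('m::finite)"
  by (subst det_diagonal) (simp_all add: mat_def)

lemma mat_mult: "mat c ** A = (\<chi> i j. c * A $ i $ j)"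
  by (simp add: mat_def matrix_matrix_mult_def vec_eq_iff if_distrib if_distribR cong: if_cong)

lemma mult_mat: "A ** mat c = (\<chi> i j. A $ i $ j * c)"
  by (simp add: mat_def matrix_matrix_mult_def vec_eq_iff if_distrib if_distribR cong: if_cong)

section \<open>Congruences modulo an ideal\<close>

definition entry_cong :: "'r::ring_1 set \<Rightarrow> 'r ^ 'm ^ 'l \<Rightarrow> 'r ^ 'm ^ 'l \<Rightarrow> bool"
  where "entry_cong I A B \<longleftrightarrow> (\<forall>i j. A $ i $ j - B $ i $ j \<in> I)"

lemma entry_cong_mult:
  assumes I: "two_sided_ideal I" and "entry_cong I A A'" "entry_cong I B B'"
  shows "entry_cong I (A ** B) (A' ** (B' :: 'r::ring_1 ^ 'k ^ ('m::finite)))"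
  using assms
  by (simp add: entry_cong_def matrix_matrix_mult_def flip: sum_subtractf)
    (auto intro!: two_sided_ideal_sum[OF I] two_sided_ideal_mult_cong[OF I])

lemma entry_cong_refl: "two_sided_ideal I \<Longrightarrow> entry_cong I A A"
  by (simp add: entry_cong_def two_sided_ideal_zero)

lemma entry_cong_trace:
  assumes "two_sided_ideal I" "entry_cong I A (B :: 'r::ring_1 ^ 'm ^ ('m::finite))"
  shows "trace A - trace B \<in> I"
  using assms by (simp add: trace_def entry_cong_def two_sided_ideal_sum flip: sum_subtractf)

text \<open>If the \<open>d s\<close> generate the unit ideal, so do their powers. Passing from
  \<open>f\<close> to \<open>d s * f\<close> lowers the exponent at \<open>s\<close>, so induction
  on the sum of the exponents gives \<open>d s * f \<in> I\<close> for every \<open>s\<close>, and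
  the relation \<open>unit\<close> recombines these to \<open>f\<close>.\<close>

lemma mem_ideal_if_powers_mem:
  fixes d :: "'s \<Rightarrow> 'r::comm_ring_1"
  assumes I: "two_sided_ideal I" and unit: "w * (\<Sum>s\<in>T. d s) = 1"
    and "\<And>s. s \<in> T \<Longrightarrow> d s ^ m s * f \<in> I"
  shows "f \<in> I"
  using assms(3)
proof (induction "\<Sum>s\<in>T. m s" arbitrary: f m rule: less_induct)
  case less
  have "finite T"
  proof (rule ccontr)
    assume "infinite T"
    then have "(0::'r) = 1" using unit by simp
    then show False by simp
  qed
  have "d s * f \<in> I" if s: "s \<in> T" for s
  proof (cases "m s")
    case 0
    then have "f \<in> I" using less.prems[OF s] by simp
    then show ?thesis by (rule two_sided_ideal_lmult[OF I])
  next
    case (Suc k)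
    show ?thesis
    proof (rule less.hyps)
      show "(\<Sum>u\<in>T. (m(s := k)) u) < (\<Sum>u\<in>T. m u)"
        using \<open>finite T\<close> s Suc by (intro sum_strict_mono_ex1) auto
      fix s' assume "s' \<in> T"
      then show "d s' ^ (m(s := k)) s' * (d s * f) \<in> I"
        using less.prems[of s'] two_sided_ideal_lmult[OF I, of "d s' ^ m s' * f" "d s"] Suc
        by (auto simp: mult_ac)
    qed
  qed
  then have "(\<Sum>s\<in>T. d s * f) \<in> I" by (rule two_sided_ideal_sum[OF I])
  then have "w * (\<Sum>s\<in>T. d s * f) \<in> I" by (rule two_sided_ideal_lmult[OF I])
  moreover have "w * (\<Sum>s\<in>T. d s * f) = f"
    using unit by (simp add: sum_distrib_right[symmetric] mult.assoc[symmetric])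
  ultimately show ?case by simp
qed

section \<open>Generic matrices and substitution\<close>

definition generic_matrix :: "('n \<times> 'n) comm_poly ^ 'n ^ ('n::finite)"
  where "generic_matrix = (\<chi> j i. comm_var (i, j))"

definition eval_at :: "complex ^ 'n ^ ('n::finite) \<Rightarrow> ('n \<times> 'n) comm_poly \<Rightarrow> complex"
  where "eval_at A = comm_eval (\<lambda>c. c) (\<lambda>(i, j). A $ j $ i)"

definition subst_matrix ::
    "('n \<times> 'n) comm_poly ^ 'n ^ 'n \<Rightarrow> ('n::finite \<times> 'n) comm_poly \<Rightarrow> ('n \<times> 'n) comm_poly"
  where "subst_matrix g = comm_eval comm_const (\<lambda>(i, j). g $ j $ i)"

definition diagonal :: "('n \<Rightarrow> 'r) \<Rightarrow> 'r::zero ^ 'n ^ 'n"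
  where "diagonal d = (\<chi> i j. if i = j then d i else 0)"

definition two_values :: "'a \<Rightarrow> 'a \<Rightarrow> 'n set \<Rightarrow> 'n \<Rightarrow> 'a"
  where "two_values a b S i = (if i \<in> S then a else b)"

lemma orbit_eq:
  "orbit \<mu>1 \<mu>2 n1 n2 = {g ** diagonal (two_values \<mu>1 \<mu>2 S) ** matrix_inv g
     | (g :: complex ^ 'n ^ ('n::finite)) S. invertible g \<and> card S = n1 \<and> card (- S) = n2}"
  unfolding orbit_def diagonal_def two_values_def ..

definition map_entries :: "('a \<Rightarrow> 'b) \<Rightarrow> 'a ^ 'm ^ 'l \<Rightarrow> 'b ^ 'm ^ 'l"
  where "map_entries f A = (\<chi> i j. f (A $ i $ j))"

context comm_hom
begin

lemma map_entries_mult: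
  "map_entries (comm_eval r v) (A ** B) =
    map_entries (comm_eval r v) A ** map_entries (comm_eval r v) (B :: _ ^ 'm ^ ('l::finite))"
  by (simp add: map_entries_def matrix_matrix_mult_def vec_eq_iff ev_sum ev_mult)

lemma map_entries_adjugate:
  "map_entries (comm_eval r v) (adjugate A) =
    adjugate (map_entries (comm_eval r v) (A :: _ ^ 'm ^ ('m::finite)))"
  by (simp add: map_entries_def adjugate_def vec_eq_iff ev_det)
    (intro allI arg_cong[of _ _ det], simp add: vec_eq_iff axis_def ev_one ev_zero)

lemma map_entries_diagonal:
  "map_entries (comm_eval r v) (diagonal d) = diagonal (\<lambda>i. comm_eval r v (d i))"
  by (simp add: map_entries_def diagonal_def vec_eq_iff ev_zero)

lemma ev_det': "comm_eval r v (det A) = det (map_entries (comm_eval r v) (A :: _ ^ 'm ^ ('m::finite)))"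
  by (simp add: ev_det map_entries_def)

end

lemma map_entries_eval_at: "map_entries (eval_at A) generic_matrix = A"
  by (simp add: map_entries_def eval_at_def generic_matrix_def num.ev_var vec_eq_iff)

lemma map_entries_subst_matrix: "map_entries (subst_matrix A) generic_matrix = A"
  by (simp add: map_entries_def subst_matrix_def generic_matrix_def sub.ev_var vec_eq_iff)

lemma
  fixes g :: "'r::semiring_1 ^ 'n ^ ('n::finite)"
  assumes "invertible g"
  shows mult_matrix_inv: "g ** matrix_inv g = mat 1" and matrix_inv_mult: "matrix_inv g ** g = mat 1"
  using someI_ex[OF assms[unfolded invertible_def]] by (simp_all add: matrix_inv_def)

lemma adjugate_eq:
  fixes g :: "complex ^ 'n ^ ('n::finite)"
  assumes "invertible g"
  shows "adjugate g = matrix_inv g ** mat (det g)"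
proof -
  have "adjugate g = matrix_inv g ** (g ** adjugate g)"
    by (simp add: matrix_mul_assoc matrix_inv_mult[OF assms])
  then show ?thesis by (simp add: mult_adjugate)
qed

text \<open>
  \<open>F\<close> is \<open>det h\<^sup>N f(h \<Delta> h\<^sup>-\<^sup>1)\<close> with the denominators cleared, as a polynomial in the entries of \<open>h\<close>.
\<close>

lemma homogenization_exists:
  fixes f :: "('n::finite \<times> 'n) comm_poly"
  assumes I: "two_sided_ideal I"
  shows "\<exists>N F. (\<forall>h. invertible h \<longrightarrow>
        eval_at h F = det h ^ N * eval_at (h ** diagonal d ** matrix_inv h) f) \<and>
      (\<forall>g. entry_cong I (generic_matrix ** g) (g ** diagonal (\<lambda>i. comm_const (d i))) \<longrightarrow>
        subst_matrix g F - det g ^ N * f \<in> I)"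
proof (induction f rule: comm_poly_induct)
  case (const c)
  show ?case
    by (rule exI[of _ 0], rule exI[of _ "comm_const c"])
      (simp add: eval_at_def subst_matrix_def num.ev_const sub.ev_const two_sided_ideal_zero[OF I])
next
  case (var x)
  obtain i j where x: "x = (i, j)" by (cases x)
  \<comment> \<open>The conjugate of the diagonal matrix by a generic matrix with the inverse
    replaced by the adjugate, so one power of the determinant clears the denominator of every
    coordinate.\<close>
  define G where "G = generic_matrix ** diagonal (\<lambda>i. comm_const (d i)) ** adjugate (generic_matrix :: ('n \<times> 'n) comm_poly ^ 'n ^ 'n)"
  have num: "map_entries (eval_at h) G = h ** diagonal d ** adjugate h" for h
    unfolding G_def eval_at_def
    by (simp add: num.map_entries_mult num.map_entries_adjugate num.map_entries_diagonal num.ev_const)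
      (simp add: map_entries_eval_at flip: eval_at_def)
  have sub: "map_entries (subst_matrix g) G = g ** diagonal (\<lambda>i. comm_const (d i)) ** adjugate g" for g
    unfolding G_def subst_matrix_def
    by (simp add: sub.map_entries_mult sub.map_entries_adjugate sub.map_entries_diagonal sub.ev_const)
      (simp add: map_entries_subst_matrix flip: subst_matrix_def)
  show ?case
  proof (intro exI[of _ "1::nat"] exI[of _ "G $ j $ i"] conjI allI impI)
    fix h :: "complex ^ 'n ^ 'n" assume "invertible h"
    then have "map_entries (eval_at h) G = h ** diagonal d ** matrix_inv h ** mat (det h)"
      by (simp add: num adjugate_eq matrix_mul_assoc)
    then have "map_entries (eval_at h) G $ j $ i = (h ** diagonal d ** matrix_inv h ** mat (det h)) $ j $ i"
      by simp
    then show "eval_at h (G $ j $ i) =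
        det h ^ 1 * eval_at (h ** diagonal d ** matrix_inv h) (comm_var x)"
      by (simp add: mult_mat x map_entries_def) (simp add: eval_at_def num.ev_var)
  next
    fix g assume "entry_cong I (generic_matrix ** g) (g ** diagonal (\<lambda>i. comm_const (d i)))"
    then have "entry_cong I (generic_matrix ** g ** adjugate g) (map_entries (subst_matrix g) G)"
      unfolding sub by (rule entry_cong_mult[OF I _ entry_cong_refl[OF I]])
    then have "entry_cong I (generic_matrix ** mat (det g)) (map_entries (subst_matrix g) G)"
      by (simp add: mult_adjugate flip: matrix_mul_assoc)
    then show "subst_matrix g (G $ j $ i) - det g ^ 1 * comm_var x \<in> I"
      by (simp add: entry_cong_def mult_mat generic_matrix_def x map_entries_def mult.commute)
        (metis two_sided_ideal_minus_iff[OF I])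
  qed
next
  case (add f1 f2)
  then obtain N1 F1 N2 F2 where
    1: "\<And>h. invertible h \<Longrightarrow> eval_at h F1 = det h ^ N1 * eval_at (h ** diagonal d ** matrix_inv h) f1"
       "\<And>g. entry_cong I (generic_matrix ** g) (g ** diagonal (\<lambda>i. comm_const (d i))) \<Longrightarrow>
          subst_matrix g F1 - det g ^ N1 * f1 \<in> I"
    and 2: "\<And>h. invertible h \<Longrightarrow> eval_at h F2 = det h ^ N2 * eval_at (h ** diagonal d ** matrix_inv h) f2"
       "\<And>g. entry_cong I (generic_matrix ** g) (g ** diagonal (\<lambda>i. comm_const (d i))) \<Longrightarrow>
          subst_matrix g F2 - det g ^ N2 * f2 \<in> I"
    by blast
  let ?D = "det (generic_matrix :: ('n \<times> 'n) comm_poly ^ 'n ^ 'n)"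
  have D: "eval_at h ?D = det h" "subst_matrix g ?D = det g" for h g
    using map_entries_eval_at[of h] map_entries_subst_matrix[of g]
    by (simp_all add: eval_at_def num.ev_det' subst_matrix_def sub.ev_det')
  show ?case
  \<comment> \<open>Each summand is multiplied by the other one's power of the generic determinant,
    to reach the common exponent.\<close>
  proof (intro exI[of _ "N1 + N2"] exI[of _ "?D ^ N2 * F1 + ?D ^ N1 * F2"] conjI allI impI)
    fix h :: "complex ^ 'n ^ 'n" assume h: "invertible h"
    have "eval_at h (?D ^ N2 * F1 + ?D ^ N1 * F2) = eval_at h ?D ^ N2 * eval_at h F1 + eval_at h ?D ^ N1 * eval_at h F2"
      by (simp add: eval_at_def num.ev_add num.ev_mult num.ev_power)
    then show "eval_at h (?D ^ N2 * F1 + ?D ^ N1 * F2) =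
        det h ^ (N1 + N2) * eval_at (h ** diagonal d ** matrix_inv h) (f1 + f2)"
      by (simp add: D 1(1)[OF h] 2(1)[OF h] power_add algebra_simps)
        (simp add: eval_at_def num.ev_add algebra_simps)
  next
    fix g assume g: "entry_cong I (generic_matrix ** g) (g ** diagonal (\<lambda>i. comm_const (d i)))"
    have "subst_matrix g (?D ^ N2 * F1 + ?D ^ N1 * F2)
        = subst_matrix g ?D ^ N2 * subst_matrix g F1 + subst_matrix g ?D ^ N1 * subst_matrix g F2"
      by (simp add: subst_matrix_def sub.ev_add sub.ev_mult sub.ev_power)
    then have "subst_matrix g (?D ^ N2 * F1 + ?D ^ N1 * F2) - det g ^ (N1 + N2) * (f1 + f2)
        = det g ^ N2 * (subst_matrix g F1 - det g ^ N1 * f1)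
          + det g ^ N1 * (subst_matrix g F2 - det g ^ N2 * f2)"
      by (simp add: D power_add algebra_simps)
    then show "subst_matrix g (?D ^ N2 * F1 + ?D ^ N1 * F2) - det g ^ (N1 + N2) * (f1 + f2) \<in> I"
      using 1(2)[OF g] 2(2)[OF g]
      by (simp add: two_sided_ideal_add[OF I] two_sided_ideal_lmult[OF I])
  qed
next
  case (mult f1 f2)
  then obtain N1 F1 N2 F2 where
    1: "\<And>h. invertible h \<Longrightarrow> eval_at h F1 = det h ^ N1 * eval_at (h ** diagonal d ** matrix_inv h) f1"
       "\<And>g. entry_cong I (generic_matrix ** g) (g ** diagonal (\<lambda>i. comm_const (d i))) \<Longrightarrow>
          subst_matrix g F1 - det g ^ N1 * f1 \<in> I"
    and 2: "\<And>h. invertible h \<Longrightarrow> eval_at h F2 = det h ^ N2 * eval_at (h ** diagonal d ** matrix_inv h) f2"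
       "\<And>g. entry_cong I (generic_matrix ** g) (g ** diagonal (\<lambda>i. comm_const (d i))) \<Longrightarrow>
          subst_matrix g F2 - det g ^ N2 * f2 \<in> I"
    by blast
  show ?case
  proof (intro exI[of _ "N1 + N2"] exI[of _ "F1 * F2"] conjI allI impI)
    fix h :: "complex ^ 'n ^ 'n" assume h: "invertible h"
    have "eval_at h (F1 * F2) = eval_at h F1 * eval_at h F2"
      by (simp add: eval_at_def num.ev_mult)
    then show "eval_at h (F1 * F2) =
        det h ^ (N1 + N2) * eval_at (h ** diagonal d ** matrix_inv h) (f1 * f2)"
      by (simp add: 1(1)[OF h] 2(1)[OF h] power_add)
        (simp add: eval_at_def num.ev_mult algebra_simps)
  next
    fix g assume g: "entry_cong I (generic_matrix ** g) (g ** diagonal (\<lambda>i. comm_const (d i)))"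
    have "subst_matrix g (F1 * F2) - (det g ^ N1 * f1) * (det g ^ N2 * f2) \<in> I"
      unfolding subst_matrix_def sub.ev_mult
      by (rule two_sided_ideal_mult_cong[OF I 1(2)[OF g] 2(2)[OF g], unfolded subst_matrix_def])
    then show "subst_matrix g (F1 * F2) - det g ^ (N1 + N2) * (f1 * f2) \<in> I"
      by (simp add: power_add mult_ac)
  qed
qed

lemma diff_mat_mult:
  fixes A :: "'r::ring_1 ^ 'm ^ ('m::finite)"
  shows "((A - mat c) ** B) $ i $ j = (A ** B) $ i $ j - c * B $ i $ j"
  by (simp add: matrix_matrix_mult_def mat_def left_diff_distrib sum_subtractf
      if_distrib[of "\<lambda>x. x * y" for y] cong: if_cong)

lemma mult_diff_mat:
  fixes A :: "'r::ring_1 ^ 'm ^ ('m::finite)"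
  shows "(B ** (A - mat c)) $ i $ j = (B ** A) $ i $ j - B $ i $ j * c"
  by (simp add: matrix_matrix_mult_def mat_def right_diff_distrib sum_subtractf
      if_distrib[of "\<lambda>x. y * x" for y] cong: if_cong)

section \<open>The ideal of the orbit\<close>

theorem orbit_functions_ideal:
  fixes f :: "('n::finite \<times> 'n) comm_poly"
  assumes I: "two_sided_ideal I" and ne: "\<mu>1 \<noteq> \<mu>2" and n: "n1 + n2 = CARD('n)"
    and quad: "\<And>j k. ((generic_matrix - mat (comm_const \<mu>1)) ** (generic_matrix - mat (comm_const \<mu>2))) $ j $ k \<in> I"
    and tr: "trace (generic_matrix :: ('n \<times> 'n) comm_poly ^ 'n ^ 'n) - comm_const (of_nat n1 * \<mu>1 + of_nat n2 * \<mu>2) \<in> I"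
    and f: "\<And>A. A \<in> orbit \<mu>1 \<mu>2 n1 n2 \<Longrightarrow> eval_at A f = 0"
  shows "f \<in> I"
proof -
  let ?a = "generic_matrix :: ('n \<times> 'n) comm_poly ^ 'n ^ 'n"
  let ?B1 = "?a - mat (comm_const \<mu>1)" and ?B2 = "?a - mat (comm_const \<mu>2)"
  define g where "g S = (\<chi> i j. if j \<in> S then ?B2 $ i $ j else - ?B1 $ i $ j)" for S :: "'n set"
  define D :: "'n set \<Rightarrow> ('n \<times> 'n) comm_poly ^ 'n ^ 'n"
    where "D S = diagonal (\<lambda>i. comm_const (two_values \<mu>1 \<mu>2 S i))" for S
  have swap: "?B2 ** ?B1 = ?B1 ** ?B2"
    by (simp add: vec_eq_iff diff_mat_mult mult_diff_mat) (simp add: mat_def algebra_simps)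
  \<comment> \<open>By the quadratic relation, the columns of \<open>?B2\<close> are eigenvectors of
    \<open>?a\<close> for \<mu>1 modulo \<open>I\<close>; since the two factors commute, those of
    \<open>?B1\<close> are eigenvectors for \<mu>2.\<close>
  have cong: "entry_cong I (?a ** g S) (g S ** D S)" for S
  proof -
    have split: "(?a ** B) $ i $ j - B $ i $ j * comm_const c = ((?a - mat (comm_const c)) ** B) $ i $ j"
      for B :: "('n \<times> 'n) comm_poly ^ 'n ^ 'n" and c i j
      by (simp add: diff_mat_mult mult.commute)
    have col: "(g S ** D S) $ i $ j = g S $ i $ j * comm_const (two_values \<mu>1 \<mu>2 S j)" for i j
      by (simp add: D_def diagonal_def matrix_matrix_mult_def if_distrib[of "\<lambda>x. y * x" for y] cong: if_cong)
    have "(?a ** g S) $ i $ j - (g S ** D S) $ i $ j \<in> I" for i j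
    proof (cases "j \<in> S")
      case True
      then have "(?a ** g S) $ i $ j = (?a ** ?B2) $ i $ j" "g S $ i $ j = ?B2 $ i $ j"
        by (simp_all add: g_def matrix_matrix_mult_def)
      then have "(?a ** g S) $ i $ j - (g S ** D S) $ i $ j = (?B1 ** ?B2) $ i $ j"
        using True by (simp only: col two_values_def if_True split)
      then show ?thesis using quad[of i j] by simp
    next
      case False
      then have *: "(?a ** g S) $ i $ j = - ((?a ** ?B1) $ i $ j)" "g S $ i $ j = - (?B1 $ i $ j)"
        by (simp_all add: g_def matrix_matrix_mult_def right_diff_distrib flip: sum_negf)
      have "(?a ** g S) $ i $ j - (g S ** D S) $ i $ j
          = - ((?a ** ?B1) $ i $ j - ?B1 $ i $ j * comm_const \<mu>2)"
        unfolding col * two_values_def if_not_P[OF False] mult_minus_left minus_diff_minus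
        by (simp only: minus_diff_eq)
      then have "(?a ** g S) $ i $ j - (g S ** D S) $ i $ j = - ((?B1 ** ?B2) $ i $ j)"
        unfolding split swap .
      then show ?thesis
        using quad[of i j] two_sided_ideal_uminus[OF I] by simp
    qed
    then show ?thesis by (simp add: entry_cong_def)
  qed
  define d where "d S = det (g S)" for S
  \<comment> \<open>Over all \<open>S\<close>, the \<open>g S\<close> are all the ways to mix
    columns of \<open>?B2\<close> and \<open>- ?B1\<close>, whose sum is the scalar matrix with
    entry \<open>\<mu>1 - \<mu>2\<close>; so \<open>det_add\<close> applies.\<close>
  have sum_d: "(\<Sum>S\<in>UNIV. d S) = comm_const ((\<mu>1 - \<mu>2) ^ CARD('n))"
  proof -
    have "(\<Sum>S\<in>UNIV. d S) = det (?B2 + - ?B1)"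
      by (simp only: det_add d_def g_def vector_uminus_component)
    also have "?B2 + - ?B1 = mat (comm_const (\<mu>1 - \<mu>2))"
      by (simp add: mat_def vec_eq_iff comm_const_diff)
    finally show ?thesis by (simp add: det_mat comm_const_power)
  qed
  have "\<exists>m. d S ^ m * f \<in> I" for S
  proof (cases "card S = n1")
    case True
    then have cS: "card (- S) = n2"
      using n by (simp add: Compl_eq_Diff_UNIV card_Diff_subset)
    obtain N F where
      F: "\<And>h. invertible h \<Longrightarrow> eval_at h F = det h ^ N * eval_at (h ** diagonal (two_values \<mu>1 \<mu>2 S) ** matrix_inv h) f"
      and sub: "\<And>g. entry_cong I (generic_matrix ** g) (g ** D S) \<Longrightarrow>
          subst_matrix g F - det g ^ N * f \<in> I"
      using homogenization_exists[OF I, of "two_values \<mu>1 \<mu>2 S" f] unfolding D_def by blast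
    have det_num: "eval_at h (det ?a) = det h" for h
      using map_entries_eval_at[of h] by (simp add: eval_at_def num.ev_det')
    \<comment> \<open>The values of \<open>F\<close> are controlled at invertible matrices only; the
      factor \<open>det ?a\<close> disposes of the others, so that the product vanishes everywhere
      and is the zero polynomial.\<close>
    have "eval_at h (F * det ?a) = 0" for h
    proof (cases "invertible h")
      case inv: True
      then have "h ** diagonal (two_values \<mu>1 \<mu>2 S) ** matrix_inv h \<in> orbit \<mu>1 \<mu>2 n1 n2"
        unfolding orbit_eq using True cS by blast
      then show ?thesis using F[OF inv] f by (simp add: eval_at_def num.ev_mult)
    next
      case False
      then have "det h = 0" by (simp add: invertible_det_nz)
      then show ?thesis
        using det_num[of h] by (simp add: eval_at_def num.ev_mult)
    qed
    then have "comm_eval (\<lambda>c. c) v (F * det ?a) = 0" for v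
      using map_entries_eval_at[of "\<chi> j i. v (i, j)"]
      by (drule_tac x = "\<chi> j i. v (i, j)" in meta_spec) (simp add: eval_at_def case_prod_unfold)
    then have "F * det ?a = 0" by (rule comm_poly_eq_zeroI)
    then have "subst_matrix (g S) (F * det ?a) = 0"
      by (simp add: subst_matrix_def sub.ev_zero)
    moreover have "subst_matrix (g S) (det ?a) = d S"
      using map_entries_subst_matrix[of "g S"] by (simp add: subst_matrix_def sub.ev_det' d_def)
    ultimately have "subst_matrix (g S) F * d S = 0"
      by (simp add: subst_matrix_def sub.ev_mult)
    moreover have "(subst_matrix (g S) F - d S ^ N * f) * d S \<in> I"
      using sub[OF cong] unfolding d_def by (rule two_sided_ideal_rmult[OF I])
    ultimately have "- (d S ^ Suc N * f) \<in> I"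
      by (simp add: algebra_simps)
    then have "d S ^ Suc N * f \<in> I" using two_sided_ideal_uminus[OF I] by fastforce
    then show ?thesis by blast
  next
    case False
    \<comment> \<open>The traces of \<open>?a g ?B\<close> and \<open>g D ?B\<close> agree modulo
      \<open>I\<close>. Cyclicity evaluates the second one by means of a left adjugate, and
      exchanging \<open>?B\<close> for \<open>?B'\<close> costs another factor \<open>d S\<close>;
      hence the square of \<open>d S\<close> in the result.\<close>
    let ?B = "adjugate (g S)" and ?B' = "transpose (adjugate (transpose (g S)))"
    have "mat (d S) ** ?B = ?B' ** (g S ** ?B)"
      by (simp add: matrix_mul_assoc transpose_adjugate_mult d_def)
    also have "\<dots> = ?B' ** mat (d S)" by (simp add: mult_adjugate d_def)
    finally have BB': "mat (d S) ** ?B = ?B' ** mat (d S)" .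
    have comm: "A ** mat (d S) = mat (d S) ** A" for A :: "('n \<times> 'n) comm_poly ^ 'n ^ 'n"
      by (simp add: mat_mult mult_mat mult.commute)
    have scale: "trace (mat c ** A) = c * trace A" for c and A :: "('n \<times> 'n) comm_poly ^ 'n ^ 'n"
      by (simp add: mat_mult trace_def sum_distrib_left)
    have "entry_cong I (mat (d S) ** (?a ** g S ** ?B)) (mat (d S) ** (g S ** D S ** ?B))"
      by (rule entry_cong_mult[OF I entry_cong_refl[OF I] entry_cong_mult[OF I cong entry_cong_refl[OF I]]])
    then have "trace (mat (d S) ** (?a ** g S ** ?B)) - trace (mat (d S) ** (g S ** D S ** ?B)) \<in> I"
      by (rule entry_cong_trace[OF I])
    moreover have "mat (d S) ** (?a ** g S ** ?B) = mat (d S) ** (mat (d S) ** ?a)"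
      using comm[of ?a] by (simp add: mult_adjugate d_def flip: matrix_mul_assoc)
    moreover have "trace (mat (d S) ** (g S ** D S ** ?B)) = d S * (d S * trace (D S))"
    proof -
      have "mat (d S) ** (g S ** D S ** ?B) = g S ** D S ** (mat (d S) ** ?B)"
        using comm[of "g S ** D S"] by (simp add: matrix_mul_assoc)
      also have "\<dots> = mat (d S) ** ((g S ** D S) ** ?B')"
        using comm by (simp add: BB' matrix_mul_assoc)
      finally have "trace (mat (d S) ** (g S ** D S ** ?B)) = d S * trace (g S ** D S ** ?B')"
        by (simp only: scale)
      also have "g S ** D S ** ?B' = g S ** (D S ** ?B')"
        by (simp only: matrix_mul_assoc)
      also have "trace (g S ** (D S ** ?B')) = trace (D S ** (?B' ** g S))"
        by (subst trace_mul_sym) (simp add: matrix_mul_assoc)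
      also have "\<dots> = d S * trace (D S)"
        by (simp add: transpose_adjugate_mult comm scale flip: d_def)
      finally show ?thesis .
    qed
    ultimately have 1: "d S * (d S * trace ?a) - d S * (d S * trace (D S)) \<in> I"
      by (simp add: scale)
    have "trace (D S) = comm_const (of_nat (card S) * \<mu>1 + of_nat (card (- S)) * \<mu>2)"
      by (simp add: D_def trace_def diagonal_def two_values_def if_distrib[of comm_const] sum.If_cases
          comm_const_add comm_const_mult comm_const_of_nat)
    moreover have "of_nat n1 * \<mu>1 + of_nat n2 * \<mu>2 - (of_nat (card S) * \<mu>1 + of_nat (card (- S)) * \<mu>2)
        = (of_nat n1 - of_nat (card S)) * (\<mu>1 - \<mu>2)" (is "?l = ?c")
    proof -
      have "card S + card (- S) = n1 + n2"
        using card_Un_disjoint[of S "- S"] n by simp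
      then have "of_nat (card S) + of_nat (card (- S)) = (of_nat n1 + of_nat n2 :: complex)"
        by (metis of_nat_add)
      then have "of_nat (card (- S)) = of_nat n1 + of_nat n2 - (of_nat (card S) :: complex)"
        by (simp add: algebra_simps)
      then show ?thesis unfolding \<open>of_nat (card (- S)) = _\<close> by (simp add: algebra_simps)
    qed
    ultimately have c: "comm_const (of_nat n1 * \<mu>1 + of_nat n2 * \<mu>2) - trace (D S) = comm_const ?c"
      by (metis comm_const_diff)
    have "d S * (d S * (trace ?a - comm_const (of_nat n1 * \<mu>1 + of_nat n2 * \<mu>2))) \<in> I"
      using tr by (intro two_sided_ideal_lmult[OF I])
    from two_sided_ideal_diff[OF I 1 this]
    have "d S * (d S * comm_const ?c) \<in> I"
      unfolding c[symmetric] by (simp add: algebra_simps)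
    then have "f * comm_const (inverse ?c) * (d S * (d S * comm_const ?c)) \<in> I"
      by (rule two_sided_ideal_lmult[OF I])
    moreover have "?c \<noteq> 0" using False ne by simp
    then have "inverse ?c * ?c = 1" by (rule left_inverse)
    then have "comm_const (inverse ?c) * comm_const ?c = (1 :: ('n \<times> 'n) comm_poly)"
      by (simp only: comm_const_one flip: comm_const_mult)
    then have "f * comm_const (inverse ?c) * (d S * (d S * comm_const ?c)) = d S ^ 2 * f"
      by (simp add: power2_eq_square mult_ac)
    ultimately show ?thesis by metis
  qed
  then obtain m where m: "\<And>S. d S ^ m S * f \<in> I" by metis
  have "comm_const (inverse ((\<mu>1 - \<mu>2) ^ CARD('n))) * (\<Sum>S\<in>UNIV. d S) = 1"
    unfolding sum_d comm_const_mult[symmetric] using ne by (simp add: comm_const_one)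
  then show ?thesis by (rule mem_ideal_if_powers_mem[OF I]) (rule m)
qed

section \<open>Quantum Darboux coordinates\<close>

definition commutator :: "'r::ring_1 \<Rightarrow> 'r \<Rightarrow> 'r"
  where "commutator a b = a * b - b * a"

lemma commutator_add_left: "commutator (a + b) c = commutator a c + commutator b c"
  and commutator_add_right: "commutator a (b + c) = commutator a b + commutator a c"
  and commutator_diff_left: "commutator (a - b) c = commutator a c - commutator b c"
  and commutator_diff_right: "commutator a (b - c) = commutator a b - commutator a c"
  and commutator_mult_left: "commutator (a * b) c = a * commutator b c + commutator a c * b"
  and commutator_mult_right: "commutator a (b * c) = commutator a b * c + b * commutator a c"
  by (simp_all add: commutator_def algebra_simps)

lemma commutator_swap: "commutator b a = - commutator a b"
  by (simp add: commutator_def)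

lemma commutator_sum_left: "commutator (sum f A) b = (\<Sum>a\<in>A. commutator (f a) b)"
  by (simp add: commutator_def sum_distrib_left sum_distrib_right sum_subtractf)

lemma commutator_sum_right: "commutator b (sum f A) = (\<Sum>a\<in>A. commutator b (f a))"
  by (simp add: commutator_def sum_distrib_left sum_distrib_right sum_subtractf)

lemmas commutator_bilinear = commutator_add_left commutator_add_right commutator_diff_left
  commutator_diff_right commutator_sum_left commutator_sum_right

lemma commutator_zero_iff: "commutator a b = 0 \<longleftrightarrow> a * b = b * a"
  by (simp add: commutator_def)

text \<open>A Weyl algebra with Planck constant \<open>t\<close>. The momentum conjugate to
  \<open>X i j\<close> is \<open>P j i\<close>, transposed so that \<open>P\<close> and
  \<open>X\<close> multiply as matrix blocks. The indices range over the whole type; the sums below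
  cut out the block of rows in \<open>S\<close> and columns in \<open>- S\<close>.\<close>

locale heisenberg =
  fixes r :: "complex poly \<Rightarrow> 'r::ring_1" and X P :: "'n::finite \<Rightarrow> 'n \<Rightarrow> 'r"
  assumes r_add: "r (a + b) = r a + r b"
    and r_mult: "r (a * b) = r a * r b"
    and r_one: "r 1 = 1"
    and r_X: "r c * X i j = X i j * r c"
    and r_P: "r c * P i j = P i j * r c"
    and X_X: "commutator (X i j) (X k l) = 0"
    and P_P: "commutator (P i j) (P k l) = 0"
    and X_P: "commutator (X i j) (P k l) = (if i = l \<and> j = k then r t_poly else 0)"
begin

definition scal :: "complex \<Rightarrow> 'r" where "scal c = r [:c:]"

lemma r_zero: "r 0 = 0"
  using r_add[of 0 0] by simp

lemma r_commute: "r a * r b = r b * r a"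
  by (simp flip: r_mult add: mult.commute)

lemma scal_zero: "scal 0 = 0" and scal_one: "scal 1 = 1"
  by (simp_all add: scal_def r_zero r_one flip: one_pCons)

lemma scal_add: "scal (a + b) = scal a + scal b"
  by (simp add: scal_def flip: r_add)

lemma scal_mult: "scal (a * b) = scal a * scal b"
  by (simp add: scal_def mult.commute flip: r_mult)

lemma scal_sum: "scal (sum f A) = (\<Sum>a\<in>A. scal (f a))"
  by (induction A rule: infinite_finite_induct) (simp_all add: scal_zero scal_add)

lemma r_scal: "r a * scal b = scal b * r a"
  by (simp add: scal_def r_commute)

lemma scal_of_nat: "scal (of_nat k) = of_nat k"
  by (induction k) (simp_all add: scal_zero scal_one scal_add)

end

locale heisenberg_frame = heisenberg r X P
  for r :: "complex poly \<Rightarrow> 'r::ring_1" and X P :: "'n::finite \<Rightarrow> 'n \<Rightarrow> 'r" +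
  fixes S :: "'n set" and g h :: "complex ^ 'n ^ 'n" and \<mu> \<nu> :: complex
  assumes g_h: "g ** h = mat 1" and h_g: "h ** g = mat 1"
begin

text \<open>
  Here \<open>h\<close> is the inverse of \<open>g\<close>, the column indices of \<open>U\<close> and row indices of \<open>V\<close> range over \<open>- S\<close>, and
  \<open>U = g (X, 1)\<close>, \<open>V = (P, \<nu> - P X) h\<close> in block form with respect to \<open>S\<close> and \<open>- S\<close>.
\<close>

definition U :: "'n \<Rightarrow> 'n \<Rightarrow> 'r"
  where "U j d = scal (g $ j $ d) + (\<Sum>a\<in>S. scal (g $ j $ a) * X a d)"

text \<open>The rows in \<open>S\<close> of the inverse of \<open>g\<close> times the unipotent
  matrix with off-diagonal block \<open>X\<close>; the rows of that inverse in \<open>- S\<close>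
  are those of \<open>h\<close>, and \<open>U\<close> collects the columns in \<open>- S\<close> of
  the product itself. Hence \<open>Y_U\<close>.\<close>

definition Y :: "'n \<Rightarrow> 'n \<Rightarrow> 'r"
  where "Y a i = scal (h $ a $ i) - (\<Sum>e\<in>- S. scal (h $ e $ i) * X a e)"

definition V :: "'n \<Rightarrow> 'n \<Rightarrow> 'r"
  where "V b i = scal (\<nu> * h $ b $ i) + (\<Sum>a\<in>S. P b a * Y a i)"

text \<open>The projection onto the span of the columns of \<open>U\<close>, with commuting entries.
  The complementary projection \<open>delta - H\<close> is what the commutators of \<open>U\<close>
  with \<open>V\<close> produce.\<close>

definition H :: "'n \<Rightarrow> 'n \<Rightarrow> 'r"
  where "H j i = (\<Sum>e\<in>- S. scal (h $ e $ i) * U j e)"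

definition L :: "'n \<Rightarrow> 'n \<Rightarrow> 'r"
  where "L j i = (\<Sum>b\<in>- S. U j b * V b i)"

definition delta :: "'n \<Rightarrow> 'n \<Rightarrow> 'r"
  where "delta j i = (if j = i then 1 else 0)"

lemma commutator_r_scal: "commutator (r c) (scal x) = 0"
  by (simp add: commutator_zero_iff r_scal)

lemma r_U: "commutator (r c) (U j d) = 0"
  by (simp add: U_def commutator_bilinear commutator_mult_right commutator_r_scal
      commutator_zero_iff[THEN iffD2, OF r_X])

lemma r_Y: "commutator (r c) (Y j d) = 0"
  by (simp add: Y_def commutator_bilinear commutator_mult_right commutator_r_scal
      commutator_zero_iff[THEN iffD2, OF r_X])

lemma r_V: "commutator (r c) (V j d) = 0"
  by (simp add: V_def commutator_bilinear commutator_mult_right commutator_r_scal r_Y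
      commutator_zero_iff[THEN iffD2, OF r_P])

lemma r_L: "commutator (r c) (L j d) = 0"
  by (simp add: L_def commutator_bilinear commutator_mult_right r_U r_V)

lemma commutator_r:
  "commutator (r c) (U j d) = 0" "commutator (U j d) (r c) = 0"
  "commutator (r c) (Y j d) = 0" "commutator (Y j d) (r c) = 0"
  "commutator (r c) (V j d) = 0" "commutator (V j d) (r c) = 0"
  "commutator (r c) (X j d) = 0" "commutator (X j d) (r c) = 0"
  "commutator (r c) (P j d) = 0" "commutator (P j d) (r c) = 0"
  "commutator (r c) (L j d) = 0" "commutator (L j d) (r c) = 0"
  "commutator (r c) (r c') = 0"
  using r_U[of c j d] r_Y[of c j d] r_V[of c j d] r_L[of c j d] r_X[of c j d] r_P[of c j d] r_commute[of c c']
  by (simp_all add: commutator_def)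

lemma commutator_scal:
  "commutator (scal c) (U j d) = 0" "commutator (U j d) (scal c) = 0"
  "commutator (scal c) (Y j d) = 0" "commutator (Y j d) (scal c) = 0"
  "commutator (scal c) (V j d) = 0" "commutator (V j d) (scal c) = 0"
  "commutator (scal c) (X j d) = 0" "commutator (X j d) (scal c) = 0"
  "commutator (scal c) (P j d) = 0" "commutator (P j d) (scal c) = 0"
  "commutator (scal c) (L j d) = 0" "commutator (L j d) (scal c) = 0"
  "commutator (scal c) (scal c') = 0"
  by (simp_all only: scal_def commutator_r)

lemma X_U: "commutator (X i j) (U k d) = 0"
  by (simp add: U_def commutator_bilinear commutator_mult_right commutator_scal X_X)

lemma U_U: "commutator (U i j) (U k d) = 0"
  by (simp add: U_def[of i] commutator_bilinear commutator_mult_left commutator_scal X_U)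

lemma X_Y: "commutator (X i j) (Y k d) = 0"
  by (simp add: Y_def commutator_bilinear commutator_mult_right commutator_scal X_X)

lemma Y_Y: "commutator (Y i j) (Y k d) = 0"
  by (simp add: Y_def[of i] commutator_bilinear commutator_mult_left commutator_scal X_Y)

lemma U_H: "U i j * H k d = H k d * U i j"
  by (simp flip: commutator_zero_iff add: H_def commutator_bilinear commutator_mult_right commutator_scal U_U)

lemma sum_S_compl: "(\<Sum>a\<in>S. f a) + (\<Sum>a\<in>- S. f a) = (\<Sum>a\<in>UNIV. f a :: 'x::comm_monoid_add)"
  by (subst sum.union_disjoint[symmetric]) (auto simp: Compl_partition)

text \<open>The equation \<open>g h = 1\<close>, split along \<open>S\<close> and
  \<open>- S\<close>; the terms containing \<open>X\<close> are the same on both sides because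
  numerical scalars commute.\<close>

lemma g_Y: "(\<Sum>a\<in>S. scal (g $ j $ a) * Y a i) = delta j i - H j i"
proof -
  have "(\<Sum>a\<in>S. g $ j $ a * h $ a $ i) + (\<Sum>a\<in>- S. g $ j $ a * h $ a $ i) = (if j = i then 1 else 0)"
    unfolding sum_S_compl using arg_cong[OF g_h, of "\<lambda>A. A $ j $ i"]
    by (simp add: matrix_matrix_mult_def mat_def)
  then have "scal (\<Sum>a\<in>S. g $ j $ a * h $ a $ i) + scal (\<Sum>a\<in>- S. g $ j $ a * h $ a $ i) = delta j i"
    by (simp add: delta_def scal_one scal_zero flip: scal_add)
  then have 1: "(\<Sum>a\<in>S. scal (g $ j $ a) * scal (h $ a $ i))
      = delta j i - (\<Sum>e\<in>- S. scal (h $ e $ i) * scal (g $ j $ e))"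
    by (simp add: scal_sum eq_diff_eq mult.commute flip: scal_mult)
  have 2: "(\<Sum>a\<in>S. scal (g $ j $ a) * (\<Sum>e\<in>- S. scal (h $ e $ i) * X a e))
      = (\<Sum>e\<in>- S. scal (h $ e $ i) * (\<Sum>a\<in>S. scal (g $ j $ a) * X a e))"
  proof -
    have "scal x * scal y = scal y * scal x" for x y
      by (simp add: mult.commute flip: scal_mult)
    then have *: "scal x * (scal y * z) = scal y * (scal x * z)" for x y z
      by (simp flip: mult.assoc)
    show ?thesis
      unfolding sum_distrib_left * [of "g $ j $ _"] by (rule sum.swap)
  qed
  have "(\<Sum>a\<in>S. scal (g $ j $ a) * Y a i) = (\<Sum>a\<in>S. scal (g $ j $ a) * scal (h $ a $ i))
      - (\<Sum>a\<in>S. scal (g $ j $ a) * (\<Sum>e\<in>- S. scal (h $ e $ i) * X a e))"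
    by (simp only: Y_def right_diff_distrib sum_subtractf)
  moreover have "H j i = (\<Sum>e\<in>- S. scal (h $ e $ i) * scal (g $ j $ e))
      + (\<Sum>e\<in>- S. scal (h $ e $ i) * (\<Sum>a\<in>S. scal (g $ j $ a) * X a e))"
    by (simp only: H_def U_def distrib_left sum.distrib)
  ultimately show ?thesis unfolding 1 2 by (simp only: diff_diff_eq)
qed

text \<open>The only contraction is that of \<open>X\<close> in \<open>U\<close> with
  \<open>P\<close> in \<open>V\<close>. It replaces \<open>P\<close> by \<open>t\<close> and leaves
  \<open>g Y\<close>, which \<open>g_Y\<close> turns into a projection independent of the pair
  \<open>b\<close>, \<open>d\<close>.\<close>

lemma U_V:
  assumes "b \<in> - S" "d \<in> - S"
  shows "commutator (U j d) (V b i) = (if b = d then r t_poly * (delta j i - H j i) else 0)"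
proof -
  have X_V: "commutator (X a d) (V b i) = (if b = d then r t_poly * Y a i else 0)" if "a \<in> S" for a
  proof -
    have "commutator (X a d) (V b i) = (\<Sum>c\<in>S. commutator (X a d) (P b c) * Y c i)"
      by (simp add: V_def commutator_bilinear commutator_mult_right commutator_scal X_Y)
    also have "\<dots> = (\<Sum>c\<in>S. if c = a then (if b = d then r t_poly * Y a i else 0) else 0)"
      by (intro sum.cong refl) (auto simp: X_P)
    finally show ?thesis using that by simp
  qed
  have "commutator (U j d) (V b i) = (\<Sum>a\<in>S. scal (g $ j $ a) * commutator (X a d) (V b i))"
    by (simp add: U_def commutator_bilinear commutator_mult_left commutator_scal)
  also have "\<dots> = (\<Sum>a\<in>S. if b = d then r t_poly * (scal (g $ j $ a) * Y a i) else 0)"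
    by (intro sum.cong refl) (auto simp: X_V r_scal simp flip: mult.assoc)
  finally show ?thesis by (simp add: g_Y flip: sum_distrib_left)
qed

lemma P_Y:
  assumes "b \<in> - S"
  shows "commutator (P b c) (Y a i) = (if a = c then r t_poly * scal (h $ b $ i) else 0)"
proof -
  have "commutator (P b c) (Y a i) = (\<Sum>e\<in>- S. scal (h $ e $ i) * commutator (X a e) (P b c))"
    by (simp add: Y_def commutator_bilinear commutator_mult_right commutator_scal
        commutator_swap[of "P b c" "X _ _"] sum_negf)
  also have "\<dots> = (\<Sum>e\<in>- S. if e = b then (if a = c then r t_poly * scal (h $ b $ i) else 0) else 0)"
    by (intro sum.cong refl) (auto simp: X_P r_scal)
  finally show ?thesis using assms by simp
qed

text \<open>The rows of \<open>V\<close> do not commute, since the momenta in one row act on the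
  coordinates inside \<open>Y\<close> in the other.\<close>

lemma V_V:
  assumes "b \<in> - S" "d \<in> - S"
  shows "commutator (V b i) (V d m) =
    r t_poly * (scal (h $ b $ m) * V d i - scal (h $ d $ i) * V b m)"
proof -
  have P_scal: "P d a * (r t_poly * scal x) = r t_poly * scal x * P d a" for d a x
    by (simp add: scal_def r_P mult.assoc flip: r_mult)
  have P_V: "commutator (P b a) (V d m) = r t_poly * scal (h $ b $ m) * P d a"
    if "b \<in> - S" "d \<in> - S" "a \<in> S" for a b d m
  proof -
    have "commutator (P b a) (V d m) = (\<Sum>c\<in>S. P d c * commutator (P b a) (Y c m))"
      by (simp add: V_def commutator_bilinear commutator_mult_right commutator_scal P_P)
    also have "\<dots> = (\<Sum>c\<in>S. if c = a then r t_poly * scal (h $ b $ m) * P d a else 0)"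
      using that by (intro sum.cong refl) (auto simp: P_Y P_scal)
    finally show ?thesis using that by simp
  qed
  have Y_V: "commutator (Y a i) (V d m) = - (r t_poly * scal (h $ d $ i) * Y a m)"
    if "d \<in> - S" "a \<in> S" for a d i m
  proof -
    have "commutator (Y a i) (V d m) = (\<Sum>c\<in>S. - (commutator (P d c) (Y a i) * Y c m))"
      by (simp add: V_def commutator_bilinear commutator_mult_right commutator_scal Y_Y
          commutator_swap[of "Y _ _" "P _ _"])
    also have "\<dots> = (\<Sum>c\<in>S. if c = a then - (r t_poly * scal (h $ d $ i) * Y a m) else 0)"
      using that by (intro sum.cong refl) (auto simp: P_Y)
    finally show ?thesis using that by simp
  qed
  have *: "(\<Sum>a\<in>S. P b a * Y a i) = V b i - scal \<nu> * scal (h $ b $ i)" for b i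
    by (simp add: V_def scal_mult)
  have scal_swap: "scal x * (scal \<nu> * scal y) = scal y * (scal \<nu> * scal x)" for x y
    by (simp add: mult_ac flip: scal_mult)
  have "commutator (V b i) (V d m) = (\<Sum>a\<in>S. P b a * commutator (Y a i) (V d m) + commutator (P b a) (V d m) * Y a i)"
    by (simp add: V_def[of b i] commutator_bilinear commutator_mult_left commutator_scal)
  also have "\<dots> = (\<Sum>a\<in>S. r t_poly * scal (h $ b $ m) * (P d a * Y a i) - r t_poly * scal (h $ d $ i) * (P b a * Y a m))"
  proof (intro sum.cong refl)
    fix a assume a: "a \<in> S"
    have "P b a * (r t_poly * scal (h $ d $ i) * Y a m) = r t_poly * scal (h $ d $ i) * (P b a * Y a m)"
      using P_scal[of b a "h $ d $ i"] by (simp flip: mult.assoc)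
    then show "P b a * commutator (Y a i) (V d m) + commutator (P b a) (V d m) * Y a i =
        r t_poly * scal (h $ b $ m) * (P d a * Y a i) - r t_poly * scal (h $ d $ i) * (P b a * Y a m)"
      using assms a by (simp add: P_V Y_V mult.assoc)
  qed
  \<comment> \<open>Completing the sums of \<open>P Y\<close> to \<open>V\<close> introduces a
    multiple of \<nu> in each of the two terms; these corrections are equal and cancel in the
    difference.\<close>
  also have "\<dots> = r t_poly * scal (h $ b $ m) * (V d i - scal \<nu> * scal (h $ d $ i))
      - r t_poly * scal (h $ d $ i) * (V b m - scal \<nu> * scal (h $ b $ m))"
    unfolding sum_subtractf sum_distrib_left[symmetric] * ..
  also have "\<dots> = r t_poly * (scal (h $ b $ m) * V d i - scal (h $ d $ i) * V b m)"
    unfolding mult.assoc right_diff_distrib scal_swap[of "h $ d $ i"] by (simp only: diff_diff_eq2 diff_add_cancel)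
  finally show ?thesis .
qed

lemma h_U: "(\<Sum>i\<in>UNIV. scal (h $ k $ i) * U i d) = delta k d + (if k \<in> S then X k d else 0)"
proof -
  have hg: "(\<Sum>i\<in>UNIV. scal (h $ k $ i) * scal (g $ i $ l)) = delta k l" for l
  proof -
    have "scal (\<Sum>i\<in>UNIV. h $ k $ i * g $ i $ l) = delta k l"
      using arg_cong[OF h_g, of "\<lambda>A. A $ k $ l"]
      by (simp add: matrix_matrix_mult_def mat_def delta_def scal_one scal_zero)
    then show ?thesis by (simp add: scal_sum scal_mult)
  qed
  have "(\<Sum>i\<in>UNIV. scal (h $ k $ i) * U i d) = delta k d
      + (\<Sum>i\<in>UNIV. \<Sum>a\<in>S. scal (h $ k $ i) * scal (g $ i $ a) * X a d)"
    by (simp add: U_def distrib_left sum.distrib hg sum_distrib_left mult.assoc)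
  also have "(\<Sum>i\<in>UNIV. \<Sum>a\<in>S. scal (h $ k $ i) * scal (g $ i $ a) * X a d)
      = (\<Sum>a\<in>S. \<Sum>i\<in>UNIV. scal (h $ k $ i) * scal (g $ i $ a) * X a d)"
    by (rule sum.swap)
  also have "\<dots> = (\<Sum>a\<in>S. if a = k then X k d else 0)"
    unfolding sum_distrib_right[symmetric] hg by (intro sum.cong refl) (auto simp: delta_def)
  finally show ?thesis by simp
qed

lemma Y_U:
  assumes "a \<in> S" "d \<in> - S"
  shows "(\<Sum>i\<in>UNIV. Y a i * U i d) = 0"
proof -
  have "Y a i * U i d = scal (h $ a $ i) * U i d - (\<Sum>e\<in>- S. X a e * (scal (h $ e $ i) * U i d))" for i
    by (simp add: Y_def left_diff_distrib sum_distrib_right scal_def r_X mult.assoc)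
  then have "(\<Sum>i\<in>UNIV. Y a i * U i d) = (\<Sum>i\<in>UNIV. scal (h $ a $ i) * U i d)
      - (\<Sum>i\<in>UNIV. \<Sum>e\<in>- S. X a e * (scal (h $ e $ i) * U i d))"
    by (simp only: sum_subtractf)
  also have "(\<Sum>i\<in>UNIV. \<Sum>e\<in>- S. X a e * (scal (h $ e $ i) * U i d))
      = (\<Sum>e\<in>- S. X a e * (\<Sum>i\<in>UNIV. scal (h $ e $ i) * U i d))"
    by (subst sum.swap) (simp only: sum_distrib_left)
  also have "\<dots> = (\<Sum>e\<in>- S. if e = d then X a d else 0)"
    unfolding h_U by (intro sum.cong refl) (auto simp: delta_def)
  finally show ?thesis using assms by (auto simp: h_U delta_def)
qed

text \<open>The term with \<open>P\<close> disappears because \<open>Y\<close> annihilates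
  \<open>U\<close>, and as \<open>P\<close> stands leftmost, nothing has to be reordered: there is
  no correction in \<open>t\<close>.\<close>

lemma V_U:
  assumes "b \<in> - S" "d \<in> - S"
  shows "(\<Sum>i\<in>UNIV. V b i * U i d) = scal \<nu> * delta b d"
proof -
  have "V b i * U i d = scal \<nu> * (scal (h $ b $ i) * U i d) + (\<Sum>a\<in>S. P b a * (Y a i * U i d))" for i
    by (simp add: V_def distrib_right sum_distrib_right scal_mult mult.assoc)
  then have "(\<Sum>i\<in>UNIV. V b i * U i d) = scal \<nu> * (\<Sum>i\<in>UNIV. scal (h $ b $ i) * U i d)
      + (\<Sum>i\<in>UNIV. \<Sum>a\<in>S. P b a * (Y a i * U i d))"
    by (simp only: sum.distrib sum_distrib_left)
  also have "(\<Sum>i\<in>UNIV. \<Sum>a\<in>S. P b a * (Y a i * U i d)) = (\<Sum>a\<in>S. P b a * (\<Sum>i\<in>UNIV. Y a i * U i d))"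
    by (subst sum.swap) (simp only: sum_distrib_left)
  also have "\<dots> = 0" using assms by (simp add: Y_U)
  finally show ?thesis using assms by (simp add: h_U)
qed

text \<open>Contracting \<open>V\<close> with \<open>U\<close> and \<open>U\<close> with
  \<open>V\<close> yields the expected bracket, but with \<open>delta - H\<close> in place of
  \<open>delta\<close>. The commutators of \<open>V\<close> with \<open>V\<close> supply exactly the
  missing terms with \<open>H\<close>.\<close>

lemma L_L:
  "commutator (L j i) (L k m) = r t_poly * (delta j m * L k i - delta k i * L j m)"
proof -
  let ?\<tau> = "r t_poly"
  have U_\<tau>: "U a b * (?\<tau> * z) = ?\<tau> * (U a b * z)" and U_scal: "U a b * (scal c * z) = scal c * (U a b * z)"
    and UU: "U a b * (U a' b' * z) = U a' b' * (U a b * z)" for a b a' b' c z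
    using r_U[of t_poly a b] r_U[of "[:c:]" a b] U_U[of a b a' b']
    by (simp_all add: commutator_zero_iff scal_def flip: mult.assoc)
  have U_N: "U a b * ((delta c e - H c e) * z) = (delta c e - H c e) * (U a b * z)" for a b c e z
  proof -
    have "U a b * (delta c e - H c e) = (delta c e - H c e) * U a b"
      by (simp add: left_diff_distrib right_diff_distrib U_H) (simp add: delta_def)
    then show ?thesis by (simp flip: mult.assoc)
  qed
  have "commutator (L j i) (L k m) = (\<Sum>b\<in>- S. \<Sum>d\<in>- S.
      U j b * (commutator (V b i) (U k d) * V d m) + U j b * (U k d * commutator (V b i) (V d m))
      + U k d * (commutator (U j b) (V d m) * V b i))"
    by (simp add: L_def commutator_sum_left)
      (simp add: commutator_sum_right commutator_mult_left commutator_mult_right U_U distrib_left mult.assoc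
        add.assoc UU[of j _ k])
  also have "\<dots> = (\<Sum>b\<in>- S. \<Sum>d\<in>- S. U j b * (commutator (V b i) (U k d) * V d m))
      + (\<Sum>b\<in>- S. \<Sum>d\<in>- S. U j b * (U k d * commutator (V b i) (V d m)))
      + (\<Sum>b\<in>- S. \<Sum>d\<in>- S. U k d * (commutator (U j b) (V d m) * V b i))"
    by (simp only: sum.distrib)
  also have "(\<Sum>b\<in>- S. \<Sum>d\<in>- S. U j b * (commutator (V b i) (U k d) * V d m))
      = - (?\<tau> * ((delta k i - H k i) * L j m))"
  proof -
    have "(\<Sum>b\<in>- S. \<Sum>d\<in>- S. U j b * (commutator (V b i) (U k d) * V d m))
        = (\<Sum>b\<in>- S. \<Sum>d\<in>- S. if d = b then - (?\<tau> * ((delta k i - H k i) * (U j b * V b m))) else 0)"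
      by (intro sum.cong refl)
        (auto simp: commutator_swap[of "V _ _" "U _ _"] U_V U_\<tau> U_N mult.assoc)
    also have "\<dots> = (\<Sum>b\<in>- S. - (?\<tau> * ((delta k i - H k i) * (U j b * V b m))))"
      by (intro sum.cong refl) simp
    also have "\<dots> = - (?\<tau> * ((delta k i - H k i) * L j m))"
      unfolding L_def sum_distrib_left sum_negf ..
    finally show ?thesis .
  qed
  also have "(\<Sum>b\<in>- S. \<Sum>d\<in>- S. U k d * (commutator (U j b) (V d m) * V b i))
      = ?\<tau> * ((delta j m - H j m) * L k i)"
  proof -
    have "(\<Sum>b\<in>- S. \<Sum>d\<in>- S. U k d * (commutator (U j b) (V d m) * V b i))
        = (\<Sum>b\<in>- S. \<Sum>d\<in>- S. if d = b then ?\<tau> * ((delta j m - H j m) * (U k b * V b i)) else 0)"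
      by (intro sum.cong refl) (auto simp: U_V U_\<tau> U_N mult.assoc)
    also have "\<dots> = (\<Sum>b\<in>- S. ?\<tau> * ((delta j m - H j m) * (U k b * V b i)))"
      by (intro sum.cong refl) simp
    also have "\<dots> = ?\<tau> * ((delta j m - H j m) * L k i)"
      unfolding L_def sum_distrib_left ..
    finally show ?thesis .
  qed
  also have "(\<Sum>b\<in>- S. \<Sum>d\<in>- S. U j b * (U k d * commutator (V b i) (V d m)))
      = ?\<tau> * (H j m * L k i) - ?\<tau> * (H k i * L j m)"
  proof -
    have "U j b * (U k d * commutator (V b i) (V d m))
        = ?\<tau> * (scal (h $ b $ m) * U j b * (U k d * V d i)) - ?\<tau> * (scal (h $ d $ i) * U k d * (U j b * V b m))"
      if "b \<in> - S" "d \<in> - S" for b d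
      unfolding V_V[OF that] right_diff_distrib U_\<tau> U_scal mult.assoc UU[of j b k d "V b m"] ..
    then have "(\<Sum>b\<in>- S. \<Sum>d\<in>- S. U j b * (U k d * commutator (V b i) (V d m)))
        = ?\<tau> * (\<Sum>b\<in>- S. \<Sum>d\<in>- S. scal (h $ b $ m) * U j b * (U k d * V d i))
          - ?\<tau> * (\<Sum>b\<in>- S. \<Sum>d\<in>- S. scal (h $ d $ i) * U k d * (U j b * V b m))"
      by (simp add: sum_subtractf sum_distrib_left)
    also have "(\<Sum>b\<in>- S. \<Sum>d\<in>- S. scal (h $ b $ m) * U j b * (U k d * V d i)) = H j m * L k i"
      by (simp only: H_def L_def sum_product)
    also have "(\<Sum>b\<in>- S. \<Sum>d\<in>- S. scal (h $ d $ i) * U k d * (U j b * V b m)) = H k i * L j m"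
      by (subst sum.swap) (simp only: H_def L_def sum_product)
    finally show ?thesis .
  qed
  finally show ?thesis by (simp add: algebra_simps)
qed

text \<open>Row \<open>j\<close>, column \<open>i\<close>: this is the operator for
  \<open>gen i j\<close>. The two eigenvalues are \<open>\<mu>\<close> and
  \<open>\<mu> + \<nu>\<close>. In the commutation relations the scalar shift cancels.\<close>

definition E :: "'n \<Rightarrow> 'n \<Rightarrow> 'r"
  where "E j i = scal (if j = i then \<mu> else 0) + L j i"

lemma E_E:
  "commutator (E j i) (E k m) = r t_poly * ((if m = j then E k i else 0) - (if i = k then E j m else 0))"
proof -
  have "commutator (E j i) (E k m) = r t_poly * (delta j m * L k i - delta k i * L j m)"
    unfolding E_def by (simp only: commutator_bilinear commutator_scal L_L add_0_left)
  also have "delta j m * L k i - delta k i * L j m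
      = (if m = j then E k i else 0) - (if i = k then E j m else 0)"
    by (auto simp: E_def delta_def scal_zero)
  finally show ?thesis .
qed

lemma r_E: "r c * E j i = E j i * r c"
  using r_L[of c j i] by (simp add: E_def distrib_left distrib_right r_scal commutator_zero_iff)

text \<open>With \<open>L = U V\<close> and \<open>V U = \<nu>\<close> one has
  \<open>L L = U (V U) V = \<nu> L\<close>.\<close>

lemma E_quadratic:
  "(\<Sum>k\<in>UNIV. (E j k - scal (if j = k then \<mu> else 0)) * (E k m - scal (if k = m then \<mu> + \<nu> else 0))) = 0"
proof -
  have scal_L: "L j m * scal \<nu> = scal \<nu> * L j m"
    using r_L[of "[:\<nu>:]" j m] by (simp add: commutator_zero_iff scal_def)
  have "(\<Sum>k\<in>UNIV. L j k * L k m) = (\<Sum>k\<in>UNIV. \<Sum>b\<in>- S. \<Sum>d\<in>- S. U j b * (V b k * U k d) * V d m)"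
    by (simp add: L_def sum_product mult.assoc)
  also have "\<dots> = (\<Sum>b\<in>- S. \<Sum>d\<in>- S. \<Sum>k\<in>UNIV. U j b * (V b k * U k d) * V d m)"
    by (subst sum.swap) (intro sum.cong refl sum.swap)
  also have "\<dots> = (\<Sum>b\<in>- S. \<Sum>d\<in>- S. U j b * (\<Sum>k\<in>UNIV. V b k * U k d) * V d m)"
    by (simp only: sum_distrib_left sum_distrib_right)
  also have "\<dots> = (\<Sum>b\<in>- S. \<Sum>d\<in>- S. if d = b then U j b * scal \<nu> * V b m else 0)"
    by (intro sum.cong refl) (auto simp: V_U delta_def)
  also have "\<dots> = (\<Sum>b\<in>- S. U j b * scal \<nu> * V b m)"
    by (intro sum.cong refl) simp
  also have "\<dots> = (\<Sum>b\<in>- S. scal \<nu> * (U j b * V b m))"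
    using r_U[of "[:\<nu>:]"] by (simp add: commutator_zero_iff scal_def flip: mult.assoc)
  also have "\<dots> = scal \<nu> * L j m"
    by (simp only: L_def sum_distrib_left)
  finally have 1: "(\<Sum>k\<in>UNIV. L j k * L k m) = scal \<nu> * L j m" .
  have "E j k - scal (if j = k then \<mu> else 0) = L j k" for k
    by (simp add: E_def)
  moreover have "E k m - scal (if k = m then \<mu> + \<nu> else 0) = L k m - (if k = m then scal \<nu> else 0)" for k
    by (simp add: E_def scal_add scal_zero)
  ultimately have "(\<Sum>k\<in>UNIV. (E j k - scal (if j = k then \<mu> else 0)) * (E k m - scal (if k = m then \<mu> + \<nu> else 0)))
      = (\<Sum>k\<in>UNIV. L j k * L k m) - (\<Sum>k\<in>UNIV. if k = m then L j m * scal \<nu> else 0)"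
    by (simp add: right_diff_distrib sum_subtractf if_distrib[of "\<lambda>x. y * x" for y] cong: if_cong)
  then show ?thesis by (simp add: 1 scal_L)
qed

text \<open>The source of the quantum correction. For each \<open>b \<in> - S\<close> the trace of
  \<open>U V\<close> is reordered to \<open>V U\<close>, which gives \<nu>; the commutators add
  \<open>t\<close> times the trace of \<open>delta - H\<close>, a projection of rank
  \<open>card S\<close>.\<close>

lemma E_trace:
  "(\<Sum>j\<in>UNIV. E j j) = scal (of_nat (card S) * \<mu> + of_nat (card (- S)) * (\<mu> + \<nu>))
    + r t_poly * of_nat (card S * card (- S))"
proof -
  have card: "CARD('n) = card S + card (- S)"
    using sum_S_compl[of "\<lambda>_. 1 :: nat"] by simp
  have diag: "(\<Sum>j\<in>UNIV. 1 - H j j) = of_nat (card S)"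
  proof -
    have "(\<Sum>j\<in>UNIV. H j j) = (\<Sum>e\<in>- S. \<Sum>j\<in>UNIV. scal (h $ e $ j) * U j e)"
      unfolding H_def by (rule sum.swap)
    also have "\<dots> = (\<Sum>e\<in>- S. 1)"
      by (intro sum.cong refl) (simp add: h_U delta_def)
    finally show ?thesis by (simp add: sum_subtractf card)
  qed
  have "(\<Sum>j\<in>UNIV. L j j) = (\<Sum>b\<in>- S. \<Sum>j\<in>UNIV. V b j * U j b + commutator (U j b) (V b j))"
    unfolding L_def by (subst sum.swap) (simp add: commutator_def)
  also have "\<dots> = (\<Sum>b\<in>- S. scal \<nu> + r t_poly * of_nat (card S))"
    by (intro sum.cong refl)
      (simp add: sum.distrib V_U U_V diag delta_def flip: sum_distrib_left)
  also have "\<dots> = of_nat (card (- S)) * scal \<nu> + r t_poly * of_nat (card S * card (- S))"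
    by (simp add: distrib_left mult_of_nat_commute[of "card (- S)" "r t_poly * of_nat (card S)"] mult.assoc)
  finally show ?thesis
    by (simp add: E_def sum.distrib card scal_add scal_mult scal_of_nat distrib_left distrib_right add.assoc)
qed

end

section \<open>Differential operators\<close>

text \<open>Additive maps form a type of class \<open>ring_1\<close>, so that noncommutative
  polynomials can be evaluated in them. The sort \<open>zero_neq_one\<close> on the underlying group
  guarantees \<open>0 \<noteq> 1\<close> for the operators. The type serves both the differential
  operators and the adjoint action.\<close>

typedef (overloaded) 'a endo = "{f :: 'a::{ab_group_add, zero_neq_one} \<Rightarrow> 'a. \<forall>x y. f (x + y) = f x + f y}"
  morphisms app Endo
  by (rule exI[of _ "\<lambda>x. x"]) simp

lemma app_add: "app f (x + y) = app f x + app f y"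
  using app[of f] by simp

lemma app_Endo: "(\<And>x y. f (x + y) = f x + f y) \<Longrightarrow> app (Endo f) = f"
  by (rule Endo_inverse) simp

lemma endo_eqI: "(\<And>x. app f x = app g x) \<Longrightarrow> f = g"
  by (simp add: app_inject[symmetric] fun_eq_iff)

lemma app_zero_right: "app f 0 = 0"
  using app_add[of f 0 0] by simp

lemma app_uminus_right: "app f (- x) = - app f x"
  using app_add[of f x "- x"] by (simp add: app_zero_right eq_neg_iff_add_eq_0 add.commute)

lemma app_diff_right: "app f (x - y) = app f x - app f y"
  using app_add[of f x "- y"] by (simp add: app_uminus_right)

instantiation endo :: ("{ab_group_add, zero_neq_one}") "{zero, one, plus, minus, uminus, times}"
begin
definition "0 = Endo (\<lambda>x. 0)"
definition "1 = Endo (\<lambda>x. x)"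
definition "f + g = Endo (\<lambda>x. app f x + app g x)"
definition "f - g = Endo (\<lambda>x. app f x - app g x)"
definition "- f = Endo (\<lambda>x. - app f x)"
definition "f * g = Endo (\<lambda>x. app f (app g x))"
instance ..
end

lemma app_zero: "app 0 x = 0"
  and app_one: "app 1 x = x"
  and app_plus: "app (f + g) x = app f x + app g x"
  and app_minus: "app (f - g) x = app f x - app g x"
  and app_uminus: "app (- f) x = - app f x"
  and app_times: "app (f * g) x = app f (app g x)"
  by (simp_all add: zero_endo_def one_endo_def plus_endo_def minus_endo_def uminus_endo_def
      times_endo_def app_Endo app_add)

instance endo :: ("{ab_group_add, zero_neq_one}") ring_1
proof
  show "(0 :: 'a endo) \<noteq> 1"
  proof
    assume "(0 :: 'a endo) = 1"
    then have "app (0 :: 'a endo) 1 = app 1 1" by simp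
    then show False by (simp add: app_zero app_one)
  qed
qed (auto intro!: endo_eqI simp: app_zero app_one app_plus app_minus app_uminus app_times app_add)

lemma app_sum: "app (sum h A) x = (\<Sum>a\<in>A. app (h a) x)"
  by (induction A rule: infinite_finite_induct) (simp_all add: app_zero app_plus)

text \<open>
  A formal power series in the variables \<open>'v\<close> is represented by its partial derivatives at the origin,
  so that \<open>\<partial>\<^sub>k\<close> is an index shift and multiplication by the variable \<open>k\<close> contributes the factor \<open>\<alpha> k\<close>.
\<close>

type_synonym 'v taylor = "('v \<Rightarrow> nat) \<Rightarrow> complex poly"

definition scale_op :: "complex poly \<Rightarrow> 'v taylor endo"
  where "scale_op c = Endo (\<lambda>F \<alpha>. c * F \<alpha>)"

definition mult_op :: "'v \<Rightarrow> 'v taylor endo"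
  where "mult_op k = Endo (\<lambda>F \<alpha>. of_nat (\<alpha> k) * F (\<alpha>(k := \<alpha> k - 1)))"

definition deriv_op :: "'v \<Rightarrow> 'v taylor endo"
  where "deriv_op k = Endo (\<lambda>F \<alpha>. F (\<alpha>(k := \<alpha> k + 1)))"

lemma app_scale_op: "app (scale_op c) F = (\<lambda>\<alpha>. c * F \<alpha>)"
  and app_mult_op: "app (mult_op k) F = (\<lambda>\<alpha>. of_nat (\<alpha> k) * F (\<alpha>(k := \<alpha> k - 1)))"
  and app_deriv_op: "app (deriv_op k) F = (\<lambda>\<alpha>. F (\<alpha>(k := \<alpha> k + 1)))"
  by (simp_all add: scale_op_def mult_op_def deriv_op_def app_Endo fun_eq_iff distrib_left)

lemma deriv_mult_op:
  "deriv_op k * mult_op l - mult_op l * deriv_op k = (if k = l then 1 else 0)"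
proof (rule endo_eqI)
  fix F :: "'a taylor"
  \<comment> \<open>For \<open>\<alpha> l = 0\<close> the subtraction truncates, but then the factor
    in front is zero.\<close>
  have *: "of_nat (\<alpha> l) * F (\<alpha>(l := Suc (\<alpha> l - Suc 0))) = of_nat (\<alpha> l) * F \<alpha>" for \<alpha>
    by (cases "\<alpha> l = 0") (simp_all add: fun_upd_idem)
  show "app (deriv_op k * mult_op l - mult_op l * deriv_op k) F = app (if k = l then 1 else 0) F"
  proof (cases "k = l")
    case True
    have "of_nat (Suc (\<alpha> l)) * F \<alpha> - of_nat (\<alpha> l) * F (\<alpha>(l := Suc (\<alpha> l - Suc 0))) = F \<alpha>" for \<alpha>
      unfolding * by (simp add: distrib_right)
    then show ?thesis
      using True by (simp add: app_minus app_times app_mult_op app_deriv_op app_one fun_eq_iff)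
  next
    case False
    then show ?thesis
      by (simp add: app_minus app_times app_mult_op app_deriv_op app_zero fun_eq_iff fun_upd_twist)
  qed
qed

lemma mult_op_commute: "mult_op k * mult_op l = mult_op l * mult_op k"
  by (cases "k = l")
    (auto intro!: endo_eqI simp: app_times app_mult_op fun_eq_iff fun_upd_twist mult_ac)

lemma scale_op_commute:
  "scale_op c * mult_op k = mult_op k * scale_op c"
  "scale_op c * deriv_op k = deriv_op k * scale_op c"
  "scale_op c * scale_op d = scale_op d * scale_op c"
  by (auto intro!: endo_eqI simp: app_times app_scale_op app_mult_op app_deriv_op mult_ac)

text \<open>The sign comes from the convention \<open>[x, p] = t\<close>, which
  \<open>p = - t d/dx\<close> satisfies.\<close>

definition momentum_op :: "'v \<Rightarrow> 'v taylor endo"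
  where "momentum_op k = - (scale_op t_poly * deriv_op k)"

lemma scale_momentum_op_commute: "scale_op c * momentum_op k = momentum_op k * scale_op c"
  by (rule endo_eqI) (simp add: momentum_op_def app_times app_uminus app_scale_op app_deriv_op fun_eq_iff)

lemma momentum_op_commute: "momentum_op k * momentum_op l = momentum_op l * momentum_op k"
  by (cases "k = l")
    (auto intro!: endo_eqI simp: momentum_op_def app_times app_uminus app_scale_op app_deriv_op
      fun_eq_iff fun_upd_twist)

interpretation weyl: heisenberg scale_op "\<lambda>a b. mult_op (a, b)" "\<lambda>b a. momentum_op (a, b :: 'n::finite)"
proof
  fix a b and i j k l :: 'n and c
  show "scale_op (a + b) = (scale_op a + scale_op b :: ('n \<times> 'n) taylor endo)"
    by (rule endo_eqI) (simp add: app_scale_op app_plus fun_eq_iff distrib_right)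
  show "scale_op (a * b) = (scale_op a * scale_op b :: ('n \<times> 'n) taylor endo)"
    by (rule endo_eqI) (simp add: app_scale_op app_times mult.assoc)
  show "scale_op 1 = (1 :: ('n \<times> 'n) taylor endo)"
    by (rule endo_eqI) (simp add: app_scale_op app_one)
  show "scale_op c * mult_op (i, j) = mult_op (i, j) * scale_op c"
    by (rule scale_op_commute)
  show "scale_op c * momentum_op (j, i) = momentum_op (j, i) * scale_op c"
    by (rule scale_momentum_op_commute)
  show "commutator (mult_op (i, j)) (mult_op (k, l)) = 0"
    by (simp add: commutator_zero_iff mult_op_commute)
  show "commutator (momentum_op (j, i)) (momentum_op (l, k)) = 0"
    by (simp add: commutator_zero_iff momentum_op_commute)
  have "commutator (mult_op (i, j)) (momentum_op (l, k)) =
      scale_op t_poly * (deriv_op (l, k) * mult_op (i, j) - mult_op (i, j) * deriv_op (l, k))"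
    using scale_op_commute(1)[of t_poly "(i, j)"]
    by (simp add: commutator_def momentum_op_def right_diff_distrib mult.assoc) (simp flip: mult.assoc)
  then show "commutator (mult_op (i, j)) (momentum_op (l, k)) =
      (if i = l \<and> j = k then scale_op t_poly else 0)"
    by (auto simp: deriv_mult_op)
qed

text \<open>Evaluation at the origin and at \<open>t = 0\<close>. It kills the image of every
  coordinate, which vanishes at the origin, and of every momentum, which carries a factor
  \<open>t\<close>; what remains of the operators is numerical.\<close>

definition base_value :: "'v taylor \<Rightarrow> complex"
  where "base_value F = coeff (F (\<lambda>_. 0)) 0"

lemma base_value_add: "base_value (F + G) = base_value F + base_value G"
  and base_value_zero: "base_value 0 = 0"
  by (simp_all add: base_value_def plus_fun_def)

lemma base_value_sum: "base_value (sum f A) = (\<Sum>a\<in>A. base_value (f a))"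
proof (induction A rule: infinite_finite_induct)
  case (infinite A)
  have "sum f A = 0" using infinite by (rule sum.infinite)
  then show ?case using infinite base_value_zero by (metis sum.infinite)
next
  case (insert a A)
  have "sum f (insert a A) = f a + sum f A" using insert(1,2) by (rule sum.insert)
  then show ?case using insert base_value_add by (metis sum.insert)
qed (simp only: sum.empty base_value_zero)

lemma base_value_scale: "base_value (app (scale_op c) F) = coeff c 0 * base_value F"
  by (simp add: base_value_def app_scale_op coeff_mult)

lemma base_value_mult_op: "base_value (app (mult_op k) F) = 0"
  by (simp add: base_value_def app_mult_op)

lemma base_value_momentum_op: "base_value (app (momentum_op k) F) = 0"
  by (simp add: base_value_def momentum_op_def app_uminus app_times app_scale_op coeff_mult)

section \<open>The classical limit of noncommutative polynomials\<close>

definition abel :: "(('n \<times> 'n) list \<Rightarrow>\<^sub>0 complex poly) \<Rightarrow> ('n \<times> 'n) comm_poly"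
  where "abel = free_eval (\<lambda>p. comm_const (coeff p 0)) comm_var"

interpretation abel: free_hom "\<lambda>p. comm_const (coeff p 0)" "comm_var :: 'n \<times> 'n \<Rightarrow> ('n \<times> 'n) comm_poly"
  rewrites "free_eval (\<lambda>p. comm_const (coeff p 0)) comm_var = abel"
  by unfold_locales (simp_all add: comm_const_add comm_const_mult comm_const_one coeff_mult mult.commute abel_def)

definition value_at :: "complex ^ 'n ^ ('n::finite) \<Rightarrow> 'n word_poly \<Rightarrow> complex"
  where "value_at A x = eval_at A (abel x)"

lemma value_at_const: "value_at A (const p) = coeff p 0"
  and value_at_gen: "value_at A (gen i j) = A $ j $ i"
  and value_at_add: "value_at A (x + y) = value_at A x + value_at A y"
  and value_at_diff: "value_at A (x - y) = value_at A x - value_at A y"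
  and value_at_mult: "value_at A (x * y) = value_at A x * value_at A y"
  and value_at_zero: "value_at A 0 = 0"
  and value_at_one: "value_at A 1 = 1"
  by (simp_all add: value_at_def eval_at_def abel.ev_const abel.ev_gen abel.ev_add abel.ev_mult
      abel.ev_zero abel.ev_one abel.ev_diff
      num.ev_const num.ev_var num.ev_add num.ev_mult num.ev_zero num.ev_one num.ev_diff)

section \<open>The representation attached to a point of the orbit\<close>

locale orbit_point =
  fixes S :: "'n::finite set" and g h :: "complex ^ 'n ^ 'n" and \<mu>1 \<mu>2 :: complex
  assumes g_h: "g ** h = mat 1" and h_g: "h ** g = mat 1"
begin

sublocale frame: heisenberg_frame scale_op "\<lambda>a b. mult_op (a, b)" "\<lambda>b a. momentum_op (a, b)"
  S g h \<mu>1 "\<mu>2 - \<mu>1"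
  by (intro heisenberg_frame.intro weyl.heisenberg_axioms heisenberg_frame_axioms.intro g_h h_g)

definition rep :: "'n word_poly \<Rightarrow> ('n \<times> 'n) taylor endo"
  where "rep = free_eval scale_op (\<lambda>(i, j). frame.E j i)"

sublocale rep: free_hom scale_op "\<lambda>(i, j). frame.E j i"
  rewrites "free_eval scale_op (\<lambda>(i, j). frame.E j i) = rep"
  by unfold_locales
    (auto simp: weyl.r_add weyl.r_mult weyl.r_one frame.r_E rep_def)

definition point :: "complex ^ 'n ^ 'n"
  where "point = g ** diagonal (two_values \<mu>1 \<mu>2 S) ** h"

lemma base_value_scal: "base_value (app (weyl.scal c) F) = c * base_value F"
  by (simp add: weyl.scal_def base_value_scale)

lemma base_value_U: "base_value (app (frame.U j d) F) = g $ j $ d * base_value F"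
  by (simp add: frame.U_def app_plus app_sum app_times base_value_add base_value_sum
      base_value_scal base_value_mult_op)

lemma base_value_V: "base_value (app (frame.V b i) F) = (\<mu>2 - \<mu>1) * h $ b $ i * base_value F"
  by (simp add: frame.V_def app_plus app_sum app_times base_value_add base_value_sum
      base_value_scal base_value_momentum_op)

lemma base_value_E: "base_value (app (frame.E j i) F) = point $ j $ i * base_value F"
proof -
  have "(\<Sum>k\<in>S. g $ j $ k * h $ k $ i) + (\<Sum>k\<in>- S. g $ j $ k * h $ k $ i) = (if j = i then 1 else 0)"
    unfolding frame.sum_S_compl using arg_cong[OF g_h, of "\<lambda>A. A $ j $ i"]
    by (simp add: matrix_matrix_mult_def mat_def)
  then have "(\<Sum>k\<in>S. g $ j $ k * h $ k $ i) = (if j = i then 1 else 0) - (\<Sum>k\<in>- S. g $ j $ k * h $ k $ i)"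
    by (simp only: eq_diff_eq)
  then have 1: "\<mu>1 * (\<Sum>k\<in>S. g $ j $ k * h $ k $ i) = (if j = i then \<mu>1 else 0) - \<mu>1 * (\<Sum>k\<in>- S. g $ j $ k * h $ k $ i)"
    by (simp add: right_diff_distrib)
  have "(g ** diagonal (two_values \<mu>1 \<mu>2 S)) $ j $ k = g $ j $ k * two_values \<mu>1 \<mu>2 S k" for k
    by (simp add: matrix_matrix_mult_def diagonal_def if_distrib[of "\<lambda>x. y * x" for y] cong: if_cong)
  then have "point $ j $ i = (\<Sum>k\<in>UNIV. g $ j $ k * two_values \<mu>1 \<mu>2 S k * h $ k $ i)"
    unfolding point_def matrix_matrix_mult_def[of "g ** _"] by simp
  also have "\<dots> = (\<Sum>k\<in>S. \<mu>1 * (g $ j $ k * h $ k $ i)) + (\<Sum>k\<in>- S. \<mu>2 * (g $ j $ k * h $ k $ i))"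
    unfolding frame.sum_S_compl[symmetric] by (simp add: two_values_def mult_ac)
  also have "\<dots> = (if j = i then \<mu>1 else 0) + (\<mu>2 - \<mu>1) * (\<Sum>k\<in>- S. g $ j $ k * h $ k $ i)"
    by (simp add: 1 left_diff_distrib flip: sum_distrib_left)
  finally have point: "point $ j $ i = (if j = i then \<mu>1 else 0) + (\<mu>2 - \<mu>1) * (\<Sum>k\<in>- S. g $ j $ k * h $ k $ i)" .
  have "base_value (app (frame.E j i) F) = (if j = i then \<mu>1 else 0) * base_value F
      + (\<Sum>b\<in>- S. g $ j $ b * ((\<mu>2 - \<mu>1) * h $ b $ i * base_value F))"
    by (simp add: frame.E_def frame.L_def app_plus app_sum app_times base_value_add base_value_sum
        base_value_scal base_value_U base_value_V)
  also have "(\<Sum>b\<in>- S. g $ j $ b * ((\<mu>2 - \<mu>1) * h $ b $ i * base_value F))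
      = (\<mu>2 - \<mu>1) * (\<Sum>b\<in>- S. g $ j $ b * h $ b $ i) * base_value F"
    by (simp add: sum_distrib_left sum_distrib_right mult_ac)
  finally show ?thesis by (simp add: point distrib_right)
qed

text \<open>Each generator acts on base values through a scalar, by \<open>base_value_E\<close>, and
  the property of acting through a scalar passes to sums and products. The scalars are the
  coordinates of \<open>point\<close>.\<close>

lemma base_value_rep: "base_value (app (rep x) F) = value_at point x * base_value F"
  by (induction x arbitrary: F rule: free_algebra_induct)
    (simp_all add: rep.ev_const rep.ev_gen rep.ev_add rep.ev_mult app_plus app_times base_value_add
      base_value_scale base_value_E value_at_const value_at_gen value_at_add value_at_mult distrib_right)

lemma value_at_eq_zero: "rep x = 0 \<Longrightarrow> value_at point x = 0"
  using base_value_rep[of x "\<lambda>_. 1"] by (simp add: app_zero base_value_zero) (simp add: base_value_def)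

text \<open>On families of polynomials in \<open>t\<close>, the element \<open>t\<close> acts by
  multiplication in an integral domain.\<close>

lemma rep_t_torsion_free:
  assumes "rep (const t_poly * x) = 0"
  shows "rep x = 0"
proof (rule endo_eqI)
  fix F
  have "app (scale_op t_poly) (app (rep x) F) = 0"
    using arg_cong[OF assms, of "\<lambda>f. app f F"]
    by (simp add: rep.ev_mult rep.ev_const app_times app_zero)
  then show "app (rep x) F = app 0 F"
    by (simp add: app_scale_op app_zero fun_eq_iff)
qed

lemma two_sided_ideal_rep: "two_sided_ideal {x. rep x = 0}"
  by (rule two_sided_idealI) (simp_all add: rep.ev_zero rep.ev_add rep.ev_mult)

lemma gl_relations_rep: "x \<in> gl_relations t_poly \<Longrightarrow> rep x = 0"
  using frame.E_E
  by (auto simp: gl_relations_def gl_bracket_def commutator_def rep.ev_diff rep.ev_mult rep.ev_gen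
      rep.ev_const rep.ev_zero)

lemma orbit_relations_rep:
  assumes "card S = n1" "card (- S) = n2" "x \<in> orbit_relations \<mu>1 \<mu>2 n1 n2"
  shows "rep x = 0"
proof -
  have m: "rep (mat (const [:c:]) $ i $ j) = weyl.scal (if i = j then c else 0)" for c i j
    by (simp add: mat_def rep.ev_const rep.ev_zero weyl.scal_def weyl.r_zero)
  have \<mu>: "\<mu>1 + (\<mu>2 - \<mu>1) = \<mu>2" by simp
  have gm: "rep (gen_matrix $ i $ j) = frame.E i j" for i j
    by (simp add: gen_matrix_def rep.ev_gen)
  have "rep (((gen_matrix - mat (const [:\<mu>1:])) ** (gen_matrix - mat (const [:\<mu>2:]))) $ j $ m) = 0" for j m
    using frame.E_quadratic[of j m, unfolded \<mu>]
    by (simp add: matrix_matrix_mult_def rep.ev_sum rep.ev_mult rep.ev_diff m gm)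
  moreover have "rep (trace gen_matrix
        - const ([:of_nat n1 * \<mu>1 + of_nat n2 * \<mu>2:] + t_poly * of_nat (n1 * n2))) = 0"
  proof -
    have "scale_op (of_nat k) = (of_nat k :: ('n \<times> 'n) taylor endo)" for k :: nat
      using weyl.scal_of_nat[of k] by (simp add: weyl.scal_def of_nat_poly)
    then have sc: "scale_op ([:c:] + t_poly * of_nat k) = (weyl.scal c + scale_op t_poly * of_nat k :: ('n \<times> 'n) taylor endo)"
      for c and k :: nat
      by (simp only: weyl.r_add weyl.r_mult weyl.scal_def)
    show ?thesis
      unfolding trace_def rep.ev_diff rep.ev_sum gm rep.ev_const sc frame.E_trace assms(1,2) \<mu> by (rule diff_self)
  qed
  ultimately show ?thesis using assms(3) by (auto simp: orbit_relations_def)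
qed

end

section \<open>Cosets and the ring structure of the free algebra\<close>

lemma (in ideal) rcos_eq_iff:
  assumes "x \<in> carrier R" "y \<in> carrier R"
  shows "I +> x = I +> y \<longleftrightarrow> x \<ominus> y \<in> I"
proof
  assume "I +> x = I +> y"
  then have "x \<in> I +> y" using a_rcos_self[OF assms(1)] by simp
  then show "x \<ominus> y \<in> I" using assms by (simp add: a_rcos_module minus_eq)
next
  assume "x \<ominus> y \<in> I"
  then have "x \<in> I +> y" using assms by (simp add: a_rcos_module minus_eq)
  then show "I +> x = I +> y" using a_repr_independence[OF _ assms(2) a_subgroup] by blast
qed

lemma (in ideal) carrier_quotient: "carrier (R Quot I) = (\<lambda>x. I +> x) ` carrier R"
  by (auto simp: FactRing_def A_RCOSETS_defs a_r_coset_def)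

lemma free_algebra_simps [simp]:
  "carrier free_algebra = UNIV" "x \<otimes>\<^bsub>free_algebra\<^esub> y = x * y" "\<one>\<^bsub>free_algebra\<^esub> = 1"
  "\<zero>\<^bsub>free_algebra\<^esub> = 0" "x \<oplus>\<^bsub>free_algebra\<^esub> y = x + y"
  by (simp_all add: free_algebra_def)

lemma free_algebra_a_inv: "\<ominus>\<^bsub>free_algebra\<^esub> x = - x"
proof -
  interpret ring "free_algebra :: ('x list \<Rightarrow>\<^sub>0 'r::comm_ring_1) ring" by (rule ring_free_algebra)
  show ?thesis by (rule minus_equality) simp_all
qed

lemma free_algebra_a_minus: "x \<ominus>\<^bsub>free_algebra\<^esub> y = x - y"
  by (simp add: a_minus_def free_algebra_a_inv)

lemma ideal_free_algebra_iff:
  fixes K :: "('x list \<Rightarrow>\<^sub>0 'r::comm_ring_1) set"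
  shows "ideal K free_algebra \<longleftrightarrow> two_sided_ideal K"
proof
  assume "ideal K free_algebra"
  then interpret ideal K free_algebra .
  show "two_sided_ideal K"
    using additive_subgroup.zero_closed[OF is_additive_subgroup]
      additive_subgroup.a_closed[OF is_additive_subgroup] I_l_closed I_r_closed
    by (intro two_sided_idealI) simp_all
next
  assume K: "two_sided_ideal K"
  have inv: "inv\<^bsub>add_monoid free_algebra\<^esub> x = - x" for x :: "'x list \<Rightarrow>\<^sub>0 'r"
    using free_algebra_a_inv[of x] by (simp add: a_inv_def)
  show "ideal K free_algebra"
    using K two_sided_ideal_uminus[OF K] inv
    by (intro idealI ring_free_algebra subgroup.intro)
      (auto simp: two_sided_ideal_zero two_sided_ideal_add two_sided_ideal_lmult two_sided_ideal_rmult)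
qed

section \<open>Congruence modulo the defining relations\<close>

definition gl_ideal :: "'r \<Rightarrow> (('n \<times> 'n) list \<Rightarrow>\<^sub>0 'r::comm_ring_1) set"
  where "gl_ideal s = Idl\<^bsub>free_algebra\<^esub> (gl_relations s)"

lemma gl_relations_in_gl_ideal: "gl_relations s \<subseteq> gl_ideal s"
  unfolding gl_ideal_def by (rule ring.genideal_self[OF ring_free_algebra]) simp

lemma gl_ideal_minimal: "two_sided_ideal K \<Longrightarrow> gl_relations s \<subseteq> K \<Longrightarrow> gl_ideal s \<subseteq> K"
  unfolding gl_ideal_def by (rule ring.genideal_minimal[OF ring_free_algebra]) (simp_all add: ideal_free_algebra_iff)

lemma env_class_eq_iff: "env_class s x = env_class s y \<longleftrightarrow> x - y \<in> gl_ideal s"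
  using ideal.rcos_eq_iff[OF ideal_gl_relations[of s], of x y]
  by (simp add: env_class_def gl_ideal_def free_algebra_a_minus)

lemma carrier_env_algebra: "carrier (env_algebra s) = range (env_class s)"
  unfolding env_algebra_def ideal.carrier_quotient[OF ideal_gl_relations]
  by (simp add: env_class_def[abs_def])

lemma env_class_mult: "env_class s x \<otimes>\<^bsub>env_algebra s\<^esub> env_class s y = env_class s (x * y)"
  and env_class_add: "env_class s x \<oplus>\<^bsub>env_algebra s\<^esub> env_class s y = env_class s (x + y)"
  and env_class_one: "\<one>\<^bsub>env_algebra s\<^esub> = env_class s 1"
  using ring_hom_mult[OF env_class_ring_hom, of x y s] ring_hom_add[OF env_class_ring_hom, of x y s]
    ring_hom_one[OF env_class_ring_hom, of s]
  by simp_all (simp add: eq_commute)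

lemma env_class_zero:
  "\<zero>\<^bsub>env_algebra s\<^esub> = env_class s (0 :: ('n \<times> 'n) list \<Rightarrow>\<^sub>0 'r::comm_ring_1)"
proof -
  interpret ring "env_algebra s :: (('n \<times> 'n) list \<Rightarrow>\<^sub>0 'r) set ring" by (rule ring_env_algebra)
  have "env_class s (0 :: ('n \<times> 'n) list \<Rightarrow>\<^sub>0 'r) \<in> carrier (env_algebra s)" by (simp add: carrier_env_algebra)
  moreover have "env_class s (0 :: ('n \<times> 'n) list \<Rightarrow>\<^sub>0 'r) \<oplus>\<^bsub>env_algebra s\<^esub> env_class s 0 = env_class s 0"
    by (simp add: env_class_add)
  ultimately show ?thesis by (metis add.r_cancel_one')
qed

lemma env_class_minus:
  fixes x y :: "('n \<times> 'n) list \<Rightarrow>\<^sub>0 'r::comm_ring_1"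
  shows "env_class s x \<ominus>\<^bsub>env_algebra s\<^esub> env_class s y = env_class s (x - y)"
proof -
  interpret ring "env_algebra s :: (('n \<times> 'n) list \<Rightarrow>\<^sub>0 'r) set ring" by (rule ring_env_algebra)
  have "\<ominus>\<^bsub>env_algebra s\<^esub> env_class s y = env_class s (- y)"
    by (rule minus_equality) (simp_all add: env_class_add env_class_zero carrier_env_algebra)
  then show ?thesis by (simp add: a_minus_def env_class_add)
qed

text \<open>The preimage of \<open>orbit_ideal\<close> in the free algebra. It reduces the twofold
  quotient to a single congruence between noncommutative polynomials.\<close>

definition relation_ideal :: "complex \<Rightarrow> complex \<Rightarrow> nat \<Rightarrow> nat \<Rightarrow> ('n::finite) word_poly set"
  where "relation_ideal \<mu>1 \<mu>2 n1 n2 = {x. env_class t_poly x \<in> orbit_ideal \<mu>1 \<mu>2 n1 n2}"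

lemma two_sided_relation_ideal:
  "two_sided_ideal (relation_ideal \<mu>1 \<mu>2 n1 n2 :: ('n::finite) word_poly set)"
proof -
  interpret ideal "orbit_ideal \<mu>1 \<mu>2 n1 n2 :: 'n word_poly set set" "env_algebra t_poly" by (rule ideal_orbit_ideal)
  show ?thesis
    unfolding relation_ideal_def
    using additive_subgroup.zero_closed[OF is_additive_subgroup]
      additive_subgroup.a_closed[OF is_additive_subgroup] I_l_closed I_r_closed
    by (intro two_sided_idealI)
      (simp_all add: carrier_env_algebra env_class_zero flip: env_class_mult env_class_add)
qed

lemma gl_relations_in_relation_ideal:
  "gl_relations t_poly \<subseteq> (relation_ideal \<mu>1 \<mu>2 n1 n2 :: ('n::finite) word_poly set)"
proof
  fix x :: "'n word_poly" assume "x \<in> gl_relations t_poly"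
  then have "env_class t_poly x = env_class t_poly 0"
    using gl_relations_in_gl_ideal by (auto simp: env_class_eq_iff)
  then show "x \<in> relation_ideal \<mu>1 \<mu>2 n1 n2"
    using two_sided_ideal_zero[OF two_sided_relation_ideal[of \<mu>1 \<mu>2 n1 n2]]
    by (auto simp: relation_ideal_def)
qed

lemma orbit_relations_in_relation_ideal: "orbit_relations \<mu>1 \<mu>2 n1 n2 \<subseteq> relation_ideal \<mu>1 \<mu>2 n1 n2"
  using ring.genideal_self[OF ring_env_algebra, of "env_class t_poly ` orbit_relations \<mu>1 \<mu>2 n1 n2" t_poly]
  by (auto simp: relation_ideal_def orbit_ideal_def carrier_env_algebra)

text \<open>Together with the two preceding inclusions this says that all the relations jointly
  generate the preimage. The image of \<open>K\<close> in the enveloping algebra is an ideal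
  containing the orbit relations, and since \<open>K\<close> contains the kernel of the projection,
  nothing outside \<open>K\<close> maps into that image.\<close>

lemma relation_ideal_minimal:
  fixes K :: "('n::finite) word_poly set"
  assumes K: "two_sided_ideal K" and gl: "gl_relations t_poly \<subseteq> K" and orb: "orbit_relations \<mu>1 \<mu>2 n1 n2 \<subseteq> K"
  shows "relation_ideal \<mu>1 \<mu>2 n1 n2 \<subseteq> K"
proof
  have gl': "gl_ideal t_poly \<subseteq> K" by (rule gl_ideal_minimal[OF K gl])
  have "ideal (env_class t_poly ` K) (env_algebra t_poly)"
    using ring.ring_ideal_imp_quot_ideal[OF ring_free_algebra ideal_gl_relations[of t_poly], of K] K
    by (simp add: ideal_free_algebra_iff env_algebra_def env_class_def[abs_def])
  then have "orbit_ideal \<mu>1 \<mu>2 n1 n2 \<subseteq> env_class t_poly ` K"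
    unfolding orbit_ideal_def using orb by (intro ring.genideal_minimal[OF ring_env_algebra]) auto
  moreover fix x :: "'n word_poly" assume "x \<in> relation_ideal \<mu>1 \<mu>2 n1 n2"
  ultimately obtain k where k: "k \<in> K" "env_class t_poly x = env_class t_poly k"
    by (auto simp: relation_ideal_def)
  then have "x - k \<in> K" using gl' by (auto simp: env_class_eq_iff)
  then show "x \<in> K" using two_sided_ideal_add[OF K _ k(1)] by fastforce
qed

lemma quotient_class_eq_iff:
  "quotient_class \<mu>1 \<mu>2 n1 n2 x = quotient_class \<mu>1 \<mu>2 n1 n2 y \<longleftrightarrow> x - y \<in> relation_ideal \<mu>1 \<mu>2 n1 n2"
  using ideal.rcos_eq_iff[OF ideal_orbit_ideal, of "env_class t_poly x" "env_class t_poly y" \<mu>1 \<mu>2 n1 n2]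
  by (simp add: quotient_class_def relation_ideal_def env_class_minus carrier_env_algebra)

lemma carrier_quotient_algebra:
  "carrier (quotient_algebra \<mu>1 \<mu>2 n1 n2) = range (quotient_class \<mu>1 \<mu>2 n1 n2)"
  unfolding quotient_algebra_def ideal.carrier_quotient[OF ideal_orbit_ideal]
  by (auto simp: quotient_class_def carrier_env_algebra)

lemma
  fixes x y :: "('n::finite) word_poly"
  shows quotient_class_mult: "quotient_class \<mu>1 \<mu>2 n1 n2 x \<otimes>\<^bsub>quotient_algebra \<mu>1 \<mu>2 n1 n2\<^esub>
      quotient_class \<mu>1 \<mu>2 n1 n2 y = quotient_class \<mu>1 \<mu>2 n1 n2 (x * y)"
    and quotient_class_add: "quotient_class \<mu>1 \<mu>2 n1 n2 x \<oplus>\<^bsub>quotient_algebra \<mu>1 \<mu>2 n1 n2\<^esub>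
      quotient_class \<mu>1 \<mu>2 n1 n2 y = quotient_class \<mu>1 \<mu>2 n1 n2 (x + y)"
    and quotient_class_one: "\<one>\<^bsub>quotient_algebra \<mu>1 \<mu>2 n1 n2\<^esub> = quotient_class \<mu>1 \<mu>2 n1 n2 (1 :: 'n word_poly)"
proof -
  have h: "(+>\<^bsub>env_algebra t_poly\<^esub>) (orbit_ideal \<mu>1 \<mu>2 n1 n2 :: 'n word_poly set set)
      \<in> ring_hom (env_algebra t_poly) (quotient_algebra \<mu>1 \<mu>2 n1 n2)"
    unfolding quotient_algebra_def by (rule ideal.rcos_ring_hom[OF ideal_orbit_ideal])
  have c: "env_class t_poly z \<in> carrier (env_algebra t_poly)" for z :: "'n word_poly"
    by (simp add: carrier_env_algebra)
  show "quotient_class \<mu>1 \<mu>2 n1 n2 x \<otimes>\<^bsub>quotient_algebra \<mu>1 \<mu>2 n1 n2\<^esub>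
      quotient_class \<mu>1 \<mu>2 n1 n2 y = quotient_class \<mu>1 \<mu>2 n1 n2 (x * y)"
    using ring_hom_mult[OF h c[of x] c[of y]] by (simp add: quotient_class_def env_class_mult)
  show "quotient_class \<mu>1 \<mu>2 n1 n2 x \<oplus>\<^bsub>quotient_algebra \<mu>1 \<mu>2 n1 n2\<^esub>
      quotient_class \<mu>1 \<mu>2 n1 n2 y = quotient_class \<mu>1 \<mu>2 n1 n2 (x + y)"
    using ring_hom_add[OF h c[of x] c[of y]] by (simp add: quotient_class_def env_class_add)
  show "\<one>\<^bsub>quotient_algebra \<mu>1 \<mu>2 n1 n2\<^esub> = quotient_class \<mu>1 \<mu>2 n1 n2 (1 :: 'n word_poly)"
    using ring_hom_one[OF h] by (simp add: quotient_class_def env_class_one)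
qed

lemma quotient_class_zero:
  "\<zero>\<^bsub>quotient_algebra \<mu>1 \<mu>2 n1 n2\<^esub> = quotient_class \<mu>1 \<mu>2 n1 n2 (0 :: ('n::finite) word_poly)"
proof -
  interpret ring "quotient_algebra \<mu>1 \<mu>2 n1 n2 :: 'n word_poly set set ring" by (rule ring_quotient_algebra)
  have "quotient_class \<mu>1 \<mu>2 n1 n2 (0 :: 'n word_poly) \<in> carrier (quotient_algebra \<mu>1 \<mu>2 n1 n2)"
    by (simp add: carrier_quotient_algebra)
  moreover have "quotient_class \<mu>1 \<mu>2 n1 n2 (0 :: 'n word_poly) \<oplus>\<^bsub>quotient_algebra \<mu>1 \<mu>2 n1 n2\<^esub> quotient_class \<mu>1 \<mu>2 n1 n2 0
      = quotient_class \<mu>1 \<mu>2 n1 n2 0"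
    by (simp add: quotient_class_add)
  ultimately show ?thesis by (metis add.r_cancel_one')
qed

lemma quotient_class_minus:
  fixes x y :: "('n::finite) word_poly"
  shows "quotient_class \<mu>1 \<mu>2 n1 n2 x \<ominus>\<^bsub>quotient_algebra \<mu>1 \<mu>2 n1 n2\<^esub> quotient_class \<mu>1 \<mu>2 n1 n2 y
    = quotient_class \<mu>1 \<mu>2 n1 n2 (x - y)"
proof -
  interpret ring "quotient_algebra \<mu>1 \<mu>2 n1 n2 :: 'n word_poly set set ring" by (rule ring_quotient_algebra)
  have "\<ominus>\<^bsub>quotient_algebra \<mu>1 \<mu>2 n1 n2\<^esub> quotient_class \<mu>1 \<mu>2 n1 n2 y = quotient_class \<mu>1 \<mu>2 n1 n2 (- y)"
    by (rule minus_equality) (simp_all add: quotient_class_add quotient_class_zero carrier_quotient_algebra)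
  then show ?thesis by (simp add: a_minus_def quotient_class_add)
qed

section \<open>Commutators and the Poisson bracket\<close>

lemma value_at_poly_functions: "(\<lambda>A. value_at A x) \<in> poly_functions"
  by (induction x rule: free_algebra_induct)
    (simp_all add: value_at_const value_at_gen value_at_add value_at_mult poly_functions.intros)

lemma poly_functions_value_at: "f \<in> poly_functions \<Longrightarrow> \<exists>x. f = (\<lambda>A. value_at A x)"
proof (induction rule: poly_functions.induct)
  case (1 c)
  show ?case by (rule exI[of _ "const [:c:]"]) (simp add: value_at_const)
next
  case (2 i j)
  show ?case by (rule exI[of _ "gen j i"]) (simp add: value_at_gen)
next
  case (3 f g)
  then obtain x y where "f = (\<lambda>A. value_at A x)" "g = (\<lambda>A. value_at A y)" by blast
  then show ?case by (intro exI[of _ "x + y"]) (simp add: value_at_add)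
next
  case (4 f g)
  then obtain x y where "f = (\<lambda>A. value_at A x)" "g = (\<lambda>A. value_at A y)" by blast
  then show ?case by (intro exI[of _ "x * y"]) (simp add: value_at_mult)
qed

lemma matrix_unit_mult:
  "matrix_unit i j ** matrix_unit m k = (if j = m then matrix_unit i k else (0 :: complex ^ 'n ^ ('n::finite)))"
proof -
  have "(\<Sum>l\<in>UNIV. (if r = i \<and> l = j then 1 else 0) * (if l = m \<and> c = k then 1 else 0))
      = (\<Sum>l\<in>UNIV. if l = j then if j = m \<and> r = i \<and> c = k then 1 else (0::complex) else 0)" for r c
    by (intro sum.cong refl) auto
  then show ?thesis
    by (auto simp: matrix_unit_def matrix_matrix_mult_def vec_eq_iff)
qed

lemma trace_function_matrix_unit: "trace_function (matrix_unit i j) A = A $ j $ i"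
proof -
  have "(\<Sum>l\<in>UNIV. (if r = i \<and> l = j then 1 else 0) * A $ l $ r)
      = (\<Sum>l\<in>UNIV. if l = j then if r = i then A $ j $ i else 0 else 0)" for r
    by (intro sum.cong refl) auto
  then show ?thesis
    by (simp add: trace_function_def trace_def matrix_unit_def matrix_matrix_mult_def)
qed

lemma trace_function_diff: "trace_function (X - Y) A = trace_function X A - trace_function Y A"
  by (simp add: trace_function_def trace_def matrix_matrix_mult_def left_diff_distrib sum_subtractf)

lemma trace_function_zero: "trace_function 0 A = 0"
  by (simp add: trace_function_def trace_def matrix_matrix_mult_def)

lemma value_at_gl_bracket:
  "value_at A (gl_bracket i j m k) = lie_poisson (\<lambda>A. value_at A (gen i j)) (\<lambda>A. value_at A (gen m k)) A"
proof -
  have "(\<lambda>A. value_at A (gen a b)) = trace_function (matrix_unit a b)" for a b :: 'a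
    by (simp add: value_at_gen trace_function_matrix_unit fun_eq_iff)
  then show ?thesis
    by (simp add: lie_poisson_linear gl_bracket_def value_at_diff value_at_zero matrix_unit_mult
        trace_function_diff trace_function_zero trace_function_matrix_unit value_at_gen)
qed

text \<open>\<open>z\<close> is a quotient of the commutator by \<open>t\<close>, modulo
  \<open>J\<close>, whose classical limit is the Poisson-Lie bracket on all matrices and not just on
  the orbit. In this form both clauses are preserved by sums and by the Leibniz rule, which carries
  them from the generators to everything.\<close>

definition bracket_lift :: "'n word_poly set \<Rightarrow> ('n::finite) word_poly \<Rightarrow> 'n word_poly \<Rightarrow> 'n word_poly \<Rightarrow> bool"
  where "bracket_lift J x y z \<longleftrightarrow> x * y - y * x - const t_poly * z \<in> J \<and>
    (\<forall>A. value_at A z = lie_poisson (\<lambda>A. value_at A x) (\<lambda>A. value_at A y) A)"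

context
  fixes J :: "('n::finite) word_poly set"
  assumes J: "two_sided_ideal J" and gl: "gl_relations t_poly \<subseteq> J"
begin

lemma bracket_lift_swap: "bracket_lift J x y z \<Longrightarrow> bracket_lift J y x (- z)"
proof -
  assume *: "bracket_lift J x y z"
  have "y * x - x * y - const t_poly * (- z) = - (x * y - y * x - const t_poly * z)"
    by (simp add: algebra_simps)
  then have "y * x - x * y - const t_poly * (- z) \<in> J"
    using * two_sided_ideal_uminus[OF J] by (simp only: bracket_lift_def)
  moreover have "value_at A (- z) = - value_at A z" for A
    using value_at_diff[of A 0 z] by (simp add: value_at_zero)
  ultimately show ?thesis
    using * lie_poisson_antisym[of "\<lambda>A. value_at A y" "\<lambda>A. value_at A x"] by (simp add: bracket_lift_def)
qed

lemma bracket_lift_const: "bracket_lift J (const c) y 0"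
  using lie_poisson_const[of "coeff c 0" "\<lambda>A. value_at A y"]
  by (simp add: bracket_lift_def const_commute value_at_const value_at_zero two_sided_ideal_zero[OF J])

lemma bracket_lift_gen: "bracket_lift J (gen i j) (gen m k) (gl_bracket i j m k)"
proof -
  have "gen i j * gen m k - gen m k * gen i j - const t_poly * gl_bracket i j m k \<in> gl_relations t_poly"
    unfolding gl_relations_def by blast
  then show ?thesis using gl by (auto simp: bracket_lift_def value_at_gl_bracket)
qed

lemma bracket_lift_add:
  assumes "bracket_lift J x1 y z1" "bracket_lift J x2 y z2"
  shows "bracket_lift J (x1 + x2) y (z1 + z2)"
proof -
  have "(x1 + x2) * y - y * (x1 + x2) - const t_poly * (z1 + z2)
      = (x1 * y - y * x1 - const t_poly * z1) + (x2 * y - y * x2 - const t_poly * z2)"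
    by (simp add: algebra_simps)
  then show ?thesis
    using assms two_sided_ideal_add[OF J]
    by (simp add: bracket_lift_def value_at_add lie_poisson_add value_at_poly_functions)
qed

lemma bracket_lift_mult:
  assumes "bracket_lift J x1 y z1" "bracket_lift J x2 y z2"
  shows "bracket_lift J (x1 * x2) y (x1 * z2 + z1 * x2)"
proof -
  have "(x1 * x2) * y - y * (x1 * x2) - const t_poly * (x1 * z2 + z1 * x2)
      = (x1 * y - y * x1 - const t_poly * z1) * x2 + x1 * (x2 * y - y * x2 - const t_poly * z2)"
    by (simp add: algebra_simps const_left_commute)
  then show ?thesis
    using assms two_sided_ideal_add[OF J] two_sided_ideal_rmult[OF J] two_sided_ideal_lmult[OF J]
    by (simp add: bracket_lift_def value_at_add value_at_mult lie_poisson_Leibniz value_at_poly_functions)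
qed

text \<open>The closure rules act on the left argument only. So a generator is fixed on the right
  while \<open>y\<close> is built up, antisymmetry moves the generator to the left, and then
  \<open>x\<close> is built up with \<open>y\<close> arbitrary.\<close>

lemma bracket_lift_exists: "\<exists>z. bracket_lift J x y z"
proof (induction x rule: free_algebra_induct)
  case (gen i j)
  have "\<exists>z. bracket_lift J y (gen i j) z"
    by (induction y rule: free_algebra_induct)
      (blast intro: bracket_lift_const bracket_lift_gen bracket_lift_add bracket_lift_mult)+
  then show ?case by (blast intro: bracket_lift_swap)
qed (blast intro: bracket_lift_const bracket_lift_add bracket_lift_mult)+

lemma commutator_t_multiple: "\<exists>z. x * y - y * x - const t_poly * z \<in> J"
  using bracket_lift_exists[of x y] by (auto simp: bracket_lift_def)

section \<open>Reduction modulo \<open>t\<close> and the relations\<close>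

definition t_multiples :: "'n word_poly set"
  where "t_multiples = {x. \<exists>y. x - const t_poly * y \<in> J}"

lemma t_multiples_iff: "x \<in> t_multiples \<longleftrightarrow> (\<exists>y. x - const t_poly * y \<in> J)"
  by (simp add: t_multiples_def)

lemma two_sided_t_multiples: "two_sided_ideal t_multiples"
proof (rule two_sided_idealI)
  show "0 \<in> t_multiples"
    unfolding t_multiples_iff by (rule exI[of _ 0]) (simp add: two_sided_ideal_zero[OF J])
next
  fix x x' assume "x \<in> t_multiples" "x' \<in> t_multiples"
  then obtain y y' where "x - const t_poly * y \<in> J" "x' - const t_poly * y' \<in> J"
    by (auto simp: t_multiples_iff)
  then have "(x + x') - (const t_poly * y + const t_poly * y') \<in> J"
    by (rule two_sided_ideal_add_cong[OF J])
  then show "x + x' \<in> t_multiples"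
    unfolding t_multiples_iff by (intro exI[of _ "y + y'"]) (simp only: distrib_left)
next
  fix x z assume "x \<in> t_multiples"
  then obtain y where y: "x - const t_poly * y \<in> J"
    by (auto simp: t_multiples_iff)
  have "z * x - const t_poly * (z * y) = z * (x - const t_poly * y)"
    "x * z - const t_poly * (y * z) = (x - const t_poly * y) * z"
    by (simp_all add: right_diff_distrib left_diff_distrib const_left_commute mult.assoc)
  then show "z * x \<in> t_multiples" "x * z \<in> t_multiples"
    using two_sided_ideal_lmult[OF J y, of z] two_sided_ideal_rmult[OF J y, of z]
    unfolding t_multiples_iff by metis+
qed

lemma J_subset_t_multiples: "J \<subseteq> t_multiples"
proof
  fix x assume "x \<in> J"
  then show "x \<in> t_multiples" unfolding t_multiples_iff by (intro exI[of _ 0]) simp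
qed

lemma const_t_multiple: "const c - const [:coeff c 0:] \<in> t_multiples"
proof -
  \<comment> \<open>\<open>poly_shift 1 c\<close> is the quotient of \<open>c\<close> minus its
    constant term by \<open>t\<close>.\<close>
  have "const c - const [:coeff c 0:] - const t_poly * const (poly_shift 1 c) = 0"
  proof -
    have "c = [:coeff c 0:] + t_poly * poly_shift 1 c"
      by (rule poly_eqI) (simp add: coeff_pCons coeff_poly_shift split: nat.splits)
    then have "const c = const [:coeff c 0:] + const t_poly * const (poly_shift 1 c)"
      by (metis const_add const_mult)
    then show ?thesis by (simp only: diff_diff_eq right_minus_eq)
  qed
  then show ?thesis
    unfolding t_multiples_iff using two_sided_ideal_zero[OF J] by metis
qed

text \<open>Commutators are multiples of \<open>t\<close>, so the first letter can be moved to the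
  place where it occurs in the other word.\<close>

lemma monomial_perm:
  "mset w = mset w' \<Longrightarrow> monomial w - monomial w' \<in> t_multiples"
proof (induction w arbitrary: w')
  case Nil
  then show ?case by (simp add: two_sided_ideal_zero[OF two_sided_t_multiples])
next
  case (Cons a u)
  then have "a \<in> set w'" by (metis list.set_intros(1) set_mset_mset)
  then obtain p q where w': "w' = p @ a # q" by (auto simp: in_set_conv_decomp)
  then have "mset u = mset (p @ q)" using Cons(2) by simp
  from Cons(1)[OF this] have "monomial u - monomial p * monomial q \<in> t_multiples"
    by (simp add: monomial_append)
  then have 1: "gen (fst a) (snd a) * monomial u - gen (fst a) (snd a) * (monomial p * monomial q) \<in> t_multiples"
    using two_sided_ideal_lmult[OF two_sided_t_multiples] by (metis right_diff_distrib)
  have "gen (fst a) (snd a) * monomial p - monomial p * gen (fst a) (snd a) \<in> t_multiples"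
    using commutator_t_multiple unfolding t_multiples_iff by blast
  from two_sided_ideal_rmult[OF two_sided_t_multiples this, of "monomial q"]
  have 2: "gen (fst a) (snd a) * (monomial p * monomial q) - monomial p * (gen (fst a) (snd a) * monomial q) \<in> t_multiples"
    by (simp add: left_diff_distrib mult.assoc)
  show ?case
    using two_sided_ideal_trans[OF two_sided_t_multiples 1 2]
    by (simp add: w' monomial_append monomial_Cons)
qed

text \<open>Choosing one word for each multiset gives an additive lift of commutative polynomials.
  By \<open>monomial_perm\<close> every \<open>y\<close> is congruent to the lift of
  \<open>abel y\<close>, and the lift of zero is zero.\<close>

lemma abel_kernel:
  assumes "abel x = 0"
  shows "x \<in> t_multiples"
proof -
  define word :: "('n \<times> 'n) multiset \<Rightarrow> ('n \<times> 'n) list" where "word M = (SOME w. mset w = M)" for M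
  have word: "mset (word M) = M" for M
    unfolding word_def by (rule someI_ex) (rule ex_mset)
  interpret lift: monoid_algebra_linear "\<lambda>c. const [:c:]" "\<lambda>M. monomial (word M)"
    by unfold_locales (simp flip: const_add)
  have "y - lift.ev (abel y) \<in> t_multiples" for y
  proof (induction y rule: poly_mapping_single_induct)
    case (single w c)
    have mono: "abel (monomial w) = Poly_Mapping.single (mset w) 1" for w
    proof (induction w)
      case Nil
      have "abel 1 = Poly_Mapping.single {#} 1" using abel.ev_one comm_const_one by (metis comm_const_def)
      then show ?case by simp
    qed (simp add: monomial_Cons abel.ev_mult abel.ev_gen comm_var_def mult_single)
    have "abel (Poly_Mapping.single w c) = Poly_Mapping.single (mset w) (coeff c 0)"
      by (simp add: single_eq_const_monomial abel.ev_mult abel.ev_const mono comm_const_def mult_single)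
    then have "lift.ev (abel (Poly_Mapping.single w c)) = const [:coeff c 0:] * monomial (word (mset w))"
      by (simp add: lift.ev_single)
    moreover have "const c * monomial w - const [:coeff c 0:] * monomial (word (mset w)) \<in> t_multiples"
      by (rule two_sided_ideal_mult_cong[OF two_sided_t_multiples const_t_multiple monomial_perm])
        (simp add: word)
    ultimately show ?case by (simp add: single_eq_const_monomial)
  next
    case (add y y')
    have *: "y + y' - lift.ev (abel (y + y')) = (y - lift.ev (abel y)) + (y' - lift.ev (abel y'))"
      by (simp add: abel.ev_add lift.ev_add)
    show ?case unfolding * by (rule two_sided_ideal_add[OF two_sided_t_multiples add])
  qed
  from this[of x] show ?thesis by (simp add: assms lift.ev_zero)
qed

lemma abel_surj: "\<exists>x. abel x = (p :: ('n \<times> 'n) comm_poly)"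
proof (induction p rule: comm_poly_induct)
  case (const c)
  show ?case by (rule exI[of _ "const [:c:]"]) (simp add: abel.ev_const)
next
  case (var v)
  show ?case by (rule exI[of _ "gen (fst v) (snd v)"]) (simp add: abel.ev_gen)
next
  case (add p q)
  then obtain x y where "abel x = p" "abel y = q" by blast
  then show ?case by (intro exI[of _ "x + y"]) (simp add: abel.ev_add)
next
  case (mult p q)
  then obtain x y where "abel x = p" "abel y = q" by blast
  then show ?case by (intro exI[of _ "x * y"]) (simp add: abel.ev_mult)
qed

text \<open>The image of \<open>t_multiples\<close> under \<open>abel\<close> is an ideal containing
  the classical relations, since the correction of the trace drops out at \<open>t = 0\<close>.
  Hence it contains every polynomial vanishing on the orbit, by
  \<open>orbit_functions_ideal\<close>; \<open>abel_kernel\<close> transports this back.\<close>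

lemma vanishing_imp_t_multiple:
  assumes ne: "\<mu>1 \<noteq> \<mu>2" and n: "n1 + n2 = CARD('n)"
    and orb: "orbit_relations \<mu>1 \<mu>2 n1 n2 \<subseteq> J"
    and x: "\<And>A. A \<in> orbit \<mu>1 \<mu>2 n1 n2 \<Longrightarrow> value_at A x = 0"
  shows "x \<in> t_multiples"
proof -
  let ?I = "abel ` t_multiples"
  have I: "two_sided_ideal ?I"
  proof (rule two_sided_idealI)
    show "0 \<in> ?I"
      using two_sided_ideal_zero[OF two_sided_t_multiples] abel.ev_zero by (metis image_eqI)
  next
    fix p q assume "p \<in> ?I" "q \<in> ?I"
    then show "p + q \<in> ?I"
      using two_sided_ideal_add[OF two_sided_t_multiples] abel.ev_add by (smt (verit) image_iff)
  next
    fix p q :: "('n \<times> 'n) comm_poly" assume p: "p \<in> ?I"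
    obtain y where y: "q = abel y" using abel_surj by metis
    show "q * p \<in> ?I" "p * q \<in> ?I"
      using p two_sided_ideal_lmult[OF two_sided_t_multiples, of _ y]
        two_sided_ideal_rmult[OF two_sided_t_multiples, of _ y]
      by (auto simp: y simp flip: abel.ev_mult)
  qed
  have mem: "abel y \<in> ?I" if "y \<in> orbit_relations \<mu>1 \<mu>2 n1 n2" for y
    using that orb J_subset_t_multiples by auto
  have gm: "abel (gen_matrix $ i $ j) = generic_matrix $ i $ j"
    and m: "abel (mat (const [:c:]) $ i $ j) = mat (comm_const c) $ i $ j" for i j :: 'n and c
    by (simp_all add: gen_matrix_def generic_matrix_def abel.ev_gen mat_def abel.ev_const abel.ev_zero)
  have "abel x \<in> ?I"
  proof (rule orbit_functions_ideal[OF I ne n])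
    fix j k :: 'n
    have "((gen_matrix - mat (const [:\<mu>1:])) ** (gen_matrix - mat (const [:\<mu>2:]))) $ j $ k
        \<in> orbit_relations \<mu>1 \<mu>2 n1 n2"
      by (auto simp: orbit_relations_def)
    from mem[OF this]
    show "((generic_matrix - mat (comm_const \<mu>1)) ** (generic_matrix - mat (comm_const \<mu>2))) $ j $ k \<in> ?I"
      by (simp add: matrix_matrix_mult_def abel.ev_sum abel.ev_mult abel.ev_diff gm m)
  next
    have "trace (gen_matrix :: 'n word_poly ^ 'n ^ 'n) - const ([:of_nat n1 * \<mu>1 + of_nat n2 * \<mu>2:] + t_poly * of_nat (n1 * n2))
        \<in> orbit_relations \<mu>1 \<mu>2 n1 n2"
      by (simp add: orbit_relations_def)
    from mem[OF this]
    show "trace (generic_matrix :: ('n \<times> 'n) comm_poly ^ 'n ^ 'n) - comm_const (of_nat n1 * \<mu>1 + of_nat n2 * \<mu>2) \<in> ?I"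
      by (simp add: trace_def abel.ev_sum abel.ev_diff gm abel.ev_const)
  next
    fix A :: "complex ^ 'n ^ 'n" assume "A \<in> orbit \<mu>1 \<mu>2 n1 n2"
    then show "eval_at A (abel x) = 0" using x by (simp add: value_at_def)
  qed
  then obtain y where y: "y \<in> t_multiples" "abel x = abel y" by auto
  then have "x - y \<in> t_multiples" by (intro abel_kernel) (simp add: abel.ev_diff)
  then show ?thesis using two_sided_ideal_add[OF two_sided_t_multiples _ y(1)] by fastforce
qed

end

section \<open>Expansion in powers of t\<close>

text \<open>The parameter \<open>index\<close> only ties the locale to the type \<open>'n\<close>,
  which the types of the other parameters do not mention.\<close>

locale symmetric_orbit =
  fixes \<mu>1 \<mu>2 :: complex and n1 n2 :: nat and index :: "'n::finite itself"
  assumes distinct: "\<mu>1 \<noteq> \<mu>2" and dim: "n1 + n2 = CARD('n)"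
begin

abbreviation J :: "'n word_poly set" where "J \<equiv> relation_ideal \<mu>1 \<mu>2 n1 n2"
abbreviation Orb :: "(complex ^ 'n ^ 'n) set" where "Orb \<equiv> orbit \<mu>1 \<mu>2 n1 n2"
abbreviation Q :: "'n word_poly set set ring" where "Q \<equiv> quotient_algebra \<mu>1 \<mu>2 n1 n2"
abbreviation cls :: "'n word_poly \<Rightarrow> 'n word_poly set set" where "cls \<equiv> quotient_class \<mu>1 \<mu>2 n1 n2"
abbreviation scalar :: "complex poly \<Rightarrow> 'n word_poly set set" where "scalar \<equiv> quotient_scalar \<mu>1 \<mu>2 n1 n2"
abbreviation t :: "'n word_poly" where "t \<equiv> const t_poly"

lemma two_sided_J: "two_sided_ideal J"
  by (rule two_sided_relation_ideal)

lemma gl_J: "gl_relations t_poly \<subseteq> J"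
  by (rule gl_relations_in_relation_ideal)

lemma orb_J: "orbit_relations \<mu>1 \<mu>2 n1 n2 \<subseteq> J"
  by (rule orbit_relations_in_relation_ideal)

text \<open>
  \<open>K\<close> is the common kernel of the representations attached to all points of the orbit; it is the
  \<open>t\<close>-adic closure of \<open>J\<close>, and unlike \<open>J\<close> it is visibly saturated with respect to \<open>t\<close>.
\<close>

definition K :: "'n word_poly set"
  where "K = {x. \<forall>S g h. orbit_point g h \<longrightarrow> card S = n1 \<longrightarrow> card (- S) = n2 \<longrightarrow>
    orbit_point.rep S g h \<mu>1 \<mu>2 x = 0}"

lemma two_sided_K: "two_sided_ideal K"
proof -
  define A where "A = {(S :: 'n set, g :: complex ^ 'n ^ 'n, h). orbit_point g h \<and> card S = n1 \<and> card (- S) = n2}"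
  define F where "F = (\<lambda>(S, g, h). {x :: 'n word_poly. orbit_point.rep S g h \<mu>1 \<mu>2 x = 0})"
  have "K = \<Inter>(F ` A)"
    by (auto simp: K_def A_def F_def)
  moreover have "two_sided_ideal (F p)" if "p \<in> A" for p
    using that orbit_point.two_sided_ideal_rep by (auto simp: A_def F_def)
  then have "two_sided_ideal (\<Inter>(F ` A))"
    by (intro two_sided_idealI)
      (simp_all add: two_sided_ideal_zero two_sided_ideal_add two_sided_ideal_lmult two_sided_ideal_rmult)
  ultimately show ?thesis by simp
qed

lemma J_subset_K: "J \<subseteq> K"
proof (rule relation_ideal_minimal[OF two_sided_K])
  show "gl_relations t_poly \<subseteq> K"
    unfolding K_def using orbit_point.gl_relations_rep by blast
  show "orbit_relations \<mu>1 \<mu>2 n1 n2 \<subseteq> K"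
    unfolding K_def using orbit_point.orbit_relations_rep by blast
qed

lemma K_saturated: "t * x \<in> K \<Longrightarrow> x \<in> K"
  by (simp add: K_def orbit_point.rep_t_torsion_free)

lemma K_vanishes:
  assumes "x \<in> K" "A \<in> Orb"
  shows "value_at A x = 0"
proof -
  obtain g :: "complex ^ 'n ^ 'n" and S where A: "A = g ** diagonal (two_values \<mu>1 \<mu>2 S) ** matrix_inv g"
    and g: "invertible g" and S: "card S = n1" "card (- S) = n2"
    using assms(2) unfolding orbit_eq mem_Collect_eq
  proof (elim exE conjE)
    fix g :: "complex ^ 'n ^ 'n" and S assume "A = g ** diagonal (two_values \<mu>1 \<mu>2 S) ** matrix_inv g" "invertible g"
      "card S = n1" "card (- S) = n2"
    then show ?thesis by (rule that)
  qed
  have p: "orbit_point g (matrix_inv g)"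
    by (rule orbit_point.intro) (simp_all add: mult_matrix_inv[OF g] matrix_inv_mult[OF g])
  then have "orbit_point.rep S g (matrix_inv g) \<mu>1 \<mu>2 x = 0"
    using assms(1) S by (auto simp: K_def)
  then show ?thesis
    using orbit_point.value_at_eq_zero[OF p] by (simp add: A orbit_point.point_def[OF p])
qed

lemma vanishing_t_multiple:
  assumes "\<And>A. A \<in> Orb \<Longrightarrow> value_at A x = 0"
  shows "\<exists>y. x - t * y \<in> J"
  using vanishing_imp_t_multiple[OF two_sided_J gl_J distinct dim orb_J assms] by (simp add: t_multiples_iff[OF two_sided_J gl_J])

text \<open>Functions on the orbit extended by zero, where \<open>restrict\<close> would give
  \<open>undefined\<close>, so that \<open>fn\<close> is linear into the pointwise vector space of
  functions.\<close>

definition fn :: "'n word_poly \<Rightarrow> complex ^ 'n ^ 'n \<Rightarrow> complex"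
  where "fn x = (\<lambda>A. if A \<in> Orb then value_at A x else 0)"

lemma fn_add: "fn (x + y) = fn x + fn y"
  and fn_diff: "fn (x - y) = fn x - fn y"
  and fn_zero: "fn 0 = 0"
  by (auto simp: fn_def value_at_add value_at_diff value_at_zero fun_eq_iff)

lemma fn_t: "fn (t * x) = 0"
  by (auto simp: fn_def value_at_mult value_at_const fun_eq_iff)

lemma fn_scale: "fn (const [:c:] * x) = (\<lambda>A. c * fn x A)"
  by (auto simp: fn_def value_at_mult value_at_const fun_eq_iff)

lemma fn_K: "x \<in> K \<Longrightarrow> fn x = 0"
  using K_vanishes by (auto simp: fn_def fun_eq_iff)

lemma fn_cong_K: "x - y \<in> K \<Longrightarrow> fn x = fn y"
  using fn_K[of "x - y"] by (simp add: fn_diff)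

lemma fn_zero_t_multiple:
  assumes "fn x = 0"
  shows "\<exists>y. x - t * y \<in> J"
proof (rule vanishing_t_multiple)
  fix A assume "A \<in> Orb"
  then show "value_at A x = 0" using fun_cong[OF assms, of A] by (simp add: fn_def)
qed

text \<open>A linear map of complex vector spaces has a linear right inverse on its range. Linearity
  of the section is what makes the expansion coefficients linear.\<close>

lemma section_exists:
  "\<exists>s. (\<forall>f g. s (f + g) = s f + s g) \<and> (\<forall>c f. s (\<lambda>A. c * f A) = const [:c:] * s f)
    \<and> (\<forall>x. fn (s (fn x)) = fn x)"
proof -
  let ?sW = "\<lambda>c (x :: 'n word_poly). const [:c:] * x"
  let ?sF = "\<lambda>c (f :: complex ^ 'n ^ 'n \<Rightarrow> complex) A. c * f A"
  have c: "const [:a + b:] = const [:a:] + const [:b:]" "const [:a * b:] = const [:a:] * const [:b:]"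
    "const [:1:] = (1 :: 'n word_poly)" for a b :: complex
    using const_add[of "[:a:]" "[:b:]"] const_mult[of "[:a:]" "[:b:]"] const_one
    by (simp_all add: mult.commute flip: one_pCons)
  interpret pair: vector_space_pair ?sW ?sF
    by unfold_locales (simp_all add: c distrib_left distrib_right mult.assoc plus_fun_def)
  have "Vector_Spaces.linear ?sW ?sF fn"
    by unfold_locales (simp_all only: fn_add fn_scale)
  from pair.linear_exists_right_inverse_on[OF this pair.vs1.subspace_UNIV]
  obtain s where s: "Vector_Spaces.linear ?sF ?sW s" "\<And>f. f \<in> range fn \<Longrightarrow> fn (s f) = f"
    by blast
  interpret s: Vector_Spaces.linear ?sF ?sW s by fact
  show ?thesis
    using s.add s.scale s(2) by (intro exI[of _ s] conjI allI) simp_all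
qed

definition sec :: "(complex ^ 'n ^ 'n \<Rightarrow> complex) \<Rightarrow> 'n word_poly"
  where "sec = (SOME s. (\<forall>f g. s (f + g) = s f + s g) \<and> (\<forall>c f. s (\<lambda>A. c * f A) = const [:c:] * s f)
    \<and> (\<forall>x. fn (s (fn x)) = fn x))"

lemma sec_add: "sec (f + g) = sec f + sec g"
  and sec_scale: "sec (\<lambda>A. c * f A) = const [:c:] * sec f"
  and fn_sec: "fn (sec (fn x)) = fn x"
  using someI_ex[OF section_exists, folded sec_def] by simp_all

lemma sec_zero: "sec 0 = 0"
  using sec_add[of 0 0] by simp

text \<open>Division by \<open>t\<close>: after subtraction of the lift of its classical part,
  \<open>x\<close> vanishes on the orbit, hence is a multiple of \<open>t\<close> modulo
  \<open>J\<close>. The quotient is a choice.\<close>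

definition next_coeff :: "'n word_poly \<Rightarrow> 'n word_poly"
  where "next_coeff x = (SOME y. x - sec (fn x) - t * y \<in> J)"

lemma next_coeff: "x - sec (fn x) - t * next_coeff x \<in> J"
proof -
  have "\<exists>y. x - sec (fn x) - t * y \<in> J"
    by (rule fn_zero_t_multiple) (simp add: fn_diff fn_sec)
  then show ?thesis unfolding next_coeff_def by (rule someI_ex)
qed

lemma next_coeff_K: "x - sec (fn x) - t * next_coeff x \<in> K"
  using next_coeff J_subset_K by blast

text \<open>Two quotients differ by an element that lies in \<open>K\<close> after multiplication by
  \<open>t\<close>, hence lies in \<open>K\<close>. All algebraic rules for
  \<open>next_coeff\<close> follow by exhibiting a quotient.\<close>

lemma next_coeff_unique:
  assumes "x - sec (fn x) - t * y \<in> K"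
  shows "next_coeff x - y \<in> K"
proof (rule K_saturated)
  have *: "t * (next_coeff x - y) = (x - sec (fn x) - t * y) - (x - sec (fn x) - t * next_coeff x)"
    by (simp add: right_diff_distrib)
  show "t * (next_coeff x - y) \<in> K"
    unfolding * by (rule two_sided_ideal_diff[OF two_sided_K assms next_coeff_K])
qed

lemma next_coeff_cong:
  assumes "x - x' \<in> K"
  shows "next_coeff x - next_coeff x' \<in> K"
proof (rule next_coeff_unique)
  have *: "x - sec (fn x) - t * next_coeff x' = (x - x') + (x' - sec (fn x') - t * next_coeff x')"
    by (simp add: fn_cong_K[OF assms])
  show "x - sec (fn x) - t * next_coeff x' \<in> K"
    unfolding * by (rule two_sided_ideal_add[OF two_sided_K assms next_coeff_K])
qed

lemma next_coeff_add: "next_coeff (x + y) - (next_coeff x + next_coeff y) \<in> K"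
proof (rule next_coeff_unique)
  have *: "x + y - sec (fn (x + y)) - t * (next_coeff x + next_coeff y)
      = (x - sec (fn x) - t * next_coeff x) + (y - sec (fn y) - t * next_coeff y)"
    by (simp only: fn_add sec_add distrib_left add_diff_add)
  show "x + y - sec (fn (x + y)) - t * (next_coeff x + next_coeff y) \<in> K"
    unfolding * by (rule two_sided_ideal_add[OF two_sided_K next_coeff_K next_coeff_K])
qed

lemma next_coeff_scale: "next_coeff (const [:c:] * x) - const [:c:] * next_coeff x \<in> K"
proof (rule next_coeff_unique)
  have *: "const [:c:] * x - sec (fn (const [:c:] * x)) - t * (const [:c:] * next_coeff x)
      = const [:c:] * (x - sec (fn x) - t * next_coeff x)"
    by (simp only: fn_scale sec_scale right_diff_distrib const_left_commute[of "const [:c:]" t_poly])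
  show "const [:c:] * x - sec (fn (const [:c:] * x)) - t * (const [:c:] * next_coeff x) \<in> K"
    unfolding * by (rule two_sided_ideal_lmult[OF two_sided_K next_coeff_K])
qed

lemma next_coeff_t: "next_coeff (t * x) - x \<in> K"
  by (rule next_coeff_unique) (simp add: fn_t sec_zero two_sided_ideal_zero[OF two_sided_K])

text \<open>The coefficients in the formal expansion of \<open>x\<close> as a sum of
  \<open>t ^ i * sec (expansion x i)\<close>; beyond the one at \<open>i = 0\<close> they depend on
  the chosen section.\<close>

definition expansion :: "'n word_poly \<Rightarrow> nat \<Rightarrow> complex ^ 'n ^ 'n \<Rightarrow> complex"
  where "expansion x i = fn ((next_coeff ^^ i) x)"

lemma expansion_0: "expansion x 0 = fn x"
  by (simp add: expansion_def)

lemma expansion_Suc: "expansion x (Suc i) = expansion (next_coeff x) i"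
  by (simp add: expansion_def funpow_swap1)

lemma expansion_cong: "x - x' \<in> K \<Longrightarrow> expansion x i = expansion x' i"
proof (induction i arbitrary: x x')
  case 0
  then show ?case unfolding expansion_0 by (rule fn_cong_K)
next
  case (Suc i)
  show ?case unfolding expansion_Suc by (rule Suc.IH[OF next_coeff_cong[OF Suc.prems]])
qed

lemma expansion_add: "expansion (x + y) i = expansion x i + expansion y i"
proof (induction i arbitrary: x y)
  case (Suc i)
  have "expansion (x + y) (Suc i) = expansion (next_coeff x + next_coeff y) i"
    by (simp add: expansion_Suc expansion_cong[OF next_coeff_add])
  then show ?case by (simp add: Suc expansion_Suc)
qed (simp add: expansion_0 fn_add)

lemma expansion_scale: "expansion (const [:c:] * x) i = (\<lambda>A. c * expansion x i A)"
proof (induction i arbitrary: x)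
  case (Suc i)
  have "expansion (const [:c:] * x) (Suc i) = expansion (const [:c:] * next_coeff x) i"
    by (simp add: expansion_Suc expansion_cong[OF next_coeff_scale])
  then show ?case by (simp add: Suc expansion_Suc)
qed (simp add: expansion_0 fn_scale)

lemma expansion_t_0: "expansion (t * x) 0 = 0"
  by (simp add: expansion_0 fn_t)

lemma expansion_t_Suc: "expansion (t * x) (Suc i) = expansion x i"
  by (simp add: expansion_Suc expansion_cong[OF next_coeff_t])

text \<open>Each division by \<open>t\<close> was made modulo \<open>J\<close>, so the conclusion
  holds modulo \<open>J\<close> and not merely modulo \<open>K\<close>. This yields injectivity for
  the quotient algebra itself.\<close>

lemma expansion_zero_imp:
  "(\<And>i. i < k \<Longrightarrow> expansion x i = 0) \<Longrightarrow> \<exists>y. x - const (t_poly ^ k) * y \<in> J"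
proof (induction k arbitrary: x)
  case 0
  show ?case by (rule exI[of _ x]) (simp add: two_sided_ideal_zero[OF two_sided_J])
next
  case (Suc k)
  have "expansion (next_coeff x) i = 0" if "i < k" for i
    unfolding expansion_Suc[symmetric] using that by (intro Suc.prems) simp
  then obtain y where y: "next_coeff x - const (t_poly ^ k) * y \<in> J" using Suc.IH by blast
  have "fn x = 0" unfolding expansion_0[symmetric] by (rule Suc.prems) simp
  then have "x - t * next_coeff x \<in> J"
    using next_coeff[of x] by (simp only: sec_zero diff_zero)
  moreover have "t * next_coeff x - t * (const (t_poly ^ k) * y) \<in> J"
    using two_sided_ideal_lmult[OF two_sided_J y, of t] by (simp only: right_diff_distrib)
  ultimately have "x - t * (const (t_poly ^ k) * y) \<in> J"
    by (rule two_sided_ideal_trans[OF two_sided_J])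
  then have "x - const (t_poly ^ Suc k) * y \<in> J"
    by (simp only: power_Suc const_mult mult.assoc)
  then show ?case by blast
qed

text \<open>Horner's scheme: an element with the shifted coefficients is multiplied by
  \<open>t\<close>, and the lift of \<open>f 0\<close> is added.\<close>

lemma expansion_exists:
  "(\<And>i. f i \<in> range fn) \<Longrightarrow> \<exists>x. \<forall>i<k. expansion x i = f i"
proof (induction k arbitrary: f)
  case (Suc k)
  from Suc.IH[of "\<lambda>i. f (Suc i)"] Suc.prems
  obtain y where y: "\<And>i. i < k \<Longrightarrow> expansion y i = f (Suc i)" by blast
  obtain z where z: "f 0 = fn z" using Suc.prems[of 0] by blast
  let ?x = "sec (f 0) + t * y"
  have fn: "fn ?x = f 0" by (simp add: fn_add fn_t z fn_sec)
  have "next_coeff ?x - y \<in> K"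
    by (rule next_coeff_unique) (simp add: fn two_sided_ideal_zero[OF two_sided_K])
  then have "expansion ?x (Suc i) = expansion y i" for i
    by (simp add: expansion_Suc expansion_cong)
  then have "\<forall>i<Suc k. expansion ?x i = f i"
    using fn y by (auto simp: expansion_0 less_Suc_eq_0_disj)
  then show ?case by blast
qed simp

section \<open>The quotient algebra as a quantization\<close>

lemma cls_eq_iff: "cls x = cls y \<longleftrightarrow> x - y \<in> J"
  by (rule quotient_class_eq_iff)

lemma scalar_mult_cls: "scalar p \<otimes>\<^bsub>Q\<^esub> cls x = cls (const p * x)"
  by (simp add: quotient_scalar_def quotient_class_mult)

lemma carrier_Q: "carrier Q = range cls"
  by (rule carrier_quotient_algebra)

definition rep_of :: "'n word_poly set set \<Rightarrow> 'n word_poly"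
  where "rep_of q = (SOME x. cls x = q)"

lemma cls_rep_of: "cls (rep_of (cls x)) = cls x"
  unfolding rep_of_def by (rule someI) (rule refl)

lemma rep_of_cls: "rep_of (cls x) - x \<in> K"
  using cls_rep_of[of x] J_subset_K by (auto simp: cls_eq_iff)

definition classical_limit :: "'n word_poly set set \<Rightarrow> complex ^ 'n ^ 'n \<Rightarrow> complex"
  where "classical_limit q = restrict (fn (rep_of q)) Orb"

lemma classical_limit_cls: "classical_limit (cls x) = restrict (fn x) Orb"
  by (simp add: classical_limit_def fn_cong_K[OF rep_of_cls])

lemma restrict_fn: "restrict (fn x) Orb = restrict (\<lambda>A. value_at A x) Orb"
  by (auto simp: fn_def fun_eq_iff)

lemma restrict_fn_eq_iff: "restrict (fn x) Orb = restrict (fn y) Orb \<longleftrightarrow> fn x = fn y"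
  by (auto simp: fn_def fun_eq_iff restrict_def)

lemma carrier_function_algebra: "carrier (function_algebra Orb) = range (\<lambda>x. restrict (fn x) Orb)"
proof -
  have *: "(poly_functions :: (complex ^ 'n ^ 'n \<Rightarrow> complex) set) = range (\<lambda>x A. value_at A x)"
    using poly_functions_value_at value_at_poly_functions by auto
  show ?thesis by (simp add: function_algebra_def restrict_fn * image_image)
qed

lemma fn_mult: "restrict (fn (x * y)) Orb = (\<lambda>A\<in>Orb. fn x A * fn y A)"
  by (auto simp: fn_def value_at_mult fun_eq_iff)

lemma fn_uminus: "fn (- x) = - fn x"
  using fn_diff[of 0 x] by (simp only: fn_zero diff_0)

lemma fn_commutator: "fn (x * y - y * x) = 0"
  by (auto simp: fn_def value_at_mult value_at_diff fun_eq_iff)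

text \<open>An algebraic substitute for the tangency of Hamiltonian vector fields to the orbit.
  Writing \<open>x - x'\<close> as \<open>t * q\<close> modulo \<open>J\<close> and cancelling
  \<open>t\<close> modulo \<open>K\<close> leaves the commutator of \<open>q\<close> and
  \<open>y\<close>, whose classical limit is zero.\<close>

lemma bracket_lift_cong_left:
  assumes fn: "fn x = fn x'" and z: "bracket_lift J x y z" and z': "bracket_lift J x' y z'"
  shows "fn z = fn z'"
proof -
  have "fn (x - x') = 0" by (simp add: fn_diff fn)
  then obtain q where q: "x - x' - t * q \<in> J" using fn_zero_t_multiple by blast
  have 1: "(x * y - y * x - t * z) - (x' * y - y * x' - t * z') \<in> J"
    by (rule two_sided_ideal_diff[OF two_sided_J conjunct1[OF z[unfolded bracket_lift_def]]
          conjunct1[OF z'[unfolded bracket_lift_def]]])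
  have 2: "(x - x' - t * q) * y - y * (x - x' - t * q) \<in> J"
    by (rule two_sided_ideal_diff[OF two_sided_J two_sided_ideal_rmult[OF two_sided_J q] two_sided_ideal_lmult[OF two_sided_J q]])
  have "t * ((z - z') - (q * y - y * q)) = ((x - x' - t * q) * y - y * (x - x' - t * q))
      - ((x * y - y * x - t * z) - (x' * y - y * x' - t * z'))"
    by (simp add: left_diff_distrib right_diff_distrib mult.assoc const_left_commute[of y])
  also have "\<dots> \<in> K"
    by (rule subsetD[OF J_subset_K two_sided_ideal_diff[OF two_sided_J 2 1]])
  finally have "(z - z') - (q * y - y * q) \<in> K" by (rule K_saturated)
  then have "fn (z - z') = fn (q * y - y * q)" by (rule fn_cong_K)
  then have "fn z - fn z' = 0" by (simp only: fn_diff[of z z'] fn_commutator)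
  then show ?thesis by (rule eq_iff_diff_eq_0[THEN iffD2])
qed

lemma bracket_lift_cong:
  assumes "fn x = fn x'" "fn y = fn y'" and z: "bracket_lift J x y z" and z': "bracket_lift J x' y' z'"
  shows "fn z = fn z'"
proof -
  obtain w where w: "bracket_lift J x' y w" using bracket_lift_exists[OF two_sided_J gl_J] by blast
  have "fn z = fn w" by (rule bracket_lift_cong_left[OF assms(1) z w])
  moreover have "fn (- w) = fn (- z')"
    by (rule bracket_lift_cong_left[OF assms(2) bracket_lift_swap[OF two_sided_J gl_J w] bracket_lift_swap[OF two_sided_J gl_J z']])
  then have "fn w = fn z'" unfolding fn_uminus by (rule neg_equal_iff_equal[THEN iffD1])
  ultimately show ?thesis by simp
qed

text \<open>The definite description is meaningful because any polynomial extensions are classical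
  limits of words, have a lift of their bracket, and \<open>bracket_lift_cong\<close> shows that all
  these lifts agree on the orbit.\<close>

lemma kks_bracket_cls:
  assumes z: "bracket_lift J x y z"
  shows "kks_bracket Orb (classical_limit (cls x)) (classical_limit (cls y)) = classical_limit (cls z)"
proof -
  have val: "restrict (lie_poisson (\<lambda>A. value_at A x) (\<lambda>A. value_at A y)) Orb = restrict (fn z) Orb"
    if "bracket_lift J x y z" for x y z
    using that by (auto simp: bracket_lift_def restrict_fn)
  show ?thesis
    unfolding kks_bracket_def classical_limit_cls
  proof (rule the_equality)
    show "\<exists>F\<in>poly_functions. \<exists>G\<in>poly_functions. restrict F Orb = restrict (fn x) Orb \<and>
        restrict G Orb = restrict (fn y) Orb \<and> restrict (fn z) Orb = restrict (lie_poisson F G) Orb"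
      using val[OF z] by (intro bexI[of _ "\<lambda>A. value_at A x"] bexI[of _ "\<lambda>A. value_at A y"])
        (simp_all add: restrict_fn value_at_poly_functions)
  next
    fix h assume "\<exists>F\<in>poly_functions. \<exists>G\<in>poly_functions. restrict F Orb = restrict (fn x) Orb \<and>
        restrict G Orb = restrict (fn y) Orb \<and> h = restrict (lie_poisson F G) Orb"
    then obtain F G where FG: "F \<in> poly_functions" "G \<in> poly_functions"
      "restrict F Orb = restrict (fn x) Orb" "restrict G Orb = restrict (fn y) Orb"
      "h = restrict (lie_poisson F G) Orb" by blast
    obtain x' y' where F: "F = (\<lambda>A. value_at A x')" and G: "G = (\<lambda>A. value_at A y')"
      using poly_functions_value_at[OF FG(1)] poly_functions_value_at[OF FG(2)] by blast
    obtain z' where z': "bracket_lift J x' y' z'" using bracket_lift_exists[OF two_sided_J gl_J] by blast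
    have "fn x' = fn x" "fn y' = fn y"
      using FG(3,4) by (simp_all add: F G flip: restrict_fn restrict_fn_eq_iff)
    then have "fn z' = fn z" using bracket_lift_cong z z' by blast
    then show "h = restrict (fn z) Orb" using FG(5) val[OF z'] by (simp add: F G)
  qed
qed

definition completion_map :: "'n word_poly set set \<Rightarrow> nat \<Rightarrow> complex ^ 'n ^ 'n \<Rightarrow> complex"
  where "completion_map q i = restrict (expansion (rep_of q) i) Orb"

lemma completion_map_cls: "completion_map (cls x) i = restrict (expansion x i) Orb"
  by (simp add: completion_map_def expansion_cong[OF rep_of_cls])

lemma expansion_fn: "\<exists>y. expansion x i = fn y"
  by (auto simp: expansion_def)

lemma is_completion_map_completion_map:
  "is_completion_map Q scalar (function_algebra Orb) (const_function Orb) completion_map"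
  unfolding is_completion_map_def carrier_Q
proof (intro conjI ballI allI impI)
  fix q i assume "q \<in> range cls"
  then obtain x where q: "q = cls x" by blast
  obtain y where "expansion x i = fn y" using expansion_fn by blast
  then show "completion_map q i \<in> carrier (function_algebra Orb)"
    by (auto simp: q completion_map_cls carrier_function_algebra)
next
  fix p q i assume "p \<in> range cls" "q \<in> range cls"
  then obtain x y where pq: "p = cls x" "q = cls y" by blast
  show "completion_map (p \<oplus>\<^bsub>Q\<^esub> q) i = completion_map p i \<oplus>\<^bsub>function_algebra Orb\<^esub> completion_map q i"
    unfolding pq quotient_class_add completion_map_cls expansion_add
    by (simp add: function_algebra_def restrict_def fun_eq_iff)
next
  fix c q i assume "q \<in> range cls"
  then obtain x where q: "q = cls x" by blast
  show "completion_map (scalar [:c:] \<otimes>\<^bsub>Q\<^esub> q) i = const_function Orb c \<otimes>\<^bsub>function_algebra Orb\<^esub> completion_map q i"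
    unfolding q scalar_mult_cls completion_map_cls expansion_scale
    by (simp add: function_algebra_def const_function_def restrict_def fun_eq_iff)
next
  fix q assume "q \<in> range cls"
  then obtain x where q: "q = cls x" by blast
  show "completion_map (scalar t_poly \<otimes>\<^bsub>Q\<^esub> q) 0 = \<zero>\<^bsub>function_algebra Orb\<^esub>"
    unfolding q scalar_mult_cls completion_map_cls expansion_t_0 by (simp add: function_algebra_def zero_fun_def)
  show "completion_map (scalar t_poly \<otimes>\<^bsub>Q\<^esub> q) (Suc i) = completion_map q i" for i
    by (simp only: q scalar_mult_cls completion_map_cls expansion_t_Suc)
next
  fix k q assume "q \<in> range cls" and zero: "\<forall>i<k. completion_map q i = \<zero>\<^bsub>function_algebra Orb\<^esub>"
  then obtain x where q: "q = cls x" by blast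
  have "expansion x i = 0" if "i < k" for i
  proof -
    obtain y where y: "expansion x i = fn y" using expansion_fn by blast
    have "restrict (expansion x i) Orb = (\<lambda>A\<in>Orb. 0)"
      using zero that by (simp add: q completion_map_cls function_algebra_def)
    then have "restrict (fn y) Orb = restrict (fn 0) Orb"
      unfolding y restrict_fn[of 0] value_at_zero .
    then have "fn y = fn 0" by (rule restrict_fn_eq_iff[THEN iffD1])
    then show ?thesis by (simp only: y fn_zero)
  qed
  then obtain y where "x - const (t_poly ^ k) * y \<in> J" using expansion_zero_imp by blast
  then have "q = scalar (t_poly ^ k) \<otimes>\<^bsub>Q\<^esub> cls y" by (simp add: q scalar_mult_cls cls_eq_iff)
  then show "\<exists>q'\<in>range cls. q = scalar (t_poly ^ k) \<otimes>\<^bsub>Q\<^esub> q'" by blast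
next
  fix k and f :: "nat \<Rightarrow> complex ^ 'n ^ 'n \<Rightarrow> complex"
  assume "\<forall>i. f i \<in> carrier (function_algebra Orb)"
  then have "\<forall>i. \<exists>y. f i = restrict (fn y) Orb"
    unfolding carrier_function_algebra by blast
  then obtain y where y: "\<And>i. f i = restrict (fn (y i)) Orb"
    using choice[of "\<lambda>i y. f i = restrict (fn y) Orb"] by blast
  obtain x where "\<forall>i<k. expansion x i = fn (y i)"
    using expansion_exists[of "\<lambda>i. fn (y i)" k] by blast
  then have "\<forall>i<k. completion_map (cls x) i = f i" by (simp add: completion_map_cls y)
  then show "\<exists>q\<in>range cls. \<forall>i<k. completion_map q i = f i" by blast
qed

theorem is_quantization_classical_limit:
  "is_quantization Q scalar (function_algebra Orb) (const_function Orb) (kks_bracket Orb) classical_limit"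
  unfolding is_quantization_def
proof (intro conjI)
  show "classical_limit \<in> ring_hom Q (function_algebra Orb)"
  proof (rule ring_hom_memI)
    fix p assume "p \<in> carrier Q"
    then show "classical_limit p \<in> carrier (function_algebra Orb)"
      by (auto simp: carrier_Q classical_limit_cls carrier_function_algebra)
  next
    fix p q assume "p \<in> carrier Q" "q \<in> carrier Q"
    then obtain x y where pq: "p = cls x" "q = cls y" by (auto simp: carrier_Q)
    show "classical_limit (p \<otimes>\<^bsub>Q\<^esub> q) = classical_limit p \<otimes>\<^bsub>function_algebra Orb\<^esub> classical_limit q"
      unfolding pq quotient_class_mult classical_limit_cls fn_mult
      by (simp add: function_algebra_def restrict_def fun_eq_iff)
    show "classical_limit (p \<oplus>\<^bsub>Q\<^esub> q) = classical_limit p \<oplus>\<^bsub>function_algebra Orb\<^esub> classical_limit q"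
      unfolding pq quotient_class_add classical_limit_cls fn_add
      by (simp add: function_algebra_def restrict_def fun_eq_iff)
  next
    show "classical_limit \<one>\<^bsub>Q\<^esub> = \<one>\<^bsub>function_algebra Orb\<^esub>"
      by (simp add: quotient_class_one classical_limit_cls restrict_fn value_at_one function_algebra_def)
  qed
  show "\<forall>p. classical_limit (scalar p) = const_function Orb (coeff p 0)"
    by (simp add: quotient_scalar_def classical_limit_cls restrict_fn value_at_const const_function_def)
  show "classical_limit ` carrier Q = carrier (function_algebra Orb)"
    unfolding carrier_Q carrier_function_algebra image_image classical_limit_cls ..
  show "a_kernel Q (function_algebra Orb) classical_limit = {scalar t_poly \<otimes>\<^bsub>Q\<^esub> q |q. q \<in> carrier Q}"
  proof -
    have *: "classical_limit (cls x) = \<zero>\<^bsub>function_algebra Orb\<^esub> \<longleftrightarrow> (\<exists>y. cls x = scalar t_poly \<otimes>\<^bsub>Q\<^esub> cls y)" for x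
    proof -
      have "classical_limit (cls x) = \<zero>\<^bsub>function_algebra Orb\<^esub> \<longleftrightarrow> restrict (fn x) Orb = restrict (fn 0) Orb"
        by (simp add: classical_limit_cls function_algebra_def) (simp add: restrict_fn value_at_zero)
      also have "\<dots> \<longleftrightarrow> fn x = 0" using restrict_fn_eq_iff[of x 0] by (simp only: fn_zero)
      also have "\<dots> \<longleftrightarrow> (\<exists>y. x - t * y \<in> J)"
      proof
        assume "\<exists>y. x - t * y \<in> J"
        then obtain y where "x - t * y \<in> J" by blast
        then have "fn x = fn (t * y)" using J_subset_K by (intro fn_cong_K) blast
        then show "fn x = 0" by (simp only: fn_t)
      qed (rule fn_zero_t_multiple)
      finally show ?thesis by (simp add: scalar_mult_cls cls_eq_iff)
    qed
    show ?thesis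
      unfolding a_kernel_def' carrier_Q
    proof (intro equalityI subsetI)
      fix q assume "q \<in> {r \<in> range cls. classical_limit r = \<zero>\<^bsub>function_algebra Orb\<^esub>}"
      then obtain x where "q = cls x" "classical_limit (cls x) = \<zero>\<^bsub>function_algebra Orb\<^esub>" by blast
      then show "q \<in> {scalar t_poly \<otimes>\<^bsub>Q\<^esub> q |q. q \<in> range cls}" unfolding * by blast
    next
      fix q assume "q \<in> {scalar t_poly \<otimes>\<^bsub>Q\<^esub> q |q. q \<in> range cls}"
      then obtain y where y: "q = scalar t_poly \<otimes>\<^bsub>Q\<^esub> cls y" by blast
      then have q: "q = cls (t * y)" by (simp only: scalar_mult_cls)
      have "classical_limit q = \<zero>\<^bsub>function_algebra Orb\<^esub>"
        unfolding q * using y unfolding q by blast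
      then show "q \<in> {r \<in> range cls. classical_limit r = \<zero>\<^bsub>function_algebra Orb\<^esub>}"
        unfolding q by blast
    qed
  qed
  show "\<exists>\<phi>. is_completion_map Q scalar (function_algebra Orb) (const_function Orb) \<phi> \<and>
      (\<forall>q\<in>carrier Q. \<phi> q 0 = classical_limit q)"
    by (intro exI[of _ completion_map] conjI is_completion_map_completion_map) (auto simp: carrier_Q completion_map_cls classical_limit_cls expansion_0)
  show "\<forall>a\<in>carrier Q. \<forall>b\<in>carrier Q. \<exists>c\<in>carrier Q.
      a \<otimes>\<^bsub>Q\<^esub> b \<ominus>\<^bsub>Q\<^esub> b \<otimes>\<^bsub>Q\<^esub> a = scalar t_poly \<otimes>\<^bsub>Q\<^esub> c \<and>
      classical_limit c = kks_bracket Orb (classical_limit a) (classical_limit b)"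
    unfolding carrier_Q
  proof (intro ballI)
    fix a b assume "a \<in> range cls" "b \<in> range cls"
    then obtain x y where ab: "a = cls x" "b = cls y" by blast
    obtain z where z: "bracket_lift J x y z" using bracket_lift_exists[OF two_sided_J gl_J] by blast
    then have "cls (x * y - y * x) = cls (t * z)" by (simp add: cls_eq_iff bracket_lift_def)
    then have "a \<otimes>\<^bsub>Q\<^esub> b \<ominus>\<^bsub>Q\<^esub> b \<otimes>\<^bsub>Q\<^esub> a = scalar t_poly \<otimes>\<^bsub>Q\<^esub> cls z"
      by (simp add: ab quotient_class_mult quotient_class_minus scalar_mult_cls)
    moreover have "classical_limit (cls z) = kks_bracket Orb (classical_limit a) (classical_limit b)"
      unfolding ab by (rule kks_bracket_cls[OF z, symmetric])
    ultimately show "\<exists>c\<in>range cls. a \<otimes>\<^bsub>Q\<^esub> b \<ominus>\<^bsub>Q\<^esub> b \<otimes>\<^bsub>Q\<^esub> a = scalar t_poly \<otimes>\<^bsub>Q\<^esub> c \<and>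
        classical_limit c = kks_bracket Orb (classical_limit a) (classical_limit b)"
      by blast
  qed
qed

lemma classical_limit_gen:
  "classical_limit (cls (gen i j)) = restrict (trace_function (matrix_unit i j)) Orb"
  unfolding classical_limit_cls restrict_fn
  by (rule restrict_ext) (simp add: value_at_gen trace_function_matrix_unit)

end

section \<open>The adjoint action\<close>

text \<open>The adjoint action by the Lie bracket itself, without a factor \<open>t\<close>: in the
  enveloping algebra with parameter \<open>t\<close>, the commutator with a generator is
  \<open>t\<close> times this derivation.\<close>

primrec word_deriv :: "'n \<times> 'n \<Rightarrow> ('n \<times> 'n) list \<Rightarrow> (('n \<times> 'n) list \<Rightarrow>\<^sub>0 'r::comm_ring_1)" where
  "word_deriv p [] = 0"
| "word_deriv p (a # w) = gl_bracket (fst p) (snd p) (fst a) (snd a) * monomial w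
    + gen (fst a) (snd a) * word_deriv p w"

definition deriv_by :: "'n \<times> 'n \<Rightarrow> (('n \<times> 'n) list \<Rightarrow>\<^sub>0 'r) \<Rightarrow> (('n \<times> 'n) list \<Rightarrow>\<^sub>0 'r::comm_ring_1)"
  where "deriv_by p = monoid_algebra_eval const (word_deriv p)"

interpretation deriv: monoid_algebra_linear const
    "word_deriv p :: ('n \<times> 'n) list \<Rightarrow> (('n \<times> 'n) list \<Rightarrow>\<^sub>0 'r::comm_ring_1)"
  rewrites "monoid_algebra_eval const (word_deriv p) = deriv_by p" for p :: "'n \<times> 'n"
  by unfold_locales (simp_all add: const_add deriv_by_def)

lemma word_deriv_append: "word_deriv p (v @ w) = word_deriv p v * monomial w + monomial v * word_deriv p w"
  by (induction v) (simp_all add: monomial_append monomial_Cons algebra_simps)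

lemma deriv_by_mult: "deriv_by p (x * y) = deriv_by p x * y + x * deriv_by p y"
proof (induction x rule: poly_mapping_single_induct)
  case (single v c)
  show ?case
  proof (induction y rule: poly_mapping_single_induct)
    case (single w d)
    have "deriv_by p (Poly_Mapping.single v c * Poly_Mapping.single w d)
        = const c * (const d * (word_deriv p v * monomial w + monomial v * word_deriv p w))"
      by (simp add: mult_single deriv.ev_single plus_list_def word_deriv_append const_mult mult.assoc)
    also have "\<dots> = const c * (word_deriv p v * (const d * monomial w)) + const c * (monomial v * (const d * word_deriv p w))"
      by (simp add: distrib_left const_left_commute[of "word_deriv p v"] const_left_commute[of "monomial v"])
    finally show ?case
      unfolding deriv.ev_single by (simp only: single_eq_const_monomial mult.assoc)
  qed (simp add: distrib_left deriv.ev_add)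
qed (simp add: distrib_right deriv.ev_add)

lemma deriv_by_const: "deriv_by p (const c) = 0"
  by (simp add: const_def deriv.ev_single)

lemma deriv_by_gen: "deriv_by p (gen i j) = gl_bracket (fst p) (snd p) i j"
  by (simp add: gen_def[of i j] monomial_def[of "[(i, j)]"] deriv.ev_single)

lemma deriv_by_one: "deriv_by p 1 = 0"
  using deriv_by_const[of p 1] by simp

lemma deriv_by_const_mult: "deriv_by p (const c * x) = const c * deriv_by p x"
  by (simp add: deriv_by_mult deriv_by_const)

lemma deriv_by_if: "deriv_by p (if b then x else 0) = (if b then deriv_by p x else 0)"
  by (simp add: deriv.ev_zero)

text \<open>Both sides are derivations in \<open>x\<close>, so they need to be compared on
  generators only, where the equation is the Jacobi identity for matrix units.\<close>

lemma deriv_by_commutator: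
  "deriv_by (i, j) (deriv_by (m, k) x) - deriv_by (m, k) (deriv_by (i, j) x)
    = (if m = j then deriv_by (i, k) x else 0) - (if i = k then deriv_by (m, j) x else 0)"
proof (induction x rule: free_algebra_induct)
  case (const c)
  then show ?case by (simp add: deriv_by_const deriv.ev_zero)
next
  case (gen a b)
  show ?case
    by (auto simp: deriv_by_gen gl_bracket_def deriv.ev_diff deriv_by_if)
next
  case (add x y)
  have *: "deriv_by (i, j) (deriv_by (m, k) (x + y)) - deriv_by (m, k) (deriv_by (i, j) (x + y))
      = (deriv_by (i, j) (deriv_by (m, k) x) - deriv_by (m, k) (deriv_by (i, j) x))
      + (deriv_by (i, j) (deriv_by (m, k) y) - deriv_by (m, k) (deriv_by (i, j) y))"
    by (simp add: deriv.ev_add)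
  show ?case unfolding * add by (simp add: deriv.ev_add)
next
  case (mult x y)
  have *: "deriv_by (i, j) (deriv_by (m, k) (x * y)) - deriv_by (m, k) (deriv_by (i, j) (x * y))
      = (deriv_by (i, j) (deriv_by (m, k) x) - deriv_by (m, k) (deriv_by (i, j) x)) * y
      + x * (deriv_by (i, j) (deriv_by (m, k) y) - deriv_by (m, k) (deriv_by (i, j) y))"
    by (simp add: deriv.ev_add deriv_by_mult algebra_simps)
  show ?case unfolding * mult by (auto simp: deriv_by_mult algebra_simps)
qed

text \<open>The relations transform like a tensor in their four indices, so their span is stable.
  For the bracket term this is the Jacobi identity.\<close>

lemma deriv_by_gl_relation:
  fixes s :: "'r::comm_ring_1"
  defines "R \<equiv> \<lambda>i j m k. gen i j * gen m k - gen m k * gen i j - const s * gl_bracket i j m k"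
  shows "deriv_by (p, q) (R i j m k) = (if i = q then R p j m k else 0) - (if p = j then R i q m k else 0)
    + (if m = q then R i j p k else 0) - (if p = k then R i j m q else 0)"
proof -
  have jacobi: "deriv_by (p, q) (gl_bracket i j m k) = (if i = q then gl_bracket p j m k else 0)
      - (if p = j then gl_bracket i q m k else 0) + (if m = q then gl_bracket i j p k else 0)
      - (if p = k then gl_bracket i j m q else (0 :: ('a \<times> 'a) list \<Rightarrow>\<^sub>0 'r))"
    by (auto simp: gl_bracket_def deriv.ev_diff deriv_by_if deriv_by_gen)
  have "deriv_by (p, q) (R i j m k) = gl_bracket p q i j * gen m k + gen i j * gl_bracket p q m k
      - (gl_bracket p q m k * gen i j + gen m k * gl_bracket p q i j)
      - const s * deriv_by (p, q) (gl_bracket i j m k)"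
    by (simp add: R_def deriv.ev_diff deriv_by_mult deriv_by_const deriv_by_gen)
  also have "\<dots> = (if i = q then R p j m k else 0) - (if p = j then R i q m k else 0)
    + (if m = q then R i j p k else 0) - (if p = k then R i j m q else 0)"
    unfolding jacobi gl_bracket_def[of p q] R_def
    by (simp add: left_diff_distrib right_diff_distrib distrib_left distrib_right)
  finally show ?thesis .
qed

text \<open>Scalar matrices are invariant, so both factors transform like the matrix of generators
  itself, and such a law is inherited by products.\<close>

lemma deriv_by_quadratic:
  fixes c1 c2 :: complex
  defines "R \<equiv> \<lambda>j m. ((gen_matrix - mat (const [:c1:])) ** (gen_matrix - mat (const [:c2:]))) $ j $ m"
  shows "deriv_by (p, q) (R j m) = (if m = q then R j p else 0) - (if p = j then R q m else 0)"
proof -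
  define A where "A c = (gen_matrix - mat (const [:c:]) :: 'a word_poly ^ 'a ^ 'a)" for c
  have A: "deriv_by (p, q) (A c $ j $ k) = (if k = q then A c $ j $ p else 0) - (if p = j then A c $ q $ k else 0)"
    for c j k
    by (auto simp: A_def gen_matrix_def mat_def deriv.ev_diff deriv_by_gen deriv_by_if deriv_by_const gl_bracket_def)
  have R: "R j m = (\<Sum>k\<in>UNIV. A c1 $ j $ k * A c2 $ k $ m)" for j m
    unfolding R_def A_def matrix_matrix_mult_def by simp
  have "deriv_by (p, q) (R j m) = (\<Sum>k\<in>UNIV. ((if k = q then A c1 $ j $ p else 0) - (if p = j then A c1 $ q $ k else 0)) * A c2 $ k $ m
      + A c1 $ j $ k * ((if m = q then A c2 $ k $ p else 0) - (if p = k then A c2 $ q $ m else 0)))"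
    by (simp only: R deriv.ev_sum deriv_by_mult A)
  \<comment> \<open>The first and the last sum come from the contracted index \<open>k\<close>; each
    collapses to the same product, so that they cancel.\<close>
  also have "\<dots> = (\<Sum>k\<in>UNIV. (if k = q then A c1 $ j $ p * A c2 $ q $ m else 0))
      - (\<Sum>k\<in>UNIV. if p = j then A c1 $ q $ k * A c2 $ k $ m else 0)
      + (\<Sum>k\<in>UNIV. if m = q then A c1 $ j $ k * A c2 $ k $ p else 0)
      - (\<Sum>k\<in>UNIV. if k = p then A c1 $ j $ p * A c2 $ q $ m else 0)"
    unfolding sum.distrib[symmetric] sum_subtractf[symmetric]
    by (intro sum.cong refl) (auto simp: left_diff_distrib right_diff_distrib)
  also have "\<dots> = (if m = q then R j p else 0) - (if p = j then R q m else 0)"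
    by (simp add: R)
  finally show ?thesis .
qed

lemma deriv_by_trace: "deriv_by (p, q) (trace (gen_matrix :: ('n::finite) word_poly ^ 'n ^ 'n)) = 0"
proof -
  have "deriv_by (p, q) (gen j j) = (if j = q then gen p q else 0) - (if j = p then gen p q else (0 :: 'n word_poly))" for j
    by (auto simp: deriv_by_gen gl_bracket_def)
  then show ?thesis
    by (simp add: trace_def gen_matrix_def deriv.ev_sum sum_subtractf)
qed

text \<open>It suffices to treat the generating relations, as the elements of \<open>?J\<close> with
  derivative in \<open>?J\<close> form an ideal. Intersecting with \<open>?J\<close> matters: the
  derivative of \<open>z * x\<close> contains \<open>deriv_by p z * x\<close>.\<close>

lemma deriv_by_relation_ideal:
  fixes x :: "('n::finite) word_poly"
  assumes "x \<in> relation_ideal \<mu>1 \<mu>2 n1 n2"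
  shows "deriv_by p x \<in> relation_ideal \<mu>1 \<mu>2 n1 n2"
proof -
  let ?J = "relation_ideal \<mu>1 \<mu>2 n1 n2 :: 'n word_poly set"
  have J: "two_sided_ideal ?J" by (rule two_sided_relation_ideal)
  have if_J: "(if b then y else 0) \<in> ?J" if "y \<in> ?J" for b y
    using that two_sided_ideal_zero[OF J] by simp
  obtain i' j' where p: "p = (i', j')" by (cases p)
  have "?J \<subseteq> {x \<in> ?J. deriv_by p x \<in> ?J}"
  proof (rule relation_ideal_minimal)
    show "two_sided_ideal {x \<in> ?J. deriv_by p x \<in> ?J}"
      by (rule two_sided_idealI)
        (simp_all add: deriv.ev_zero deriv.ev_add deriv_by_mult two_sided_ideal_zero[OF J]
          two_sided_ideal_add[OF J] two_sided_ideal_lmult[OF J] two_sided_ideal_rmult[OF J])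
    show "gl_relations t_poly \<subseteq> {x \<in> ?J. deriv_by p x \<in> ?J}"
    proof
      fix x :: "'n word_poly" assume x: "x \<in> gl_relations t_poly"
      define R where "R i j m k = gen i j * gen m k - gen m k * gen i j - const t_poly * (gl_bracket i j m k :: 'n word_poly)"
        for i j m k
      have R: "R i j m k \<in> ?J" for i j m k
        using gl_relations_in_relation_ideal unfolding gl_relations_def R_def by blast
      obtain i j m k where xR: "x = R i j m k" using x by (auto simp: gl_relations_def R_def)
      have "deriv_by p x \<in> ?J"
        unfolding p xR R_def deriv_by_gl_relation
        by (intro two_sided_ideal_diff[OF J] two_sided_ideal_add[OF J] if_J R[unfolded R_def])
      then show "x \<in> {x \<in> ?J. deriv_by p x \<in> ?J}" using R xR by simp
    qed
    show "orbit_relations \<mu>1 \<mu>2 n1 n2 \<subseteq> {x \<in> ?J. deriv_by p x \<in> ?J}"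
    proof
      fix x :: "'n word_poly" assume x: "x \<in> orbit_relations \<mu>1 \<mu>2 n1 n2"
      define R where "R j m = ((gen_matrix - mat (const [:\<mu>1:])) ** (gen_matrix - mat (const [:\<mu>2:])) :: 'n word_poly ^ 'n ^ 'n) $ j $ m"
        for j m
      have R: "R j m \<in> ?J" for j m
        using orbit_relations_in_relation_ideal[of \<mu>1 \<mu>2 n1 n2] unfolding orbit_relations_def R_def by blast
      have "deriv_by p x \<in> ?J"
        using x unfolding orbit_relations_def
      proof (elim UnE)
        assume "x \<in> {((gen_matrix - mat (const [:\<mu>1:])) ** (gen_matrix - mat (const [:\<mu>2:]))) $ j $ m | j m. True}"
        then obtain j m where xR: "x = R j m" by (auto simp: R_def)
        show ?thesis
          unfolding p xR R_def deriv_by_quadratic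
          by (intro two_sided_ideal_diff[OF J] if_J R[unfolded R_def])
      next
        assume "x \<in> {trace gen_matrix - const ([:of_nat n1 * \<mu>1 + of_nat n2 * \<mu>2:] + t_poly * of_nat (n1 * n2))}"
        then show ?thesis
          by (simp only: singleton_iff deriv.ev_diff p deriv_by_trace deriv_by_const diff_zero two_sided_ideal_zero[OF J])
      qed
      then show "x \<in> {x \<in> ?J. deriv_by p x \<in> ?J}" using x orbit_relations_in_relation_ideal by blast
    qed
  qed
  then show ?thesis using assms by blast
qed

section \<open>The action of the enveloping algebra\<close>

definition deriv_op_by :: "'n \<times> 'n \<Rightarrow> ('n word_poly) endo"
  where "deriv_op_by p = Endo (deriv_by p)"

definition const_op :: "complex \<Rightarrow> ('n word_poly) endo"
  where "const_op c = Endo (\<lambda>x. const [:c:] * x)"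

lemma app_deriv_op_by: "app (deriv_op_by p) x = deriv_by p x"
  by (simp add: deriv_op_by_def app_Endo deriv.ev_add)

lemma app_const_op: "app (const_op c) x = const [:c:] * x"
  by (simp add: const_op_def app_Endo distrib_left)

definition adjoint_op :: "(('n \<times> 'n) list \<Rightarrow>\<^sub>0 complex) \<Rightarrow> ('n word_poly) endo"
  where "adjoint_op = free_eval const_op deriv_op_by"

interpretation adjoint: free_hom const_op "deriv_op_by :: 'n \<times> 'n \<Rightarrow> ('n word_poly) endo"
  rewrites "free_eval const_op deriv_op_by = adjoint_op"
proof -
  show "free_hom const_op (deriv_op_by :: 'n \<times> 'n \<Rightarrow> ('n word_poly) endo)"
  proof
    fix a b :: complex and p :: "'n \<times> 'n"
    have c: "const [:a + b:] = const [:a:] + const [:b:]" "const [:a * b:] = const [:a:] * const [:b:]"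
      "const [:1:] = (1 :: 'n word_poly)"
      using const_add[of "[:a:]" "[:b:]"] const_mult[of "[:a:]" "[:b:]"] const_one
      by (simp_all add: mult.commute flip: one_pCons)
    show "const_op (a + b) = (const_op a + const_op b :: ('n word_poly) endo)"
      by (rule endo_eqI) (simp add: app_const_op app_plus c distrib_right)
    show "const_op (a * b) = (const_op a * const_op b :: ('n word_poly) endo)"
      by (rule endo_eqI) (simp add: app_const_op app_times c mult.assoc)
    show "const_op 1 = (1 :: ('n word_poly) endo)"
      by (rule endo_eqI) (simp add: app_const_op app_one c)
    show "const_op a * deriv_op_by p = deriv_op_by p * const_op a"
      by (rule endo_eqI) (simp add: app_const_op app_times app_deriv_op_by deriv_by_const_mult)
  qed
qed (simp add: adjoint_op_def)

lemma adjoint_op_gl_ideal: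
  assumes "u \<in> gl_ideal 1"
  shows "adjoint_op u = 0"
proof -
  have "gl_ideal 1 \<subseteq> {u :: ('a \<times> 'a) list \<Rightarrow>\<^sub>0 complex. adjoint_op u = 0}"
  proof (rule gl_ideal_minimal)
    show "two_sided_ideal {u :: ('a \<times> 'a) list \<Rightarrow>\<^sub>0 complex. adjoint_op u = 0}"
      by (rule two_sided_idealI) (simp_all add: adjoint.ev_zero adjoint.ev_add adjoint.ev_mult)
    have "adjoint_op (gen i j * gen m k - gen m k * gen i j - const 1 * gl_bracket i j m k) = (0 :: ('a word_poly) endo)"
      for i j m k
    proof (rule endo_eqI)
      fix x :: "'a word_poly"
      have "app (adjoint_op (gl_bracket i j m k)) x
          = (if m = j then deriv_by (i, k) x else 0) - (if i = k then deriv_by (m, j) x else 0)"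
        by (simp add: gl_bracket_def adjoint.ev_diff adjoint.ev_zero adjoint.ev_gen app_minus app_zero app_deriv_op_by)
      then show "app (adjoint_op (gen i j * gen m k - gen m k * gen i j - const 1 * gl_bracket i j m k)) x = app 0 x"
        using deriv_by_commutator[of i j m k x]
        by (simp add: adjoint.ev_diff adjoint.ev_mult adjoint.ev_gen app_minus app_times app_deriv_op_by app_zero)
    qed
    then show "gl_relations 1 \<subseteq> {u :: ('a \<times> 'a) list \<Rightarrow>\<^sub>0 complex. adjoint_op u = 0}"
      by (auto simp: gl_relations_def)
  qed
  then show ?thesis using assms by blast
qed

lemma adjoint_op_relation_ideal:
  fixes x :: "('n::finite) word_poly"
  assumes "x \<in> relation_ideal \<mu>1 \<mu>2 n1 n2"
  shows "app (adjoint_op u) x \<in> relation_ideal \<mu>1 \<mu>2 n1 n2"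
  using assms
  by (induction u arbitrary: x rule: free_algebra_induct)
    (simp_all add: adjoint.ev_const adjoint.ev_gen adjoint.ev_add adjoint.ev_mult app_const_op
      app_deriv_op_by app_plus app_times deriv_by_relation_ideal
      two_sided_ideal_lmult[OF two_sided_relation_ideal] two_sided_ideal_add[OF two_sided_relation_ideal])

lemma adjoint_op_const_mult: "app (adjoint_op u) (const p * x) = const p * app (adjoint_op u) x"
proof (induction u arbitrary: x rule: free_algebra_induct)
  case (const c)
  show ?case by (simp only: adjoint.ev_const app_const_op const_left_commute[of "const [:c:]"])
qed (simp_all add: adjoint.ev_gen adjoint.ev_add adjoint.ev_mult app_deriv_op_by app_plus app_times
    deriv_by_const_mult distrib_left)

lemma adjoint_op_monomial_Cons:
  "app (adjoint_op (monomial (a # w))) x = deriv_by a (app (adjoint_op (monomial w)) x)"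
  by (simp add: adjoint.ev_monomial app_times app_deriv_op_by)

lemma adjoint_op_monomial_one: "app (adjoint_op (monomial w)) 1 = (if w = [] then 1 else 0)"
proof (induction w)
  case (Cons a w)
  then show ?case by (simp add: adjoint_op_monomial_Cons deriv_by_one deriv.ev_zero)
qed (simp add: adjoint.ev_one app_one)

text \<open>Subsets are split according to whether they contain position 0, with the other positions
  shifted by one, as in removing the first letter of a word.\<close>

lemma sum_Pow_lessThan_Suc:
  "(\<Sum>S\<in>Pow {..<Suc n}. f S) = (\<Sum>S\<in>Pow {..<n}. f (insert 0 (Suc ` S)) + f (Suc ` S))"
proof -
  have inj: "inj_on ((`) Suc) (Pow {..<n})" "inj_on (\<lambda>S. insert 0 (Suc ` S)) (Pow {..<n})"
    by (simp_all add: inj_on_def inj_image_eq_iff insert_ident)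
  have "Pow {..<Suc n} = (`) Suc ` Pow {..<n} \<union> (\<lambda>S. insert 0 (Suc ` S)) ` Pow {..<n}"
    by (simp only: lessThan_Suc_eq_insert_0 Pow_insert image_Pow_surj[OF refl, symmetric] image_image)
  moreover have "(`) Suc ` Pow {..<n} \<inter> (\<lambda>S. insert 0 (Suc ` S)) ` Pow {..<n} = {}"
    by auto
  ultimately have "(\<Sum>S\<in>Pow {..<Suc n}. f S)
      = (\<Sum>S\<in>Pow {..<n}. f (Suc ` S)) + (\<Sum>S\<in>Pow {..<n}. f (insert 0 (Suc ` S)))"
    using inj by (simp add: sum.union_disjoint sum.reindex[OF inj(1)] sum.reindex[OF inj(2)])
  then show ?thesis by (simp add: sum.distrib add.commute)
qed

text \<open>The iterated Leibniz rule: the first letter acts as a derivation, so it joins either the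
  subword acting on \<open>x\<close> or the complementary subword acting on
  \<open>y\<close>.\<close>

lemma adjoint_op_monomial_mult:
  "app (adjoint_op (monomial w)) (x * y) = (\<Sum>S\<in>Pow {..<length w}.
    app (adjoint_op (monomial (nths w S))) x * app (adjoint_op (monomial (nths w (- S)))) y)"
proof (induction w)
  case Nil
  show ?case by (simp add: adjoint.ev_one app_one)
next
  case (Cons a w)
  have n: "nths (a # w) (insert 0 (Suc ` S)) = a # nths w S" "nths (a # w) (- insert 0 (Suc ` S)) = nths w (- S)"
    "nths (a # w) (Suc ` S) = nths w S" "nths (a # w) (- (Suc ` S)) = a # nths w (- S)" for S
    by (auto simp: nths_Cons intro!: arg_cong[of _ _ "nths w"])
  show ?case
    unfolding adjoint_op_monomial_Cons Cons deriv.ev_sum deriv_by_mult length_Cons sum_Pow_lessThan_Suc n ..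
qed

context symmetric_orbit
begin

definition adjoint_action ::
    "(('n \<times> 'n) list \<Rightarrow>\<^sub>0 complex) set \<Rightarrow> 'n word_poly set set \<Rightarrow> 'n word_poly set set"
  where "adjoint_action u q = cls (app (adjoint_op (SOME v. env_class 1 v = u)) (rep_of q))"

text \<open>Independence of both representatives: the relations of the enveloping algebra act by
  zero on words, and every operator maps \<open>J\<close> into itself.\<close>

lemma adjoint_action_cls: "adjoint_action (env_class 1 u) (cls x) = cls (app (adjoint_op u) x)"
proof -
  define v where "v = (SOME v. env_class 1 v = env_class 1 u)"
  have "env_class 1 v = env_class 1 u" unfolding v_def by (rule someI) (rule refl)
  then have "adjoint_op (v - u) = 0" by (intro adjoint_op_gl_ideal) (simp add: env_class_eq_iff)
  then have v: "adjoint_op v = adjoint_op u" by (simp add: adjoint.ev_diff)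
  have "rep_of (cls x) - x \<in> J" using cls_rep_of[of x] by (simp only: cls_eq_iff)
  then have "app (adjoint_op u) (rep_of (cls x) - x) \<in> J" by (rule adjoint_op_relation_ideal)
  then show ?thesis
    by (simp add: adjoint_action_def v cls_eq_iff app_diff_right flip: v_def)
qed

lemma finsum_cls: "finite A \<Longrightarrow> finsum Q (\<lambda>a. cls (f a)) A = cls (\<Sum>a\<in>A. f a)"
proof (induction A rule: finite_induct)
  case empty
  interpret ring Q by (rule ring_quotient_algebra)
  show ?case by (simp add: quotient_class_zero)
next
  case (insert a A)
  interpret ring Q by (rule ring_quotient_algebra)
  have "finsum Q (\<lambda>a. cls (f a)) (insert a A) = cls (f a) \<oplus>\<^bsub>Q\<^esub> finsum Q (\<lambda>a. cls (f a)) A"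
    using insert(1,2) by (intro finsum_insert) (simp_all add: carrier_Q)
  then show ?case using insert by (simp add: quotient_class_add)
qed

lemma is_module_algebra_adjoint_action: "is_module_algebra Q scalar adjoint_action"
  unfolding is_module_algebra_def Let_def carrier_Q carrier_env_algebra
proof (intro conjI)
  let ?U = "env_algebra (1 :: complex)"
  show "\<forall>u\<in>range (env_class 1). \<forall>a\<in>range cls. adjoint_action u a \<in> range cls"
    by (auto simp: adjoint_action_cls)
  show "\<forall>u\<in>range (env_class 1). \<forall>v\<in>range (env_class 1). \<forall>a\<in>range cls.
      adjoint_action (u \<oplus>\<^bsub>?U\<^esub> v) a = adjoint_action u a \<oplus>\<^bsub>Q\<^esub> adjoint_action v a"
    by (auto simp: env_class_add adjoint_action_cls adjoint.ev_add app_plus quotient_class_add)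
  show "\<forall>u\<in>range (env_class 1). \<forall>a\<in>range cls. \<forall>b\<in>range cls.
      adjoint_action u (a \<oplus>\<^bsub>Q\<^esub> b) = adjoint_action u a \<oplus>\<^bsub>Q\<^esub> adjoint_action u b"
    by (auto simp: adjoint_action_cls app_add quotient_class_add)
  show "\<forall>u\<in>range (env_class 1). \<forall>v\<in>range (env_class 1). \<forall>a\<in>range cls.
      adjoint_action (u \<otimes>\<^bsub>?U\<^esub> v) a = adjoint_action u (adjoint_action v a)"
    by (auto simp: env_class_mult adjoint_action_cls adjoint.ev_mult app_times)
  show "\<forall>c. \<forall>a\<in>range cls. adjoint_action (env_class 1 (const c)) a = scalar [:c:] \<otimes>\<^bsub>Q\<^esub> a"
    by (auto simp: adjoint_action_cls adjoint.ev_const app_const_op scalar_mult_cls)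
  show "\<forall>u\<in>range (env_class 1). \<forall>p. \<forall>a\<in>range cls.
      adjoint_action u (scalar p \<otimes>\<^bsub>Q\<^esub> a) = scalar p \<otimes>\<^bsub>Q\<^esub> adjoint_action u a"
    by (auto simp: adjoint_action_cls scalar_mult_cls adjoint_op_const_mult)
  show "\<forall>w. \<forall>a\<in>range cls. \<forall>b\<in>range cls. adjoint_action (env_class 1 (monomial w)) (a \<otimes>\<^bsub>Q\<^esub> b) =
      (\<Oplus>\<^bsub>Q\<^esub>S\<in>Pow {..<length w}. adjoint_action (env_class 1 (monomial (nths w S))) a \<otimes>\<^bsub>Q\<^esub>
        adjoint_action (env_class 1 (monomial (nths w (- S)))) b)"
  proof (intro allI ballI)
    fix w and a b :: "'n word_poly set set" assume "a \<in> range cls" "b \<in> range cls"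
    then obtain x y where ab: "a = cls x" "b = cls y" by blast
    show "adjoint_action (env_class 1 (monomial w)) (a \<otimes>\<^bsub>Q\<^esub> b) =
      (\<Oplus>\<^bsub>Q\<^esub>S\<in>Pow {..<length w}. adjoint_action (env_class 1 (monomial (nths w S))) a \<otimes>\<^bsub>Q\<^esub>
        adjoint_action (env_class 1 (monomial (nths w (- S)))) b)"
      unfolding ab quotient_class_mult adjoint_action_cls adjoint_op_monomial_mult
      by (subst finsum_cls) simp_all
  qed
  show "\<forall>w. adjoint_action (env_class 1 (monomial w)) \<one>\<^bsub>Q\<^esub> = (if w = [] then \<one>\<^bsub>Q\<^esub> else \<zero>\<^bsub>Q\<^esub>)"
    by (simp add: quotient_class_one quotient_class_zero adjoint_action_cls adjoint_op_monomial_one)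
qed

lemma adjoint_action_gen:
  "adjoint_action (env_class 1 (gen i j)) (cls (gen m k)) = cls (gl_bracket i j m k)"
  by (simp add: adjoint_action_cls adjoint.ev_gen app_deriv_op_by deriv_by_gen)

end

text \<open>The values on generators identify the two maps: since \<sigma> is multiplicative with
  prescribed scalars, it must be the evaluation given by the trace pairing, and the module algebra
  laws determine \<open>act\<close> as the adjoint action.\<close>

theorem corollary4p17:
  fixes \<mu>1 \<mu>2 :: complex and n1 n2 :: nat
  assumes "\<mu>1 \<noteq> \<mu>2" and "n1 > 0" and "n2 > 0" and "n1 + n2 = CARD('n::finite)"
  defines "Q \<equiv> (quotient_algebra \<mu>1 \<mu>2 n1 n2 :: 'n word_poly set set ring)"
    and "cls \<equiv> (quotient_class \<mu>1 \<mu>2 n1 n2 :: 'n word_poly \<Rightarrow> _)"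
    and "\<iota> \<equiv> (quotient_scalar \<mu>1 \<mu>2 n1 n2 :: _ \<Rightarrow> 'n word_poly set set)"
    and "Orb \<equiv> (orbit \<mu>1 \<mu>2 n1 n2 :: (complex ^ 'n ^ 'n) set)"
  shows "(\<exists>\<sigma>. is_quantization Q \<iota> (function_algebra Orb) (const_function Orb) (kks_bracket Orb) \<sigma>
            \<and> (\<forall>i j. \<sigma> (cls (gen i j)) = restrict (trace_function (matrix_unit i j)) Orb))
       \<and> (\<exists>act. is_module_algebra Q \<iota> act
            \<and> (\<forall>i j m k. act (env_class 1 (gen i j)) (cls (gen m k)) = cls (gl_bracket i j m k)))"
proof -
  interpret symmetric_orbit \<mu>1 \<mu>2 n1 n2 "TYPE('n)"
    using assms(1,4) by unfold_locales
  show ?thesis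
    unfolding Q_def cls_def \<iota>_def Orb_def
    using is_quantization_classical_limit classical_limit_gen is_module_algebra_adjoint_action adjoint_action_gen
    by blast
qed

end
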